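(* Let $(E,d)$ be a Polish space, $E_1'$ a Borel subset of $\mathbb{R}^e$, $E_2'$ a Polish space, $F:E\times E_1'\times E_2'\to E$ measurable, and set $f_t(x)=F(x,Z_{t-1},\varepsilon_t)$, $f_s^t=f_t\circ\cdots\circ f_s$ for $s\le t$ (with $f_t^{t-1}(x)=x$), and $\mathcal{F}_t=\sigma((Z_j,\varepsilon_j):j\le t)$. Let $p\ge1$ and $x_0\in E$ be such that: (A0) $Z=(Z_t)_{t\in\mathbb{Z}}$ is an $E_1'$-valued stationary ergodic process, $(\varepsilon_t)_{t\in\mathbb{Z}}$ is an i.i.d. $E_2'$-valued sequence, independent of $Z$; (A1') for every $z\in E_1'$, $\mathbb{E}[d^p(F(x_0,z,\varepsilon_1),x_0)]<\infty$; (A2') there is a measurable $\kappa:E_1'\to(0,\infty)$ with $\mathbb{E}[\log^+\kappa(Z_0)]<\infty$, $\mathbb{E}[\log\kappa(Z_0)]<0$, such that for all $(x,y)\in E^2$ and $z\in E_1'$, $\mathbb{E}[d^p(F(x,z,\varepsilon_0),F(y,z,\varepsilon_0))]\le\kappa^p(z)d^p(x,y)$; moreover $\mathbb{E}\big[\log^+\int d^p(x_0,F(x_0,Z_0,u))\,d\mathbb{P}_{\varepsilon_1}(u)\big]<\infty$. Then: 1. For every $(x,t)\in E\times\mathbb{Z}$ there is a random variable $X_t(x)$ with $\mathbb{E}[d^p(X_t(x),x_0)\mid Z]<\infty$ a.s. and $\lim_{s\to\infty}\mathbb{E}[d^p(f_{t-s}^t(x),X_t(x))\mid Z]=0$ a.s.;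 also $f_{t-s}^t(x)\to X_t(x)$ a.s. as $s\to\infty$. 2. For $x\neq y$, $\mathbb{P}(X_t(x)\ne X_t(y))=0$; one sets $X_t=X_t(x)$. 3. The process $((X_t,Z_t))_{t\in\mathbb{Z}}$ is stationary and ergodic. 4. If $(Y_t)_{t\in\mathbb{Z}}$ is non-anticipative ($Y_t$ is $\mathcal{F}_t$-measurable), $((Y_t,Z_t))_t$ is stationary, $Y_t=f_t(Y_{t-1})$ for all $t$, and $\mathbb{E}[d^p(Y_0,x_0)\mid Z_0,Z_{-1},\dots]<\infty$ a.s., then $Y_t=X_t$ a.s.
   Context: $\mathbb{E}[\,\cdot\mid Z]$ denotes conditional expectation given the whole process $(Z_t)_{t\in\mathbb{Z}}$. $\log^+(x)=\log x$ if $x\ge1$ and $0$ otherwise. $\mathbb{P}_{\varepsilon_1}$ is the law of $\varepsilon_1$. *)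

theory Defs
  imports "HOL-Probability.Probability"
begin

definition logplus :: "real \<Rightarrow> real" where
  "logplus x = (if x \<ge> 1 then ln x else 0)"

definition proc_law :: "'a measure \<Rightarrow> (int \<Rightarrow> 'a \<Rightarrow> 'b::topological_space) \<Rightarrow> (int \<Rightarrow> 'b) measure" where
  "proc_law M Y = distr M (Pi\<^sub>M UNIV (\<lambda>_. borel)) (\<lambda>\<omega> t. Y t \<omega>)"

definition stationary_process :: "'a measure \<Rightarrow> (int \<Rightarrow> 'a \<Rightarrow> 'b::topological_space) \<Rightarrow> bool" where
  "stationary_process M Y \<longleftrightarrow>
     (\<forall>t. Y t \<in> borel_measurable M) \<and>
     (\<forall>h::int. proc_law M (\<lambda>t. Y (t + h)) = proc_law M Y)"

definition ergodic_process :: "'a measure \<Rightarrow> (int \<Rightarrow> 'a \<Rightarrow> 'b::topological_space) \<Rightarrow> bool" where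
  "ergodic_process M Y \<longleftrightarrow> stationary_process M Y \<and>
     (\<forall>A \<in> sets (Pi\<^sub>M UNIV (\<lambda>_::int. (borel :: 'b measure))).
        (\<lambda>w t. w (t + 1)) -` A \<inter> space (Pi\<^sub>M UNIV (\<lambda>_::int. (borel :: 'b measure))) = A
        \<longrightarrow> measure (proc_law M Y) A = 0 \<or> measure (proc_law M Y) A = 1)"

definition proc_sigma :: "'a measure \<Rightarrow> int set \<Rightarrow> (int \<Rightarrow> 'a \<Rightarrow> 'b::topological_space) \<Rightarrow> 'a measure" where
  "proc_sigma M I Y = vimage_algebra (space M) (\<lambda>\<omega>. \<lambda>j\<in>I. Y j \<omega>) (Pi\<^sub>M I (\<lambda>_. borel))"

text \<open>Iterated random maps: iterF F Z eps t n x = f_t o ... o f_(t-n+1) (x),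
  where f_t(x) = F x (Z (t-1)) (eps t). Hence f_(t-s)^t(x) = iterF F Z eps t (Suc s) x
  and f_t^(t-1)(x) = iterF F Z eps t 0 x = x.\<close>
fun iterF :: "('e \<Rightarrow> 'z \<Rightarrow> 'w \<Rightarrow> 'e) \<Rightarrow> (int \<Rightarrow> 'a \<Rightarrow> 'z) \<Rightarrow> (int \<Rightarrow> 'a \<Rightarrow> 'w)
              \<Rightarrow> int \<Rightarrow> nat \<Rightarrow> 'e \<Rightarrow> 'a \<Rightarrow> 'e" where
  "iterF F Z eps t 0 x \<omega> = x"
| "iterF F Z eps t (Suc n) x \<omega> = F (iterF F Z eps (t - 1) n x \<omega>) (Z (t - 1) \<omega>) (eps t \<omega>)"

end

theory Submission
  imports Defs
begin

text \<open>
  Conditionally on \<open>Z\<close> the maps \<open>f_t\<close> are independent, and \<open>f_t\<close> contracts in conditional \<open>L^p\<close>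
  by the factor \<open>\<kappa> (Z (t - 1))\<close>. Since \<open>E log \<kappa>(Z_0) < 0\<close>, the maximal ergodic lemma gives
  \<open>\<kappa>(Z_(t-1)) \<dots> \<kappa>(Z_(t-n)) \<le> C exp (- \<delta> n)\<close> almost surely, while the logarithmic moment and
  Borel--Cantelli make \<open>E[d^p (f_(t-n)(x0), x0) | Z]\<close> subexponential in \<open>n\<close>. Hence, for a suitable
  \<open>\<rho> < 1\<close>, the weighted sum \<open>Q = \<Sum>k. \<rho>^(-2k) d^p (k-th increment)\<close> of the backward iterates has
  finite conditional expectation. A finite \<open>Q\<close> bounds every increment by a geometric sequence,
  which yields the almost sure limit and both conditional statements without any use of
  Minkowski's inequality.

  The limit is \<open>X_t = \<phi>(shift^t (Z, eps))\<close>, so ergodicity reduces to that of the pair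
  \<open>(Z, eps)\<close>: an invariant event is approximated by events depending on \<open>Z\<close> and on \<open>eps\<close> from
  some time on; shifting these far to the right makes them conditionally independent of any given
  past of \<open>eps\<close>, so the event is conditionally trivial, and its conditional probability given \<open>Z\<close>
  is invariant, hence constant.

  A stationary solution \<open>Y\<close> is compared with the iterates started at \<open>x0\<close> at time \<open>t - n\<close>: the
  product of the contraction factors tends to \<open>0\<close>, and on a set of probability close to \<open>1\<close>,
  uniformly in \<open>n\<close> by stationarity, \<open>Y_(t-n)\<close> has a bounded truncated moment; so the distance
  tends to \<open>0\<close> in probability.
\<close>

section \<open>Independence and conditional expectation\<close>

text \<open>Only logarithmic moments of the environment are available, so the conditional bounds
  need not be integrable, and conditional expectations are fixed only up to null sets. Conditional
  inequalities are therefore proved in integrated form, tested against nonnegative functions of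
  \<open>Z\<close>, and localised on the sets where the majorant is at most \<open>n\<close>; there
  all integrals are finite. The noise is integrated out one variable at a time. For this the
  reference sigma-algebra at each time carries the complete trajectory of \<open>Z\<close>, future
  included, so that a factor depending on any \<open>Z s\<close> is a constant in every step.

  Ergodicity is a statement about exactly invariant sets. The objects to which it is applied
  (unboundedness of partial sums, the conditional probability of an invariant event, the limit
  itself) are accordingly built as functions defined on every path, and their behaviour under the
  shift is an identity and not an almost sure statement.\<close>

text \<open>The library predicate \<open>indep_var\<close> forces both variables to take values in the same type.\<close>
definition (in prob_space) indep_pair ::
    "'b measure \<Rightarrow> ('a \<Rightarrow> 'b) \<Rightarrow> 'c measure \<Rightarrow> ('a \<Rightarrow> 'c) \<Rightarrow> bool" where
  "indep_pair S X T Y \<longleftrightarrow> X \<in> M \<rightarrow>\<^sub>M S \<and> Y \<in> M \<rightarrow>\<^sub>M T \<and>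
     distr M S X \<Otimes>\<^sub>M distr M T Y = distr M (S \<Otimes>\<^sub>M T) (\<lambda>\<omega>. (X \<omega>, Y \<omega>))"

lemma (in prob_space) indep_pairI:
  assumes [measurable]: "X \<in> M \<rightarrow>\<^sub>M S" "Y \<in> M \<rightarrow>\<^sub>M T"
    and ind: "\<And>A B. A \<in> sets S \<Longrightarrow> B \<in> sets T \<Longrightarrow>
      prob ((X -` A \<inter> space M) \<inter> (Y -` B \<inter> space M)) = prob (X -` A \<inter> space M) * prob (Y -` B \<inter> space M)"
  shows "indep_pair S X T Y"
  unfolding indep_pair_def
proof (intro conjI pair_measure_eqI)
  fix A B assume AB: "A \<in> sets (distr M S X)" "B \<in> sets (distr M T Y)"
  then have [measurable]: "A \<in> sets S" "B \<in> sets T" by auto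
  have "(\<lambda>\<omega>. (X \<omega>, Y \<omega>)) -` (A \<times> B) \<inter> space M = (X -` A \<inter> space M) \<inter> (Y -` B \<inter> space M)"
    by auto
  then show "emeasure (distr M S X) A * emeasure (distr M T Y) B =
      emeasure (distr M (S \<Otimes>\<^sub>M T) (\<lambda>\<omega>. (X \<omega>, Y \<omega>))) (A \<times> B)"
    by (simp add: emeasure_distr emeasure_eq_measure ind ennreal_mult'[symmetric])
qed (auto intro!: prob_space_imp_sigma_finite prob_space_distr)

lemma (in prob_space) indep_pairD:
  assumes "indep_pair S X T Y" and [measurable]: "A \<in> sets S" "B \<in> sets T"
  shows "prob ((X -` A \<inter> space M) \<inter> (Y -` B \<inter> space M)) = prob (X -` A \<inter> space M) * prob (Y -` B \<inter> space M)"
proof -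
  have [measurable]: "X \<in> M \<rightarrow>\<^sub>M S" "Y \<in> M \<rightarrow>\<^sub>M T"
    and eq: "distr M (S \<Otimes>\<^sub>M T) (\<lambda>\<omega>. (X \<omega>, Y \<omega>)) = distr M S X \<Otimes>\<^sub>M distr M T Y"
    using assms by (auto simp: indep_pair_def)
  interpret Y: prob_space "distr M T Y" by (rule prob_space_distr) simp
  have "(X -` A \<inter> space M) \<inter> (Y -` B \<inter> space M) = (\<lambda>\<omega>. (X \<omega>, Y \<omega>)) -` (A \<times> B) \<inter> space M"
    by auto
  then have "emeasure M ((X -` A \<inter> space M) \<inter> (Y -` B \<inter> space M)) =
      emeasure (distr M (S \<Otimes>\<^sub>M T) (\<lambda>\<omega>. (X \<omega>, Y \<omega>))) (A \<times> B)"
    by (simp add: emeasure_distr)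
  also have "\<dots> = emeasure M (X -` A \<inter> space M) * emeasure M (Y -` B \<inter> space M)"
    by (simp add: eq Y.emeasure_pair_measure_Times emeasure_distr)
  finally show ?thesis
    by (simp add: emeasure_eq_measure ennreal_mult'[symmetric])
qed

lemma (in prob_space) indep_pair_measurable:
  "indep_pair S X T Y \<Longrightarrow> X \<in> M \<rightarrow>\<^sub>M S" "indep_pair S X T Y \<Longrightarrow> Y \<in> M \<rightarrow>\<^sub>M T"
  by (auto simp: indep_pair_def)

text \<open>Only the sigma-algebras generated by \<open>X\<close> and \<open>Y\<close> matter, and
  each of their events is already a preimage of a set from \<open>S\<close> or \<open>T\<close>.
  Hence \<open>R\<close> need not be displayed as a function of \<open>X\<close>, which later lets
  any variable measurable for the past be separated from the next noise value.\<close>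

lemma (in prob_space) indep_pair_vimage_algebra:
  assumes XY: "indep_pair S X T Y" and R: "R \<in> vimage_algebra (space M) X S \<rightarrow>\<^sub>M N"
    and R': "R' \<in> vimage_algebra (space M) Y T \<rightarrow>\<^sub>M N'"
  shows "indep_pair N R N' R'"
proof (rule indep_pairI)
  note [measurable] = indep_pair_measurable[OF XY]
  show "R \<in> M \<rightarrow>\<^sub>M N" "R' \<in> M \<rightarrow>\<^sub>M N'"
    by (rule measurable_compose[of id M _ R, simplified, OF measurable_vimage_algebra2 R]
      measurable_compose[of id M _ R', simplified, OF measurable_vimage_algebra2 R'];
      simp add: measurable_space[OF indep_pair_measurable(1)[OF XY]] measurable_space[OF indep_pair_measurable(2)[OF XY]])+
  fix A B assume AB: "A \<in> sets N" "B \<in> sets N'"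
  have "R -` A \<inter> space M \<in> sets (vimage_algebra (space M) X S)"
    using measurable_sets[OF R AB(1)] by simp
  moreover have "R' -` B \<inter> space M \<in> sets (vimage_algebra (space M) Y T)"
    using measurable_sets[OF R' AB(2)] by simp
  moreover have "X \<in> space M \<rightarrow> space S" "Y \<in> space M \<rightarrow> space T"
    using indep_pair_measurable[OF XY] by (auto intro: measurable_space)
  ultimately obtain A' B' where "A' \<in> sets S" "R -` A \<inter> space M = X -` A' \<inter> space M"
    "B' \<in> sets T" "R' -` B \<inter> space M = Y -` B' \<inter> space M"
    by (auto simp: sets_vimage_algebra2)
  then show "prob ((R -` A \<inter> space M) \<inter> (R' -` B \<inter> space M)) = prob (R -` A \<inter> space M) * prob (R' -` B \<inter> space M)"
    using indep_pairD[OF XY] by simp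
qed

lemma (in prob_space) indep_pair_compose:
  assumes XY: "indep_pair S X T Y" and f: "f \<in> S \<rightarrow>\<^sub>M N" and g: "g \<in> T \<rightarrow>\<^sub>M N'"
  shows "indep_pair N (\<lambda>\<omega>. f (X \<omega>)) N' (\<lambda>\<omega>. g (Y \<omega>))"
proof (rule indep_pair_vimage_algebra[OF XY])
  have "X \<in> space M \<rightarrow> space S" "Y \<in> space M \<rightarrow> space T"
    using indep_pair_measurable[OF XY] by (auto intro: measurable_space)
  then show "(\<lambda>\<omega>. f (X \<omega>)) \<in> vimage_algebra (space M) X S \<rightarrow>\<^sub>M N"
    "(\<lambda>\<omega>. g (Y \<omega>)) \<in> vimage_algebra (space M) Y T \<rightarrow>\<^sub>M N'"
    using f g by (auto intro: measurable_compose[OF measurable_vimage_algebra1])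
qed

text \<open>Fubini on the triple product law: \<open>X\<close> splits off from the pair, then
  \<open>Y\<close> from \<open>V\<close>. This merges the independence of \<open>Z\<close> and the
  noise with the independence among blocks of noise.\<close>

lemma (in prob_space) indep_pair_assoc:
  assumes X_YV: "indep_pair S X (T \<Otimes>\<^sub>M U) (\<lambda>\<omega>. (Y \<omega>, V \<omega>))"
    and Y_V: "indep_pair T Y U V"
  shows "indep_pair (S \<Otimes>\<^sub>M T) (\<lambda>\<omega>. (X \<omega>, Y \<omega>)) U V"
proof -
  have [measurable]: "X \<in> M \<rightarrow>\<^sub>M S" "Y \<in> M \<rightarrow>\<^sub>M T" "V \<in> M \<rightarrow>\<^sub>M U"
    using X_YV Y_V by (auto simp: indep_pair_def)
  let ?X = "distr M S X" and ?Y = "distr M T Y" and ?V = "distr M U V"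
  interpret X: prob_space ?X by (rule prob_space_distr) simp
  interpret Y: prob_space ?Y by (rule prob_space_distr) simp
  interpret V: prob_space ?V by (rule prob_space_distr) simp
  interpret XY: pair_prob_space ?X ?Y ..
  interpret YV: pair_prob_space ?Y ?V ..
  interpret XYV: pair_prob_space "distr M (S \<Otimes>\<^sub>M T) (\<lambda>\<omega>. (X \<omega>, Y \<omega>))" ?V
    by (intro pair_prob_space.intro pair_sigma_finite.intro prob_space_imp_sigma_finite
        prob_space_distr V.prob_space_axioms) simp_all
  have YV: "?Y \<Otimes>\<^sub>M ?V = distr M (T \<Otimes>\<^sub>M U) (\<lambda>\<omega>. (Y \<omega>, V \<omega>))"
    using Y_V by (simp add: indep_pair_def)
  have XYV: "?X \<Otimes>\<^sub>M (?Y \<Otimes>\<^sub>M ?V) = distr M (S \<Otimes>\<^sub>M (T \<Otimes>\<^sub>M U)) (\<lambda>\<omega>. (X \<omega>, Y \<omega>, V \<omega>))"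
    using X_YV by (simp add: indep_pair_def YV)
  have "indep_pair S X T Y"
    using indep_pair_compose[OF X_YV measurable_ident measurable_fst] by simp
  then have XY: "?X \<Otimes>\<^sub>M ?Y = distr M (S \<Otimes>\<^sub>M T) (\<lambda>\<omega>. (X \<omega>, Y \<omega>))"
    by (simp add: indep_pair_def)
  have "distr M (S \<Otimes>\<^sub>M T) (\<lambda>\<omega>. (X \<omega>, Y \<omega>)) \<Otimes>\<^sub>M ?V =
      distr M ((S \<Otimes>\<^sub>M T) \<Otimes>\<^sub>M U) (\<lambda>\<omega>. ((X \<omega>, Y \<omega>), V \<omega>))"
  proof (rule pair_measure_eqI)
    fix A B assume "A \<in> sets (distr M (S \<Otimes>\<^sub>M T) (\<lambda>\<omega>. (X \<omega>, Y \<omega>)))" "B \<in> sets ?V"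
    then have [measurable]: "A \<in> sets (S \<Otimes>\<^sub>M T)" "B \<in> sets U" by auto
    \<comment> \<open>\<open>A\<close> is an arbitrary measurable set of the product, not just a
      rectangle, so its event is rebracketed into the triple product and integrated coordinate by
      coordinate.\<close>
    let ?C = "{c \<in> space (S \<Otimes>\<^sub>M (T \<Otimes>\<^sub>M U)). (fst c, fst (snd c)) \<in> A \<and> snd (snd c) \<in> B}"
    have "emeasure (distr M ((S \<Otimes>\<^sub>M T) \<Otimes>\<^sub>M U) (\<lambda>\<omega>. ((X \<omega>, Y \<omega>), V \<omega>))) (A \<times> B) =
        emeasure (distr M (S \<Otimes>\<^sub>M (T \<Otimes>\<^sub>M U)) (\<lambda>\<omega>. (X \<omega>, Y \<omega>, V \<omega>))) ?C"
      using measurable_space[of X M S] measurable_space[of Y M T] measurable_space[of V M U]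
      by (subst (1 2) emeasure_distr)
        (auto intro!: arg_cong2[where f = emeasure] simp: space_pair_measure)
    also have "\<dots> = (\<integral>\<^sup>+ c. indicator ?C c \<partial>(?X \<Otimes>\<^sub>M (?Y \<Otimes>\<^sub>M ?V)))"
      unfolding XYV by (rule nn_integral_indicator[symmetric]) simp
    also have "\<dots> = (\<integral>\<^sup>+ x. \<integral>\<^sup>+ y. \<integral>\<^sup>+ v. indicator ?C (x, y, v) \<partial>?V \<partial>?Y \<partial>?X)"
    proof -
      have [measurable]: "indicator ?C \<in> borel_measurable (?X \<Otimes>\<^sub>M (?Y \<Otimes>\<^sub>M ?V))" by simp
      have "(\<integral>\<^sup>+ c. indicator ?C c \<partial>(?X \<Otimes>\<^sub>M (?Y \<Otimes>\<^sub>M ?V))) =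
          (\<integral>\<^sup>+ x. \<integral>\<^sup>+ yv. indicator ?C (x, yv) \<partial>(?Y \<Otimes>\<^sub>M ?V) \<partial>?X)"
        by (rule YV.nn_integral_fst[symmetric]) simp
      also have "\<dots> = (\<integral>\<^sup>+ x. \<integral>\<^sup>+ y. \<integral>\<^sup>+ v. indicator ?C (x, y, v) \<partial>?V \<partial>?Y \<partial>?X)"
        by (intro nn_integral_cong V.nn_integral_fst[symmetric]) simp
      finally show ?thesis .
    qed
    also have "\<dots> = (\<integral>\<^sup>+ x. \<integral>\<^sup>+ y. indicator A (x, y) * emeasure ?V B \<partial>?Y \<partial>?X)"
    proof (intro nn_integral_cong)
      fix x y assume xy: "x \<in> space ?X" "y \<in> space ?Y"
      have "(\<integral>\<^sup>+ v. indicator ?C (x, y, v) \<partial>?V) = (\<integral>\<^sup>+ v. indicator A (x, y) * indicator B v \<partial>?V)"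
        using xy by (intro nn_integral_cong) (auto simp: space_pair_measure split: split_indicator)
      then show "(\<integral>\<^sup>+ v. indicator ?C (x, y, v) \<partial>?V) = indicator A (x, y) * emeasure ?V B"
        by (simp add: nn_integral_cmult)
    qed
    also have "\<dots> = (\<integral>\<^sup>+ c. indicator A c * emeasure ?V B \<partial>(?X \<Otimes>\<^sub>M ?Y))"
      by (rule Y.nn_integral_fst) simp
    also have "\<dots> = emeasure (?X \<Otimes>\<^sub>M ?Y) A * emeasure ?V B"
      by (subst nn_integral_multc) simp_all
    finally show "emeasure (distr M (S \<Otimes>\<^sub>M T) (\<lambda>\<omega>. (X \<omega>, Y \<omega>))) A * emeasure ?V B =
        emeasure (distr M ((S \<Otimes>\<^sub>M T) \<Otimes>\<^sub>M U) (\<lambda>\<omega>. ((X \<omega>, Y \<omega>), V \<omega>))) (A \<times> B)"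
      by (simp add: XY)
  qed (simp_all add: V.sigma_finite_measure_axioms XYV.M1.sigma_finite_measure_axioms)
  then show ?thesis
    by (simp add: indep_pair_def)
qed

text \<open>The freezing principle, that is, Fubini for the joint law; it takes the place of
  conditioning on \<open>X\<close>.\<close>

lemma (in prob_space) nn_integral_indep_pair:
  assumes "indep_pair S X T Y" and [measurable]: "f \<in> borel_measurable (S \<Otimes>\<^sub>M T)"
  shows "(\<integral>\<^sup>+ \<omega>. f (X \<omega>, Y \<omega>) \<partial>M) = (\<integral>\<^sup>+ \<omega>. \<integral>\<^sup>+ u. f (X \<omega>, u) \<partial>distr M T Y \<partial>M)"
proof -
  have [measurable]: "X \<in> M \<rightarrow>\<^sub>M S" "Y \<in> M \<rightarrow>\<^sub>M T"
    and eq: "distr M S X \<Otimes>\<^sub>M distr M T Y = distr M (S \<Otimes>\<^sub>M T) (\<lambda>\<omega>. (X \<omega>, Y \<omega>))"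
    using assms by (auto simp: indep_pair_def)
  interpret Y: prob_space "distr M T Y" by (rule prob_space_distr) simp
  have "(\<integral>\<^sup>+ \<omega>. f (X \<omega>, Y \<omega>) \<partial>M) = (\<integral>\<^sup>+ c. f c \<partial>(distr M S X \<Otimes>\<^sub>M distr M T Y))"
    unfolding eq by (simp add: nn_integral_distr)
  also have "\<dots> = (\<integral>\<^sup>+ x. \<integral>\<^sup>+ u. f (x, u) \<partial>distr M T Y \<partial>distr M S X)"
    by (rule Y.nn_integral_fst[symmetric]) simp
  also have "\<dots> = (\<integral>\<^sup>+ \<omega>. \<integral>\<^sup>+ u. f (X \<omega>, u) \<partial>distr M T Y \<partial>M)"
    by (rule nn_integral_distr) simp_all
  finally show ?thesis .
qed

section \<open>Tested inequalities and approximation of events\<close>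

lemma (in finite_measure_subalgebra) nn_cond_exp_le:
  assumes f[measurable]: "f \<in> borel_measurable M" and R[measurable]: "R \<in> borel_measurable F"
    and fin: "AE x in M. R x < \<infinity>"
    and le: "\<And>A. A \<in> sets F \<Longrightarrow> (\<integral>\<^sup>+ x. indicator A x * f x \<partial>M) \<le> (\<integral>\<^sup>+ x. indicator A x * R x \<partial>M)"
  shows "AE x in M. nn_cond_exp M F f x \<le> R x"
proof -
  let ?c = "nn_cond_exp M F f"
  have sp: "space F = space M" using subalg by (simp add: subalgebra_def)
  have [measurable]: "R \<in> borel_measurable M" by (rule measurable_from_subalg[OF subalg R])
  have "AE x in M. \<not> (R x \<le> of_nat n \<and> R x < ?c x)" for n
  proof -
    \<comment> \<open>The test set is where the claim fails, cut off at \<open>n\<close>. There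
      \<open>R\<close> has finite integral and can be subtracted, and the tested inequality forces
      the difference \<open>?c - R\<close> to have integral 0.\<close>
    define A where "A = {x \<in> space F. R x \<le> of_nat n \<and> R x < ?c x}"
    have A: "A \<in> sets F" unfolding A_def by measurable
    have [measurable]: "A \<in> sets M" using A subalg by (auto simp: subalgebra_def)
    have "(\<integral>\<^sup>+ x. indicator A x * R x \<partial>M) \<le> (\<integral>\<^sup>+ x. of_nat n \<partial>M)"
      by (intro nn_integral_mono) (auto simp: A_def split: split_indicator)
    also have "\<dots> < \<infinity>" by (simp add: emeasure_eq_measure ennreal_of_nat_eq_real_of_nat ennreal_mult''[symmetric])
    finally have finA: "(\<integral>\<^sup>+ x. indicator A x * R x \<partial>M) < \<infinity>" .
    have "(\<integral>\<^sup>+ x. indicator A x * ?c x \<partial>M) = (\<integral>\<^sup>+ x. indicator A x * f x \<partial>M)"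
      using A by (intro nn_cond_exp_intg) auto
    also note le[OF A]
    finally have *: "(\<integral>\<^sup>+ x. indicator A x * ?c x \<partial>M) \<le> (\<integral>\<^sup>+ x. indicator A x * R x \<partial>M)" .
    have "(\<integral>\<^sup>+ x. indicator A x * ?c x - indicator A x * R x \<partial>M) =
        (\<integral>\<^sup>+ x. indicator A x * ?c x \<partial>M) - (\<integral>\<^sup>+ x. indicator A x * R x \<partial>M)"
    proof (rule nn_integral_diff)
      show "AE x in M. indicator A x * R x \<le> indicator A x * ?c x"
        by (auto simp: A_def less_imp_le split: split_indicator)
    qed (use finA in auto)
    also have "\<dots> = 0" using * finA by (auto simp: diff_eq_0_iff_ennreal)
    finally have "AE x in M. indicator A x * ?c x - indicator A x * R x = 0"
      by (subst (asm) nn_integral_0_iff_AE) auto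
    then show ?thesis
      by (rule AE_mp) (auto intro!: AE_I2 simp: A_def sp diff_eq_0_iff_ennreal split: split_indicator_asm)
  qed
  then have "AE x in M. \<forall>n. \<not> (R x \<le> of_nat n \<and> R x < ?c x)" by (subst AE_all_countable) blast
  with fin show ?thesis
  proof eventually_elim
    case (elim x)
    then obtain n where "R x < of_nat n" using ennreal_Ex_less_of_nat[of "R x"] by auto
    then have "R x \<le> of_nat n" by (rule less_imp_le)
    with elim show ?case by (auto simp: not_less)
  qed
qed

text \<open>The approximable sets form a sigma-algebra. The case with content is a countable union:
  it is cut to a finite union up to \<open>e / 2\<close>, and each of the \<open>n\<close> pieces is
  then approximated with error \<open>e / (2 * (n + 1))\<close>.\<close>

lemma (in finite_measure) approx_by_algebra:
  assumes alg: "algebra (space M) G" and G: "G \<subseteq> sets M"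
    and A: "A \<in> sigma_sets (space M) G" and e: "0 < e"
  shows "\<exists>B\<in>G. measure M (sym_diff A B) < e"
  using A e
proof (induction arbitrary: e)
  case (Basic a)
  then show ?case by (intro bexI[of _ a]) auto
next
  case Empty
  interpret algebra "space M" G by fact
  show ?case using Empty by (intro bexI[of _ "{}"]) auto
next
  case (Compl a)
  interpret algebra "space M" G by fact
  obtain B where B: "B \<in> G" "measure M (sym_diff a B) < e"
    using Compl.IH[OF Compl.prems] by blast
  have "a \<subseteq> space M" using sigma_sets_into_sp[OF space_closed Compl.hyps] by simp
  moreover have "B \<subseteq> space M" using B sets_into_space by blast
  ultimately have "sym_diff (space M - a) (space M - B) = sym_diff a B" by auto
  then show ?case using B by (intro bexI[of _ "space M - B"]) auto
next
  case (Union a)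
  interpret algebra "space M" G by fact
  have sub: "sigma_sets (space M) G \<subseteq> sets M" using G by (rule sets.sigma_sets_subset)
  have a[measurable]: "a i \<in> sets M" for i using Union(1) sub by auto
  let ?U = "\<Union>i. a i" and ?V = "\<lambda>n. \<Union>i<n. a i"
  have "(\<lambda>n. measure M (?V n)) \<longlonglongrightarrow> measure M (\<Union>n. ?V n)"
    by (rule finite_Lim_measure_incseq) (auto simp: incseq_def intro: less_le_trans)
  also have "(\<Union>n. ?V n) = ?U" by auto
  finally have "eventually (\<lambda>n. measure M ?U - e / 2 < measure M (?V n)) sequentially"
    using Union(3) by (intro order_tendstoD) auto
  then obtain n where n: "measure M ?U - e / 2 < measure M (?V n)"
    by (auto simp: eventually_sequentially)
  have "\<exists>B\<in>G. measure M (sym_diff (a i) B) < e / (2 * (real n + 1))" for i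
    using Union(2)[of "e / (2 * (real n + 1))" i] Union(3) by simp
  then obtain B where B: "\<And>i. B i \<in> G" "\<And>i. measure M (sym_diff (a i) (B i)) < e / (2 * (real n + 1))"
    by metis
  have [measurable]: "B i \<in> sets M" for i using B G by auto
  have "measure M (sym_diff ?U (\<Union>i<n. B i)) \<le> measure M ((?U - ?V n) \<union> (\<Union>i<n. sym_diff (a i) (B i)))"
    by (intro finite_measure_mono) auto
  also have "\<dots> \<le> measure M (?U - ?V n) + measure M (\<Union>i<n. sym_diff (a i) (B i))"
    by (intro measure_Un_le) auto
  also have "measure M (?U - ?V n) = measure M ?U - measure M (?V n)"
    by (intro finite_measure_Diff) auto
  also have "measure M (\<Union>i<n. sym_diff (a i) (B i)) \<le> (\<Sum>i<n. measure M (sym_diff (a i) (B i)))"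
    by (intro measure_UNION_le) auto
  also have "\<dots> \<le> (\<Sum>i<n. e / (2 * (real n + 1)))"
    using B(2) by (intro sum_mono less_imp_le)
  also have "\<dots> \<le> e / 2" using Union(3) by (simp add: field_simps)
  finally have "measure M (sym_diff ?U (\<Union>i<n. B i)) < e" using n by simp
  then show ?case using B(1) by (intro bexI[of _ "\<Union>i<n. B i"]) auto
qed

section \<open>Stationary and ergodic processes\<close>

abbreviation path_space :: "(int \<Rightarrow> 'b::topological_space) measure" where
  "path_space \<equiv> Pi\<^sub>M UNIV (\<lambda>_. borel)"

lemma measurable_path [measurable (raw)]:
  "(\<And>t. Y t \<in> borel_measurable M) \<Longrightarrow> (\<lambda>\<omega> t. Y t \<omega>) \<in> M \<rightarrow>\<^sub>M path_space"
  by (rule measurable_PiM_single') auto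

lemma space_path_space [simp]: "space path_space = UNIV"
  by (simp add: space_PiM)

lemma UNIV_path_space: "UNIV \<in> sets path_space"
  using sets.top[of path_space] by simp

lemma prob_space_proc_law:
  "prob_space M \<Longrightarrow> (\<And>t. Y t \<in> borel_measurable M) \<Longrightarrow> prob_space (proc_law M Y)"
  unfolding proc_law_def by (intro prob_space.prob_space_distr measurable_path)

lemma sets_proc_law [measurable_cong, simp]: "sets (proc_law M Y) = sets path_space"
  by (simp add: proc_law_def)

lemma stationary_process_measurable:
  "stationary_process M Y \<Longrightarrow> Y t \<in> borel_measurable M"
  by (simp add: stationary_process_def)

lemma proc_law_shift:
  assumes "stationary_process M Y"
  shows "distr (proc_law M Y) path_space (\<lambda>w t. w (t + h)) = proc_law M Y"
proof -
  note [measurable] = stationary_process_measurable[OF assms]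
  have "distr (proc_law M Y) path_space (\<lambda>w t. w (t + h)) = proc_law M (\<lambda>t. Y (t + h))"
    unfolding proc_law_def by (subst distr_distr) (auto simp: comp_def)
  then show ?thesis using assms by (simp add: stationary_process_def)
qed

lemma stationary_process_nn_integral:
  assumes Y: "stationary_process M Y" and [measurable]: "f \<in> borel_measurable path_space"
  shows "(\<integral>\<^sup>+ \<omega>. f (\<lambda>t. Y (t + h) \<omega>) \<partial>M) = (\<integral>\<^sup>+ \<omega>. f (\<lambda>t. Y t \<omega>) \<partial>M)"
proof -
  note [measurable] = stationary_process_measurable[OF Y]
  have "(\<integral>\<^sup>+ \<omega>. f (\<lambda>t. Y (t + h) \<omega>) \<partial>M) = (\<integral>\<^sup>+ w. f w \<partial>proc_law M (\<lambda>t. Y (t + h)))"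
    unfolding proc_law_def by (simp add: nn_integral_distr)
  also have "\<dots> = (\<integral>\<^sup>+ w. f w \<partial>proc_law M Y)"
    using Y by (simp add: stationary_process_def)
  also have "\<dots> = (\<integral>\<^sup>+ \<omega>. f (\<lambda>t. Y t \<omega>) \<partial>M)"
    unfolding proc_law_def by (simp add: nn_integral_distr)
  finally show ?thesis .
qed

text \<open>The induced map \<Phi> on paths commutes exactly with the shift, so it pulls strictly
  invariant sets back to strictly invariant sets, and the law of the factor is the image
  law.\<close>

lemma ergodic_process_factor:
  fixes W :: "int \<Rightarrow> 'a \<Rightarrow> 'b::topological_space" and \<phi> :: "(int \<Rightarrow> 'b) \<Rightarrow> 'c::topological_space"
  assumes W: "ergodic_process M W" and \<phi>[measurable]: "\<phi> \<in> borel_measurable path_space"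
  shows "ergodic_process M (\<lambda>t \<omega>. \<phi> (\<lambda>s. W (t + s) \<omega>))"
proof -
  have stat: "stationary_process M W" using W by (simp add: ergodic_process_def)
  note [measurable] = stationary_process_measurable[OF stat]
  define \<Phi> where "\<Phi> w = (\<lambda>t. \<phi> (\<lambda>s. w (t + s)))" for w
  have \<Phi>[measurable]: "\<Phi> \<in> path_space \<rightarrow>\<^sub>M path_space"
    unfolding \<Phi>_def by measurable
  have law: "proc_law M (\<lambda>t \<omega>. \<phi> (\<lambda>s. W (t + h + s) \<omega>)) = distr (proc_law M (\<lambda>t. W (t + h))) path_space \<Phi>" for h
    unfolding proc_law_def
    by (subst distr_distr) (auto simp: comp_def \<Phi>_def ac_simps intro!: distr_cong)
  have stat': "stationary_process M (\<lambda>t \<omega>. \<phi> (\<lambda>s. W (t + s) \<omega>))"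
    unfolding stationary_process_def
  proof (intro conjI allI)
    fix h
    have "proc_law M (\<lambda>t. W (t + h)) = proc_law M (\<lambda>t. W (t + 0))"
      using stat by (simp add: stationary_process_def)
    then show "proc_law M (\<lambda>t \<omega>. \<phi> (\<lambda>s. W (t + h + s) \<omega>)) = proc_law M (\<lambda>t \<omega>. \<phi> (\<lambda>s. W (t + s) \<omega>))"
      using law[of h] law[of 0] by simp
  qed measurable
  show ?thesis
    unfolding ergodic_process_def
  proof (intro conjI ballI impI stat')
    fix A :: "(int \<Rightarrow> 'c) set"
    assume A[measurable]: "A \<in> sets path_space"
      and inv: "(\<lambda>w t. w (t + 1)) -` A \<inter> space path_space = A"
    have inv': "(\<lambda>t. w (t + 1)) \<in> A \<longleftrightarrow> w \<in> A" for w using inv by auto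
    have "(\<lambda>w t. w (t + 1)) -` (\<Phi> -` A) = \<Phi> -` A"
    proof (intro set_eqI)
      fix w
      have "\<Phi> (\<lambda>t. w (t + 1)) = (\<lambda>t. \<Phi> w (t + 1))" by (simp add: \<Phi>_def ac_simps)
      then show "w \<in> (\<lambda>w t. w (t + 1)) -` (\<Phi> -` A) \<longleftrightarrow> w \<in> \<Phi> -` A" using inv' by simp
    qed
    moreover have "\<Phi> -` A \<in> sets path_space" using measurable_sets[OF \<Phi> A] by simp
    ultimately have "measure (proc_law M W) (\<Phi> -` A) = 0 \<or> measure (proc_law M W) (\<Phi> -` A) = 1"
      using W by (simp add: ergodic_process_def)
    moreover have "measure (proc_law M (\<lambda>t \<omega>. \<phi> (\<lambda>s. W (t + s) \<omega>))) A = measure (proc_law M W) (\<Phi> -` A)"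
      using law[of 0] by (simp add: measure_distr sets_eq_imp_space_eq[OF sets_proc_law])
    ultimately show "measure (proc_law M (\<lambda>t \<omega>. \<phi> (\<lambda>s. W (t + s) \<omega>))) A = 0 \<or>
        measure (proc_law M (\<lambda>t \<omega>. \<phi> (\<lambda>s. W (t + s) \<omega>))) A = 1" by simp
  qed
qed

text \<open>This is the maximum of 0 and the first \<open>n\<close> partial sums of \<open>g\<close>
  along \<open>w (-1)\<close>, \<open>w (-2)\<close>, ..., in the recursive form of Garsia's
  argument for the maximal ergodic lemma. The sums run backwards from -1 because the maps composed
  up to time \<open>t\<close> see \<open>Z (t - 1)\<close>, \<open>Z (t - 2)\<close>, ...\<close>

fun path_max :: "('b \<Rightarrow> real) \<Rightarrow> nat \<Rightarrow> (int \<Rightarrow> 'b) \<Rightarrow> real" where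
  "path_max g 0 w = 0"
| "path_max g (Suc n) w = max 0 (g (w (-1)) + path_max g n (\<lambda>t. w (t + (-1))))"

lemma path_max_nonneg: "0 \<le> path_max g n w"
  by (cases n) auto

lemma path_max_mono: "path_max g n w \<le> path_max g (Suc n) w"
proof (induction n arbitrary: w)
  case (Suc n)
  show ?case using Suc[of "\<lambda>t. w (t + (-1))"] by (simp only: path_max.simps)
qed simp

lemma sum_le_path_max: "(\<Sum>i<n. g (w (-1 - int i))) \<le> path_max g n w"
proof (induction n arbitrary: w)
  case (Suc n)
  have "(\<Sum>i<Suc n. g (w (-1 - int i))) = g (w (-1)) + (\<Sum>i<n. g (w (-1 - int i + (-1))))"
    by (subst sum.lessThan_Suc_shift) 
      (intro arg_cong2[where f = "(+)"] sum.cong arg_cong[where f = g] arg_cong[where f = w], simp_all)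
  also have "\<dots> \<le> path_max g (Suc n) w"
    using Suc[of "\<lambda>t. w (t + (-1))"] by simp
  finally show ?case .
qed simp

lemma measurable_path_max [measurable]:
  fixes g :: "'b::topological_space \<Rightarrow> real"
  assumes [measurable]: "g \<in> borel_measurable borel"
  shows "path_max g n \<in> borel_measurable path_space"
  by (induction n) (simp_all, measurable)

text \<open>
  Writing \<open>F_n = path_max g n\<close> and \<open>T\<close> for the backward shift, \<open>F_(n+1) - F_n o T = max (- F_n o T) g\<close>.
  Its mean equals \<open>E (F_(n+1) - F_n) \<ge> 0\<close>, but it would decrease to \<open>E g < 0\<close> if the invariant event
  that \<open>F_n\<close> is unbounded had probability \<open>1\<close>.
\<close>
lemma ergodic_path_max_bounded:
  fixes g :: "'b::topological_space \<Rightarrow> real"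
  assumes "prob_space M" and erg: "ergodic_process M Y"
    and g[measurable]: "g \<in> borel_measurable borel"
    and int: "integrable M (\<lambda>\<omega>. g (Y 0 \<omega>))" and neg: "(\<integral>\<omega>. g (Y 0 \<omega>) \<partial>M) < 0"
  shows "AE w in proc_law M Y. bdd_above (range (\<lambda>n. path_max g n w))"
proof -
  interpret prob_space M by fact
  have stat: "stationary_process M Y" using erg by (simp add: ergodic_process_def)
  note [measurable] = stationary_process_measurable[OF stat]
  let ?N = "proc_law M Y" and ?T = "\<lambda>w t. w (t + (-1)) :: 'b"
  interpret N: prob_space ?N by (rule prob_space_proc_law) (simp_all add: prob_space_axioms)
  have spN[simp]: "space ?N = UNIV" using sets_eq_imp_space_eq[OF sets_proc_law] by simp
  have T: "distr ?N path_space ?T = ?N" by (rule proc_law_shift[OF stat])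
  define A where "A = {w. \<not> bdd_above (range (\<lambda>n. path_max g n w))}"
  have A_iff: "w \<in> A \<longleftrightarrow> (\<forall>K::nat. \<exists>n. real K < path_max g n w)" for w
    unfolding A_def bdd_above_def
    by (auto simp: not_le) (meson order_less_le_trans order_le_less_trans real_arch_simple linorder_not_less)+
  have "{w \<in> space path_space. \<forall>K::nat. \<exists>n. real K < path_max g n w} \<in> sets path_space"
    by measurable
  then have A[measurable]: "A \<in> sets path_space" by (simp flip: A_iff)
  \<comment> \<open>By the recursion the maxima along \<open>w\<close> and along \<open>?T w\<close>
    differ by the finite number \<open>g (w (-1))\<close>, apart from the cut at 0, so they are
    unbounded together, for every path.\<close>
  have inv: "?T w \<in> A \<longleftrightarrow> w \<in> A" for w
  proof
    assume T: "?T w \<in> A"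
    show "w \<in> A" unfolding A_iff
    proof
      fix K :: nat
      obtain K' :: nat where "real K - g (w (-1)) \<le> real K'" using real_arch_simple by blast
      moreover obtain n where "real K' < path_max g n (?T w)" using T A_iff by blast
      ultimately have "real K < path_max g (Suc n) w" by simp
      then show "\<exists>n. real K < path_max g n w" ..
    qed
  next
    assume w: "w \<in> A"
    show "?T w \<in> A" unfolding A_iff
    proof
      fix K :: nat
      obtain K' :: nat where K': "real K + g (w (-1)) \<le> real K'" using real_arch_simple by blast
      obtain n where n: "real K' < path_max g n w" using w A_iff by blast
      then obtain m where "n = Suc m" by (cases n) auto
      with n K' have "real K < path_max g m (?T w)" by auto
      then show "\<exists>n. real K < path_max g n (?T w)" ..
    qed
  qed
  \<comment> \<open>The argument uses the backward shift while ergodicity refers to the forward one;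
    applying \<open>inv\<close> to a path shifted forward turns one invariance into the
    other.\<close>
  have "(\<lambda>w t. w (t + 1)) -` A \<inter> space path_space = A"
    using inv[of "\<lambda>t. _ (t + 1)"] by auto
  then consider "measure ?N A = 0" | "measure ?N A = 1"
    using erg A unfolding ergodic_process_def by blast
  then show ?thesis
  proof cases
    case 1
    then have "emeasure ?N A = 0" by (simp add: N.emeasure_eq_measure)
    then have "AE w in ?N. w \<notin> A" by (intro AE_not_in) (simp add: null_setsI)
    then show ?thesis by (simp add: A_def)
  next
    case 2
    then have AE_A: "AE w in ?N. w \<in> A"
      using N.AE_in_set_eq_1 by simp
    let ?g = "\<lambda>w. g (w (-1))" and ?F = "path_max g"
    have g0: "integrable ?N (\<lambda>w. g (w 0))"
      using int unfolding proc_law_def by (subst integrable_distr_eq) auto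
    have "integrable (distr ?N path_space ?T) (\<lambda>w. g (w 0))" using g0 T by simp
    then have g1: "integrable ?N ?g" by (subst (asm) integrable_distr_eq) auto
    have "(\<integral>w. g (w 0) \<partial>distr ?N path_space ?T) = (\<integral>w. ?g w \<partial>?N)"
      by (subst integral_distr) auto
    then have "(\<integral>w. ?g w \<partial>?N) = (\<integral>w. g (w 0) \<partial>?N)" using T by simp
    also have "\<dots> = (\<integral>\<omega>. g (Y 0 \<omega>) \<partial>M)" unfolding proc_law_def by (subst integral_distr) auto
    finally have neg': "(\<integral>w. ?g w \<partial>?N) < 0" using neg by simp
    have FT: "integrable ?N (\<lambda>w. ?F n (?T w))" if "integrable ?N (?F n)" for n
    proof -
      have "integrable (distr ?N path_space ?T) (?F n)" using that T by simp
      then show ?thesis by (subst (asm) integrable_distr_eq) auto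
    qed
    have F: "integrable ?N (?F n)" for n
    proof (induction n)
      case (Suc n)
      show ?case using FT[OF Suc] g1 by simp
    qed simp
    have diff: "?F (Suc n) w - ?F n (?T w) = max (- ?F n (?T w)) (?g w)" for n w
      by simp
    have "0 \<le> (\<integral>w. max (- ?F n (?T w)) (?g w) \<partial>?N)" for n
    proof -
      have "(\<integral>w. ?F n w \<partial>distr ?N path_space ?T) = (\<integral>w. ?F n (?T w) \<partial>?N)"
        by (subst integral_distr) auto
      then have eq: "(\<integral>w. ?F n (?T w) \<partial>?N) = (\<integral>w. ?F n w \<partial>?N)" using T by simp
      have "(\<integral>w. max (- ?F n (?T w)) (?g w) \<partial>?N) = (\<integral>w. ?F (Suc n) w - ?F n (?T w) \<partial>?N)"
        using diff by simp
      also have "\<dots> = (\<integral>w. ?F (Suc n) w \<partial>?N) - (\<integral>w. ?F n w \<partial>?N)"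
        using F[of "Suc n"] FT[OF F] eq by (subst Bochner_Integration.integral_diff) auto
      also have "\<dots> \<ge> 0"
        using integral_mono[OF F F path_max_mono] by simp
      finally show ?thesis by simp
    qed
    \<comment> \<open>On \<open>A\<close> the maxima eventually exceed \<open>- ?g\<close>, and from
      then on the integrand equals \<open>?g\<close>. Domination by the absolute value of
      \<open>?g\<close> holds because \<open>path_max\<close> is nonnegative: the integrand is
      \<open>?g\<close> where \<open>?g \<ge> 0\<close>, and lies between \<open>?g\<close> and 0
      elsewhere.\<close>
    moreover have "(\<lambda>n. \<integral>w. max (- ?F n (?T w)) (?g w) \<partial>?N) \<longlonglongrightarrow> (\<integral>w. ?g w \<partial>?N)"
    proof (rule integral_dominated_convergence[where w = "\<lambda>w. \<bar>?g w\<bar>"])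
      show "AE w in ?N. (\<lambda>n. max (- ?F n (?T w)) (?g w)) \<longlonglongrightarrow> ?g w"
        using AE_A
      proof eventually_elim
        case (elim w)
        then have "?T w \<in> A" using inv by simp
        obtain K :: nat where K: "- ?g w \<le> real K" using real_arch_simple by blast
        obtain n0 where n0: "real K < ?F n0 (?T w)" using \<open>?T w \<in> A\<close> A_iff by blast
        have "?g w \<ge> - ?F n (?T w)" if "n \<ge> n0" for n
          using lift_Suc_mono_le[of "\<lambda>n. ?F n (?T w)", OF path_max_mono that] n0 K by linarith
        then have "eventually (\<lambda>n. ?g w = max (- ?F n (?T w)) (?g w)) sequentially"
          by (auto simp: eventually_sequentially intro!: exI[of _ n0])
        then show ?case by (rule Lim_transform_eventually[OF tendsto_const])
      qed
      show "AE w in ?N. norm (max (- ?F n (?T w)) (?g w)) \<le> \<bar>?g w\<bar>" for n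
        using path_max_nonneg[of g n] by (auto intro!: AE_I2 simp: max_def abs_if) (smt (verit) path_max_nonneg)+
    qed (use g1 in auto)
    ultimately have "0 \<le> (\<integral>w. ?g w \<partial>?N)"
      by (intro LIMSEQ_le_const) auto
    with neg' show ?thesis by simp
  qed
qed

text \<open>The event \<open>f \<le> E f\<close> is invariant, so \<open>f - E f\<close> has a constant sign almost surely and mean \<open>0\<close>.\<close>
lemma ergodic_invariant_const:
  fixes f :: "(int \<Rightarrow> 'b::topological_space) \<Rightarrow> real"
  assumes "prob_space M" and erg: "ergodic_process M Y"
    and [measurable]: "f \<in> borel_measurable path_space"
    and int: "integrable (proc_law M Y) f" and inv: "\<And>w. f (\<lambda>t. w (t + 1)) = f w"
  shows "AE w in proc_law M Y. f w = (\<integral>w. f w \<partial>proc_law M Y)"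
proof -
  interpret prob_space M by fact
  have "stationary_process M Y" using erg by (simp add: ergodic_process_def)
  note [measurable] = stationary_process_measurable[OF this]
  let ?N = "proc_law M Y"
  interpret N: prob_space ?N by (rule prob_space_proc_law) (simp_all add: prob_space_axioms)
  have spN[simp]: "space ?N = UNIV" using sets_eq_imp_space_eq[OF sets_proc_law] by simp
  define q where "q = (\<integral>w. f w \<partial>?N)"
  define A where "A = {w \<in> space path_space. f w \<le> q}"
  have A[measurable]: "A \<in> sets path_space" unfolding A_def by measurable
  have int0: "integrable ?N (\<lambda>w. q - f w)" "(\<integral>w. q - f w \<partial>?N) = 0"
    using int N.prob_space by (auto simp: q_def)
  have int1: "integrable ?N (\<lambda>w. f w - q)" "(\<integral>w. f w - q \<partial>?N) = 0"
    using int N.prob_space by (auto simp: q_def)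
  have "(\<lambda>w t. w (t + 1)) -` A \<inter> space path_space = A"
    by (auto simp: A_def inv)
  then consider "measure ?N A = 0" | "measure ?N A = 1"
    using erg A unfolding ergodic_process_def by blast
  then have "AE w in ?N. f w = q"
  proof cases
    case 1
    then have "emeasure ?N A = 0" by (simp add: N.emeasure_eq_measure)
    then have "AE w in ?N. w \<notin> A" by (intro AE_not_in) (simp add: null_setsI)
    then have "AE w in ?N. 0 \<le> f w - q" by eventually_elim (simp add: A_def)
    then have "AE w in ?N. f w - q = 0"
      using integral_nonneg_eq_0_iff_AE[OF int1(1)] int1(2) by simp
    then show ?thesis by eventually_elim simp
  next
    case 2
    then have "AE w in ?N. w \<in> A" using N.AE_in_set_eq_1 by simp
    then have "AE w in ?N. 0 \<le> q - f w" by eventually_elim (simp add: A_def)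
    then have "AE w in ?N. q - f w = 0"
      using integral_nonneg_eq_0_iff_AE[OF int0(1)] int0(2) by simp
    then show ?thesis by eventually_elim simp
  qed
  then show ?thesis by (simp add: q_def)
qed

lemma proc_sigma_UNIV: "proc_sigma M UNIV Y = vimage_algebra (space M) (\<lambda>\<omega> t. Y t \<omega>) path_space"
  by (simp add: proc_sigma_def restrict_def)

section \<open>Ergodicity of the driving noise\<close>

text \<open>Second countability makes \<open>borel\<close> on the pair type coincide with the
  product sigma-algebra, as the joint process \<open>W\<close> requires.\<close>

locale noise_driven = prob_space M for M :: "'a measure" +
  fixes Z :: "int \<Rightarrow> 'a \<Rightarrow> 'z::second_countable_topology"
    and eps :: "int \<Rightarrow> 'a \<Rightarrow> 'w::second_countable_topology"
  assumes Z_erg: "ergodic_process M Z"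
    and eps_indep: "indep_vars (\<lambda>_. borel) eps UNIV"
    and eps_ident: "\<And>t. distr M borel (eps t) = distr M borel (eps 0)"
    and Z_eps_indep: "indep_set (sets (proc_sigma M UNIV Z)) (sets (proc_sigma M UNIV eps))"
begin

lemma Z_stat: "stationary_process M Z"
  using Z_erg by (simp add: ergodic_process_def)

lemma Z_meas [measurable]: "Z t \<in> borel_measurable M"
  using stationary_process_measurable[OF Z_stat] .

lemma eps_meas [measurable]: "eps t \<in> borel_measurable M"
  using eps_indep by (auto simp: indep_vars_def)

lemma indep_Z_eps: "indep_pair path_space (\<lambda>\<omega> t. Z t \<omega>) path_space (\<lambda>\<omega> t. eps t \<omega>)"
proof (rule indep_pairI)
  fix A :: "(int \<Rightarrow> 'z) set" and B :: "(int \<Rightarrow> 'w) set"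
  assume "A \<in> sets path_space" "B \<in> sets path_space"
  then show "prob (((\<lambda>\<omega> t. Z t \<omega>) -` A \<inter> space M) \<inter> ((\<lambda>\<omega> t. eps t \<omega>) -` B \<inter> space M)) =
      prob ((\<lambda>\<omega> t. Z t \<omega>) -` A \<inter> space M) * prob ((\<lambda>\<omega> t. eps t \<omega>) -` B \<inter> space M)"
    by (intro indep_setD[OF Z_eps_indep]) (auto simp: proc_sigma_UNIV intro!: in_vimage_algebra)
qed measurable

lemma indep_Z_eps_disjoint:
  assumes "I \<inter> J = {}"
  shows "indep_pair (path_space \<Otimes>\<^sub>M Pi\<^sub>M I (\<lambda>_. borel)) (\<lambda>\<omega>. (\<lambda>t. Z t \<omega>, \<lambda>i\<in>I. eps i \<omega>))
    (Pi\<^sub>M J (\<lambda>_. borel)) (\<lambda>\<omega>. \<lambda>j\<in>J. eps j \<omega>)"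
proof (rule indep_pair_assoc)
  show "indep_pair path_space (\<lambda>\<omega> t. Z t \<omega>) (Pi\<^sub>M I (\<lambda>_. borel) \<Otimes>\<^sub>M Pi\<^sub>M J (\<lambda>_. borel))
      (\<lambda>\<omega>. (\<lambda>i\<in>I. eps i \<omega>, \<lambda>j\<in>J. eps j \<omega>))"
    by (rule indep_pair_compose[OF indep_Z_eps measurable_ident,
          of "\<lambda>e. (restrict e I, restrict e J)", simplified])
      (intro measurable_Pair measurable_restrict_subset; simp)
  show "indep_pair (Pi\<^sub>M I (\<lambda>_. borel)) (\<lambda>\<omega>. \<lambda>i\<in>I. eps i \<omega>) (Pi\<^sub>M J (\<lambda>_. borel)) (\<lambda>\<omega>. \<lambda>j\<in>J. eps j \<omega>)"
    using indep_var_restrict[OF eps_indep assms] by (simp add: indep_pair_def indep_var_distribution_eq)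
qed

text \<open>Independence turns the law into a product of equal marginals, and an injective
  relabelling of the times leaves such a product unchanged.\<close>

lemma eps_stat: "stationary_process M eps"
proof -
  have law: "proc_law M eps = Pi\<^sub>M UNIV (\<lambda>_. distr M borel (eps 0))"
  proof -
    have "proc_law M eps = Pi\<^sub>M UNIV (\<lambda>i. distr M borel (eps i))"
      using eps_indep indep_vars_iff_distr_eq_PiM[where I = UNIV and M' = "\<lambda>_. borel" and X = eps]
      by (simp add: proc_law_def restrict_UNIV)
    also have "(\<lambda>i. distr M borel (eps i)) = (\<lambda>_. distr M borel (eps 0))"
      by (rule ext) (rule eps_ident)
    finally show ?thesis .
  qed
  have "proc_law M (\<lambda>t. eps (t + h)) = proc_law M eps" for h
  proof -
    have "proc_law M (\<lambda>t. eps (t + h)) = distr (proc_law M eps) path_space (\<lambda>e t. e (t + h))"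
      unfolding proc_law_def by (subst distr_distr) (auto simp: comp_def)
    also have "\<dots> = distr (Pi\<^sub>M UNIV (\<lambda>_. distr M borel (eps 0)))
        (Pi\<^sub>M UNIV (\<lambda>_. distr M borel (eps 0))) (\<lambda>e. \<lambda>t\<in>UNIV. e (t + h))"
      unfolding law by (rule distr_cong) (auto intro!: sets_PiM_cong)
    also have "\<dots> = Pi\<^sub>M UNIV (\<lambda>_. distr M borel (eps 0))"
      by (rule distr_PiM_reindex) (auto simp: inj_on_def intro: prob_space_distr)
    finally show ?thesis by (simp add: law)
  qed
  then show ?thesis by (simp add: stationary_process_def)
qed

lemma law_Z_eps:
  "distr M (path_space \<Otimes>\<^sub>M path_space) (\<lambda>\<omega>. (\<lambda>t. Z (t + h) \<omega>, \<lambda>t. eps (t + h) \<omega>)) =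
     proc_law M Z \<Otimes>\<^sub>M proc_law M eps"
proof -
  have "indep_pair path_space (\<lambda>\<omega> t. Z (t + h) \<omega>) path_space (\<lambda>\<omega> t. eps (t + h) \<omega>)"
    by (rule indep_pair_compose[OF indep_Z_eps]) measurable
  then have "distr M (path_space \<Otimes>\<^sub>M path_space) (\<lambda>\<omega>. (\<lambda>t. Z (t + h) \<omega>, \<lambda>t. eps (t + h) \<omega>)) =
      proc_law M (\<lambda>t. Z (t + h)) \<Otimes>\<^sub>M proc_law M (\<lambda>t. eps (t + h))"
    by (simp add: indep_pair_def proc_law_def)
  then show ?thesis using Z_stat eps_stat by (simp add: stationary_process_def)
qed

definition W :: "int \<Rightarrow> 'a \<Rightarrow> 'z \<times> 'w" where
  "W t \<omega> = (Z t \<omega>, eps t \<omega>)"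

lemma W_meas [measurable]: "W t \<in> borel_measurable M"
  unfolding W_def by measurable

lemma W_stat: "stationary_process M W"
proof -
  have [measurable]: "(\<lambda>ze t. (fst ze t, snd ze t)) \<in> (path_space \<Otimes>\<^sub>M path_space) \<rightarrow>\<^sub>M (path_space :: (int \<Rightarrow> 'z \<times> 'w) measure)"
    by (rule measurable_path) measurable
  have *: "proc_law M (\<lambda>t. W (t + h)) = distr (proc_law M Z \<Otimes>\<^sub>M proc_law M eps) path_space (\<lambda>ze t. (fst ze t, snd ze t))" for h
    unfolding law_Z_eps[of h, symmetric] unfolding proc_law_def
    by (subst distr_distr) (auto simp: comp_def W_def)
  have "proc_law M (\<lambda>t. W (t + h)) = proc_law M W" for h
    using *[of h] *[of 0] by simp
  then show ?thesis
    by (simp add: stationary_process_def)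
qed

lemma prob_invariant_Z:
  assumes A[measurable]: "A \<in> sets path_space"
    and inv: "\<And>w. (\<lambda>t. w (t + 1)) \<in> A \<longleftrightarrow> w \<in> A"
    and B[measurable]: "B \<in> sets path_space"
  shows "prob {\<omega>\<in>space M. (\<lambda>t. W t \<omega>) \<in> A \<and> (\<lambda>t. Z t \<omega>) \<in> B} =
    prob {\<omega>\<in>space M. (\<lambda>t. W t \<omega>) \<in> A} * prob {\<omega>\<in>space M. (\<lambda>t. Z t \<omega>) \<in> B}"
proof -
  let ?N = "proc_law M Z" and ?P = "proc_law M eps"
  interpret N: prob_space ?N by (rule prob_space_proc_law) (simp_all add: prob_space_axioms)
  interpret P: prob_space ?P by (rule prob_space_proc_law) (simp_all add: prob_space_axioms)
  have spN[simp]: "space (proc_law M Y) = UNIV" for Y :: "int \<Rightarrow> 'a \<Rightarrow> 'x::topological_space"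
    using sets_eq_imp_space_eq[OF sets_proc_law] by simp
  have [measurable]: "(\<lambda>ze t. (fst ze t, snd ze t)) \<in> (path_space \<Otimes>\<^sub>M path_space) \<rightarrow>\<^sub>M (path_space :: (int \<Rightarrow> 'z \<times> 'w) measure)"
    by (rule measurable_path) measurable
  define A' where "A' = {ze \<in> space (path_space \<Otimes>\<^sub>M path_space). (\<lambda>t. (fst ze t, snd ze t)) \<in> A}"
  have A'[measurable]: "A' \<in> sets (path_space \<Otimes>\<^sub>M path_space)" unfolding A'_def by measurable
  have A'_iff: "(z, e) \<in> A' \<longleftrightarrow> (\<lambda>t. (z t, e t)) \<in> A" for z e by (simp add: A'_def space_pair_measure)
  \<comment> \<open>A version of the conditional probability given the path of \<open>Z\<close>,
    defined for every path through the slices of \<open>A'\<close>. Its invariance is pointwise: a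
    shift of \<open>z\<close> is compensated by a shift of the noise, whose law does not
    change.\<close>
  define a where "a z = measure ?P (Pair z -` A')" for z
  have "(\<lambda>z. emeasure ?P (Pair z -` A')) \<in> borel_measurable path_space"
    by (rule P.measurable_emeasure_Pair) (simp cong: sets_pair_measure_cong)
  then have a[measurable]: "a \<in> borel_measurable path_space"
    unfolding a_def measure_def by measurable
  have slice[measurable]: "Pair z -` A' \<in> sets path_space" for z using sets_Pair1[OF A'] .
  have a_inv: "a (\<lambda>t. z (t + 1)) = a z" for z
  proof -
    have "a (\<lambda>t. z (t + 1)) = measure (distr ?P path_space (\<lambda>e t. e (t + 1))) (Pair (\<lambda>t. z (t + 1)) -` A')"
      using proc_law_shift[OF eps_stat, of 1] by (simp add: a_def)
    also have "\<dots> = measure ?P ((\<lambda>e t. e (t + 1)) -` (Pair (\<lambda>t. z (t + 1)) -` A'))"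
      by (subst measure_distr) auto
    also have "(\<lambda>e t. e (t + 1)) -` (Pair (\<lambda>t. z (t + 1)) -` A') = Pair z -` A'"
    proof -
      have "(\<lambda>t. (z (t + 1), e (t + 1))) \<in> A \<longleftrightarrow> (\<lambda>t. (z t, e t)) \<in> A" for e
        using inv[of "\<lambda>t. (z t, e t)"] .
      then show ?thesis by (simp add: vimage_def A'_iff)
    qed
    finally show ?thesis by (simp add: a_def)
  qed
  have a_int: "integrable ?N a"
    by (rule N.integrable_const_bound[where B = 1]) (auto simp: a_def)
  have a_const: "AE z in ?N. a z = (\<integral>z. a z \<partial>?N)"
    by (rule ergodic_invariant_const[OF prob_space_axioms Z_erg a a_int a_inv])
  have gen: "prob {\<omega>\<in>space M. (\<lambda>t. W t \<omega>) \<in> A \<and> (\<lambda>t. Z t \<omega>) \<in> B} = (\<integral>z. indicator B z * a z \<partial>?N)"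
    if [measurable]: "B \<in> sets path_space" for B
  proof -
    have eq: "{\<omega>\<in>space M. (\<lambda>t. W t \<omega>) \<in> A \<and> (\<lambda>t. Z t \<omega>) \<in> B} =
        (\<lambda>\<omega>. (\<lambda>t. Z (t + 0) \<omega>, \<lambda>t. eps (t + 0) \<omega>)) -` (A' \<inter> (B \<times> UNIV)) \<inter> space M"
      by (auto simp: A'_iff W_def)
    have [measurable]: "A' \<inter> (B \<times> UNIV) \<in> sets (path_space \<Otimes>\<^sub>M path_space)"
      by (intro sets.Int A' pair_measureI that UNIV_path_space)
    have "emeasure M {\<omega>\<in>space M. (\<lambda>t. W t \<omega>) \<in> A \<and> (\<lambda>t. Z t \<omega>) \<in> B} =
        emeasure (proc_law M Z \<Otimes>\<^sub>M proc_law M eps) (A' \<inter> (B \<times> UNIV))"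
      unfolding law_Z_eps[of 0, symmetric] eq by (subst emeasure_distr) measurable
    also have "\<dots> = (\<integral>\<^sup>+ z. emeasure ?P (Pair z -` (A' \<inter> (B \<times> UNIV))) \<partial>?N)"
      by (rule P.emeasure_pair_measure_alt) (simp cong: sets_pair_measure_cong)
    also have "\<dots> = (\<integral>\<^sup>+ z. ennreal (indicator B z * a z) \<partial>?N)"
      by (intro nn_integral_cong) (auto simp: a_def P.emeasure_eq_measure indicator_def vimage_def)
    also have "\<dots> = ennreal (\<integral>z. indicator B z * a z \<partial>?N)"
      by (rule nn_integral_eq_integral)
        (auto intro!: N.integrable_const_bound[where B = 1] simp: a_def indicator_def)
    finally show ?thesis
      by (simp add: emeasure_eq_measure a_def integral_nonneg_AE)
  qed
  have "(\<integral>z. indicator B z * a z \<partial>?N) = (\<integral>z. indicator B z * (\<integral>z. a z \<partial>?N) \<partial>?N)"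
    by (rule integral_cong_AE) (use a_const in \<open>auto\<close>)
  also have "\<dots> = measure ?N B * (\<integral>z. a z \<partial>?N)" by simp
  also have "measure ?N B = prob {\<omega>\<in>space M. (\<lambda>t. Z t \<omega>) \<in> B}"
    unfolding proc_law_def by (subst measure_distr) (auto intro!: arg_cong[where f = prob])
  \<comment> \<open>Taking \<open>UNIV\<close> for \<open>B\<close> in \<open>gen\<close> identifies
    the almost sure value of \<open>a\<close>.\<close>
  also have "(\<integral>z. a z \<partial>?N) = prob {\<omega>\<in>space M. (\<lambda>t. W t \<omega>) \<in> A}"
  proof -
    show ?thesis using gen[OF UNIV_path_space] by simp
  qed
  finally show ?thesis using gen[OF B] by simp
qed


section \<open>Events determined by \<open>Z\<close> and the noise from some time on\<close>

definition future_proj :: "nat \<Rightarrow> (int \<Rightarrow> 'z \<times> 'w) \<Rightarrow> (int \<Rightarrow> 'z) \<times> (int \<Rightarrow> 'w)" where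
  "future_proj k w = (\<lambda>t. fst (w t), \<lambda>j\<in>{- int k..}. snd (w j))"

text \<open>These sigma-algebras increase with \<open>k\<close>, so their union is an algebra, and
  the coordinate at time \<open>i\<close> enters at the latest when \<open>k\<close> is the absolute
  value of \<open>i\<close>. Hence the union generates the path space and
  \<open>approx_by_algebra\<close> applies to it.\<close>

definition future_algebra :: "nat \<Rightarrow> (int \<Rightarrow> 'z \<times> 'w) measure" where
  "future_algebra k = vimage_algebra UNIV (future_proj k) (path_space \<Otimes>\<^sub>M Pi\<^sub>M {- int k..} (\<lambda>_. borel))"

lemma future_proj_space:
  "future_proj k \<in> UNIV \<rightarrow> space (path_space \<Otimes>\<^sub>M Pi\<^sub>M {- int k..} (\<lambda>_. borel))"
  by (auto simp: future_proj_def space_pair_measure space_PiM)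

lemma measurable_future_proj:
  "future_proj k \<in> future_algebra k \<rightarrow>\<^sub>M path_space \<Otimes>\<^sub>M Pi\<^sub>M {- int k..} (\<lambda>_. borel)"
  unfolding future_algebra_def by (rule measurable_vimage_algebra1[OF future_proj_space])

lemma measurable_future_proj_path [measurable]:
  "future_proj k \<in> path_space \<rightarrow>\<^sub>M path_space \<Otimes>\<^sub>M Pi\<^sub>M {- int k..} (\<lambda>_. borel)"
proof -
  have [measurable]: "(fst :: 'z \<times> 'w \<Rightarrow> 'z) \<in> borel \<rightarrow>\<^sub>M borel" "(snd :: 'z \<times> 'w \<Rightarrow> 'w) \<in> borel \<rightarrow>\<^sub>M borel"
    by (auto simp flip: borel_prod)
  show ?thesis
    unfolding future_proj_def
    by (intro measurable_Pair measurable_path measurable_restrict measurable_compose[OF measurable_component_singleton]) auto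
qed

lemma space_future_algebra [simp]: "space (future_algebra k) = UNIV"
  by (simp add: future_algebra_def)

lemma sets_future_algebra:
  "sets (future_algebra k) = {future_proj k -` D |D. D \<in> sets (path_space \<Otimes>\<^sub>M Pi\<^sub>M {- int k..} (\<lambda>_. borel))}"
  unfolding future_algebra_def by (subst sets_vimage_algebra2[OF future_proj_space]) simp

lemma future_algebra_mono:
  assumes "k \<le> l" shows "sets (future_algebra k) \<subseteq> sets (future_algebra l)"
proof -
  have "(\<lambda>ze. (fst ze, restrict (snd ze) {- int k..})) \<in>
      (path_space :: (int \<Rightarrow> 'z) measure) \<Otimes>\<^sub>M Pi\<^sub>M {- int l..} (\<lambda>_. borel :: 'w measure) \<rightarrow>\<^sub>M path_space \<Otimes>\<^sub>M Pi\<^sub>M {- int k..} (\<lambda>_. borel)"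
    using assms
    by (intro measurable_Pair measurable_fst measurable_compose[OF measurable_snd measurable_restrict_subset]) auto
  moreover have "(fst (future_proj l w), restrict (snd (future_proj l w)) {- int k..}) = future_proj k w" for w
    using assms by (auto simp: future_proj_def fun_eq_iff restrict_def)
  ultimately have "future_proj k \<in> future_algebra l \<rightarrow>\<^sub>M path_space \<Otimes>\<^sub>M Pi\<^sub>M {- int k..} (\<lambda>_. borel)"
    using measurable_compose[OF measurable_future_proj[of l], of "\<lambda>ze. (fst ze, restrict (snd ze) {- int k..})"] by simp
  then show ?thesis
    unfolding future_algebra_def[of k] by (intro sets_image_in_sets) auto
qed

lemma algebra_future: "algebra UNIV (\<Union>k. sets (future_algebra k))"
  unfolding algebra_iff_Un
proof (intro conjI ballI)
  fix a b assume "a \<in> (\<Union>k. sets (future_algebra k))" "b \<in> (\<Union>k. sets (future_algebra k))"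
  then obtain k l where "a \<in> sets (future_algebra k)" "b \<in> sets (future_algebra l)" by auto
  then have "a \<in> sets (future_algebra (max k l))" "b \<in> sets (future_algebra (max k l))"
    using future_algebra_mono[of k "max k l"] future_algebra_mono[of l "max k l"] by auto
  then show "a \<union> b \<in> (\<Union>k. sets (future_algebra k))" by blast
next
  fix a assume "a \<in> (\<Union>k. sets (future_algebra k))"
  then obtain k where "a \<in> sets (future_algebra k)" by auto
  then have "UNIV - a \<in> sets (future_algebra k)" using sets.compl_sets[of a "future_algebra k"] by simp
  then show "UNIV - a \<in> (\<Union>k. sets (future_algebra k))" by blast
qed auto

lemma path_space_subset_future: "sets path_space \<subseteq> sigma_sets UNIV (\<Union>k. sets (future_algebra k))"
proof -
  let ?N = "sigma UNIV (\<Union>k. sets (future_algebra k))"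
  have sets: "sets ?N = sigma_sets UNIV (\<Union>k. sets (future_algebra k))"
    by (rule sets_measure_of) simp
  have "sets (path_space :: (int \<Rightarrow> 'z \<times> 'w) measure) \<subseteq> sets ?N"
  proof (rule sets_PiM_in_sets)
    fix i and A :: "('z \<times> 'w) set" assume A: "A \<in> sets borel"
    define k where "k = nat \<bar>i\<bar>"
    have k: "i \<in> {- int k..}" by (auto simp: k_def)
    have "(\<lambda>ze. (fst ze i, snd ze i)) \<in>
        borel_measurable ((path_space :: (int \<Rightarrow> 'z) measure) \<Otimes>\<^sub>M Pi\<^sub>M {- int k..} (\<lambda>_. borel :: 'w measure))"
      using k by measurable
    from measurable_compose[OF measurable_future_proj[of k] this]
    have "(\<lambda>w. w i) \<in> borel_measurable (future_algebra k)"
      using k by (simp add: future_proj_def)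
    from measurable_sets[OF this A] have "{w. w i \<in> A} \<in> sets (future_algebra k)"
      by (simp add: vimage_def)
    then show "{x \<in> space ?N. x i \<in> A} \<in> sets ?N"
      unfolding sets by (auto simp: space_measure_of_conv)
  qed (simp add: space_measure_of_conv)
  then show ?thesis using sets by simp
qed

text \<open>Invariance lets an approximating event be moved in time at no cost: its shift still
  approximates \<open>C\<close> but uses only noise after \<open>m\<close>. Together with
  \<open>D\<close> it is then independent of \<open>D'\<close>, and \<open>prob_invariant_Z\<close>
  splits the remaining intersection of \<open>C\<close> and \<open>D\<close>.\<close>

lemma invariant_indep:
  assumes A[measurable]: "A \<in> sets path_space"
    and inv: "\<And>w. (\<lambda>t. w (t + 1)) \<in> A \<longleftrightarrow> w \<in> A"
    and B[measurable]: "B \<in> sets path_space" and B'[measurable]: "B' \<in> sets (Pi\<^sub>M {..m} (\<lambda>_. borel))"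
  defines "C \<equiv> {\<omega>\<in>space M. (\<lambda>t. W t \<omega>) \<in> A}"
    and "D \<equiv> {\<omega>\<in>space M. (\<lambda>t. Z t \<omega>) \<in> B}"
    and "D' \<equiv> {\<omega>\<in>space M. (\<lambda>j\<in>{..m}. eps j \<omega>) \<in> B'}"
  shows "prob (C \<inter> (D \<inter> D')) = prob C * prob (D \<inter> D')"
proof -
  have [measurable]: "C \<in> sets M" "D \<in> sets M" "D' \<in> sets M"
    unfolding C_def D_def D'_def by measurable
  have inv_n: "(\<lambda>t. w (t + int n)) \<in> A \<longleftrightarrow> w \<in> A" for w n
  proof (induction n arbitrary: w)
    case (Suc n)
    show ?case using Suc[of "\<lambda>t. w (t + 1)"] inv[of w] by (simp add: ac_simps)
  qed simp
  let ?N = "proc_law M W"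
  interpret N: prob_space ?N by (rule prob_space_proc_law) (simp_all add: prob_space_axioms)
  have spN[simp]: "space ?N = UNIV" using sets_eq_imp_space_eq[OF sets_proc_law] by simp
  have fut: "sets (future_algebra k) \<subseteq> sets path_space" for k
    unfolding sets_future_algebra using measurable_sets[OF measurable_future_proj_path[of k]] by auto
  \<comment> \<open>One \<open>e\<close> pays for replacing \<open>C\<close> in the triple
    intersection, the other for undoing the replacement in
    \<open>prob (C \<inter> D)\<close>.\<close>
  have bound: "\<bar>prob (C \<inter> (D \<inter> D')) - prob (C \<inter> D) * prob D'\<bar> \<le> 2 * e" if "0 < e" for e
  proof -
    have "\<exists>A'\<in>(\<Union>k. sets (future_algebra k)). N.prob (sym_diff A A') < e"
    proof (rule N.approx_by_algebra)
      show "(\<Union>k. sets (future_algebra k)) \<subseteq> sets ?N" using fut by auto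
      show "A \<in> sigma_sets (space ?N) (\<Union>k. sets (future_algebra k))"
        using path_space_subset_future A by auto
    qed (use algebra_future that in auto)
    then obtain k A' where A': "A' \<in> sets (future_algebra k)" "N.prob (sym_diff A A') < e" by auto
    then obtain G where G[measurable]: "G \<in> sets (path_space \<Otimes>\<^sub>M Pi\<^sub>M {- int k..} (\<lambda>_. borel))"
      and A'_eq: "A' = future_proj k -` G" by (auto simp: sets_future_algebra)
    have [measurable]: "A' \<in> sets path_space" using A' fut by auto
    \<comment> \<open>The approximating event uses noise from time \<open>- k\<close> on; after a
      shift by \<open>n\<close> these times start at \<open>n - k\<close>, beyond
      \<open>m\<close>.\<close>
    define n where "n = nat (\<bar>m\<bar> + int k + 1)"
    have n: "m < int n - int k" by (auto simp: n_def)
    define C' where "C' = {\<omega>\<in>space M. (\<lambda>t. W (t + int n) \<omega>) \<in> A'}"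
    have [measurable]: "C' \<in> sets M" unfolding C'_def by measurable
    have "sym_diff C C' = (\<lambda>\<omega> t. W (t + int n) \<omega>) -` sym_diff A A' \<inter> space M"
    proof -
      have "(\<lambda>t. W (t + int n) \<omega>) \<in> A \<longleftrightarrow> (\<lambda>t. W t \<omega>) \<in> A" for \<omega>
        using inv_n[of "\<lambda>t. W t \<omega>" n] .
      then show ?thesis by (auto simp: C_def C'_def)
    qed
    then have "prob (sym_diff C C') = measure (proc_law M (\<lambda>t. W (t + int n))) (sym_diff A A')"
      unfolding proc_law_def by (subst measure_distr) auto
    also have "\<dots> = N.prob (sym_diff A A')" using W_stat by (simp add: stationary_process_def)
    finally have CC': "prob (sym_diff C C') < e" using A' by simp
    have close: "\<bar>prob (C \<inter> E) - prob (C' \<inter> E)\<bar> \<le> e" if [measurable]: "E \<in> sets M" for E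
    proof -
      have "prob (C \<inter> E) \<le> prob ((C' \<inter> E) \<union> sym_diff C C')"
        by (intro finite_measure_mono) auto
      also have "\<dots> \<le> prob (C' \<inter> E) + prob (sym_diff C C')" by (intro measure_Un_le) auto
      finally have 1: "prob (C \<inter> E) \<le> prob (C' \<inter> E) + e" using CC' by simp
      have "prob (C' \<inter> E) \<le> prob ((C \<inter> E) \<union> sym_diff C C')"
        by (intro finite_measure_mono) auto
      also have "\<dots> \<le> prob (C \<inter> E) + prob (sym_diff C C')" by (intro measure_Un_le) auto
      finally show ?thesis using 1 CC' by simp
    qed
    \<comment> \<open>\<open>B\<close> is built into \<open>H\<close> so that
      \<open>C' \<inter> D\<close> as a whole is an event of \<open>Z\<close> and the noise after
      \<open>m\<close>.\<close>
    define H where "H = {ze \<in> space (path_space \<Otimes>\<^sub>M Pi\<^sub>M {m<..} (\<lambda>_. borel)).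
      (\<lambda>t. fst ze (t + int n), \<lambda>j\<in>{- int k..}. snd ze (j + int n)) \<in> G \<and> fst ze \<in> B}"
    have [measurable]: "(\<lambda>ze. \<lambda>j\<in>{- int k..}. snd ze (j + int n)) \<in>
        (path_space :: (int \<Rightarrow> 'z) measure) \<Otimes>\<^sub>M Pi\<^sub>M {m<..} (\<lambda>_. borel :: 'w measure) \<rightarrow>\<^sub>M Pi\<^sub>M {- int k..} (\<lambda>_. borel)"
      using n by (intro measurable_restrict measurable_compose[OF measurable_snd measurable_component_singleton]) auto
    have H[measurable]: "H \<in> sets (path_space \<Otimes>\<^sub>M Pi\<^sub>M {m<..} (\<lambda>_. borel))"
      unfolding H_def by measurable
    have CD: "C' \<inter> D = (\<lambda>\<omega>. (\<lambda>t. Z t \<omega>, \<lambda>i\<in>{m<..}. eps i \<omega>)) -` H \<inter> space M"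
    proof -
      have "(\<lambda>j\<in>{- int k..}. (\<lambda>i\<in>{m<..}. eps i \<omega>) (j + int n)) = (\<lambda>j\<in>{- int k..}. eps (j + int n) \<omega>)" for \<omega>
        using n by (auto simp: restrict_def fun_eq_iff)
      then show ?thesis
        by (auto simp: C'_def D_def H_def A'_eq future_proj_def W_def space_pair_measure space_PiM)
    qed
    have "prob ((C' \<inter> D) \<inter> D') = prob (C' \<inter> D) * prob D'"
    proof -
      have "{m<..} \<inter> {..m} = {}" by auto
      moreover have "D' = (\<lambda>\<omega>. \<lambda>j\<in>{..m}. eps j \<omega>) -` B' \<inter> space M" by (auto simp: D'_def)
      ultimately show ?thesis
        using indep_pairD[OF indep_Z_eps_disjoint H B'] unfolding CD by metis
    qed
    then have "\<bar>prob (C \<inter> (D \<inter> D')) - prob (C' \<inter> D) * prob D'\<bar> \<le> e"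
      using close[of "D \<inter> D'"] by (simp add: Int_assoc)
    moreover have "\<bar>prob (C \<inter> D) * prob D' - prob (C' \<inter> D) * prob D'\<bar> \<le> e"
    proof -
      have "\<bar>prob (C \<inter> D) * prob D' - prob (C' \<inter> D) * prob D'\<bar> = \<bar>prob (C \<inter> D) - prob (C' \<inter> D)\<bar> * prob D'"
        by (simp add: left_diff_distrib[symmetric] abs_mult)
      also have "\<dots> \<le> \<bar>prob (C \<inter> D) - prob (C' \<inter> D)\<bar> * 1" by (intro mult_left_mono) auto
      finally show ?thesis using close[of D] by simp
    qed
    ultimately show ?thesis by linarith
  qed
  have "\<bar>prob (C \<inter> (D \<inter> D')) - prob (C \<inter> D) * prob D'\<bar> \<le> 0"
  proof (rule field_le_epsilon)
    fix e :: real assume "0 < e"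
    then show "\<bar>prob (C \<inter> (D \<inter> D')) - prob (C \<inter> D) * prob D'\<bar> \<le> 0 + e"
      using bound[of "e / 2"] by simp
  qed
  then have "prob (C \<inter> (D \<inter> D')) = prob (C \<inter> D) * prob D'" by simp
  also have "prob (C \<inter> D) = prob C * prob D"
  proof -
    have "C \<inter> D = {\<omega>\<in>space M. (\<lambda>t. W t \<omega>) \<in> A \<and> (\<lambda>t. Z t \<omega>) \<in> B}"
      by (auto simp: C_def D_def)
    then show ?thesis using prob_invariant_Z[OF A inv B] by (simp add: C_def D_def)
  qed
  also have "prob C * prob D * prob D' = prob C * prob (D \<inter> D')"
  proof -
    have "indep_pair path_space (\<lambda>\<omega> t. Z t \<omega>) (Pi\<^sub>M {..m} (\<lambda>_. borel)) (\<lambda>\<omega>. \<lambda>j\<in>{..m}. eps j \<omega>)"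
      by (rule indep_pair_compose[OF indep_Z_eps measurable_ident, of "\<lambda>e. restrict e {..m}", simplified])
        (rule measurable_restrict_subset, simp)
    moreover have "D = (\<lambda>\<omega> t. Z t \<omega>) -` B \<inter> space M" by (auto simp: D_def)
    moreover have "D' = (\<lambda>\<omega>. \<lambda>j\<in>{..m}. eps j \<omega>) -` B' \<inter> space M" by (auto simp: D'_def)
    ultimately have "prob (D \<inter> D') = prob D * prob D'"
      using indep_pairD[OF _ B B'] by metis
    then show ?thesis by simp
  qed
  finally show ?thesis .
qed

lemma W_ergodic: "ergodic_process M W"
  unfolding ergodic_process_def
proof (intro conjI ballI impI W_stat)
  fix A :: "(int \<Rightarrow> 'z \<times> 'w) set"
  assume A[measurable]: "A \<in> sets path_space"
    and inv0: "(\<lambda>w t. w (t + 1)) -` A \<inter> space path_space = A"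
  have inv: "(\<lambda>t. w (t + 1)) \<in> A \<longleftrightarrow> w \<in> A" for w using inv0 by auto
  define C where "C = {\<omega>\<in>space M. (\<lambda>t. W t \<omega>) \<in> A}"
  \<comment> \<open>A pi-system that generates all \<open>Z t\<close> and \<open>eps t\<close>: each
    noise time lies in some window \<open>{..m}\<close>, and two windows fit into the larger one.
    \<open>C\<close> is independent of \<open>E\<close>, hence of the generated sigma-algebra, to
    which \<open>C\<close> itself belongs.\<close>
  define E where "E = {{\<omega>\<in>space M. (\<lambda>t. Z t \<omega>) \<in> B} \<inter> {\<omega>\<in>space M. (\<lambda>j\<in>{..m}. eps j \<omega>) \<in> B'} | B B' m.
      B \<in> sets path_space \<and> B' \<in> sets (Pi\<^sub>M {..m} (\<lambda>_. borel))}"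
  have C[measurable]: "C \<in> sets M" unfolding C_def by measurable
  have E: "E \<subseteq> sets M" unfolding E_def by auto
  have "indep_set {C} E"
  proof (rule indep_setI)
    fix a b assume "a \<in> {C}" "b \<in> E"
    then show "prob (a \<inter> b) = prob a * prob b"
      using invariant_indep[OF A inv] by (auto simp: C_def E_def)
  qed (use C E in auto)
  moreover have "Int_stable {C}" by (simp add: Int_stable_def)
  moreover have "Int_stable E"
    unfolding Int_stable_def
  proof (intro ballI)
    fix a b assume "a \<in> E" "b \<in> E"
    then obtain B1 B1' m1 B2 B2' m2 where
      a: "a = {\<omega>\<in>space M. (\<lambda>t. Z t \<omega>) \<in> B1} \<inter> {\<omega>\<in>space M. (\<lambda>j\<in>{..m1}. eps j \<omega>) \<in> B1'}"
      and [measurable]: "B1 \<in> sets path_space" "B1' \<in> sets (Pi\<^sub>M {..m1} (\<lambda>_. borel))"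
      and b: "b = {\<omega>\<in>space M. (\<lambda>t. Z t \<omega>) \<in> B2} \<inter> {\<omega>\<in>space M. (\<lambda>j\<in>{..m2}. eps j \<omega>) \<in> B2'}"
      and [measurable]: "B2 \<in> sets path_space" "B2' \<in> sets (Pi\<^sub>M {..m2} (\<lambda>_. borel))"
      unfolding E_def by blast
    let ?m = "max m1 m2"
    have [measurable]: "(\<lambda>e. restrict e {..m1}) \<in> Pi\<^sub>M {..?m} (\<lambda>_. borel) \<rightarrow>\<^sub>M Pi\<^sub>M {..m1} (\<lambda>_. borel :: 'w measure)"
      "(\<lambda>e. restrict e {..m2}) \<in> Pi\<^sub>M {..?m} (\<lambda>_. borel) \<rightarrow>\<^sub>M Pi\<^sub>M {..m2} (\<lambda>_. borel :: 'w measure)"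
      by (intro measurable_restrict_subset; auto)+
    define B' where "B' = {e \<in> space (Pi\<^sub>M {..?m} (\<lambda>_. borel)). restrict e {..m1} \<in> B1' \<and> restrict e {..m2} \<in> B2'}"
    have "B' \<in> sets (Pi\<^sub>M {..?m} (\<lambda>_. borel))" unfolding B'_def by measurable
    moreover have "B1 \<inter> B2 \<in> sets path_space" by measurable
    moreover have "a \<inter> b = {\<omega>\<in>space M. (\<lambda>t. Z t \<omega>) \<in> B1 \<inter> B2} \<inter> {\<omega>\<in>space M. (\<lambda>j\<in>{..?m}. eps j \<omega>) \<in> B'}"
    proof -
      have "{..?m} \<inter> {..m1} = {..m1}" "{..?m} \<inter> {..m2} = {..m2}" by auto
      then show ?thesis by (auto simp: a b B'_def space_PiM)
    qed
    ultimately show "a \<inter> b \<in> E" unfolding E_def by blast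
  qed
  ultimately have ind: "indep_set (sigma_sets (space M) {C}) (sigma_sets (space M) E)"
    by (rule indep_set_sigma_sets)
  have "C \<in> sigma_sets (space M) E"
  proof -
    let ?S = "sigma (space M) E"
    have sets: "sets ?S = sigma_sets (space M) E" "space ?S = space M"
      using E sets.space_closed[of M] by (auto simp: sets_measure_of_conv space_measure_of_conv)
    have "Z t \<in> borel_measurable ?S" for t
    proof (rule measurableI)
      fix B :: "'z set" assume B[measurable]: "B \<in> sets borel"
      have "{z \<in> space path_space. z t \<in> B} \<in> sets path_space" by measurable
      moreover have "Z t -` B \<inter> space ?S = {\<omega>\<in>space M. (\<lambda>t. Z t \<omega>) \<in> {z \<in> space path_space. z t \<in> B}} \<inter>
          {\<omega>\<in>space M. (\<lambda>j\<in>{..0}. eps j \<omega>) \<in> space (Pi\<^sub>M {..0} (\<lambda>_. borel))}"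
        by (auto simp: sets(2) space_PiM)
      ultimately have "Z t -` B \<inter> space ?S \<in> E" unfolding E_def by blast
      then show "Z t -` B \<inter> space ?S \<in> sets ?S" by (simp add: sets(1))
    qed simp
    moreover have "eps t \<in> borel_measurable ?S" for t
    proof (rule measurableI)
      fix B :: "'w set" assume B[measurable]: "B \<in> sets borel"
      have "{e \<in> space (Pi\<^sub>M {..t} (\<lambda>_. borel)). e t \<in> B} \<in> sets (Pi\<^sub>M {..t} (\<lambda>_. borel))" by measurable
      moreover have "eps t -` B \<inter> space ?S = {\<omega>\<in>space M. (\<lambda>t. Z t \<omega>) \<in> space path_space} \<inter>
          {\<omega>\<in>space M. (\<lambda>j\<in>{..t}. eps j \<omega>) \<in> {e \<in> space (Pi\<^sub>M {..t} (\<lambda>_. borel)). e t \<in> B}}"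
        by (auto simp: sets(2) space_PiM)
      ultimately have "eps t -` B \<inter> space ?S \<in> E" unfolding E_def by blast
      then show "eps t -` B \<inter> space ?S \<in> sets ?S" by (simp add: sets(1))
    qed simp
    ultimately have "(\<lambda>\<omega> t. W t \<omega>) \<in> ?S \<rightarrow>\<^sub>M path_space"
      unfolding W_def by measurable
    from measurable_sets[OF this A] show ?thesis
      by (simp add: sets C_def vimage_def Int_def conj_commute)
  qed
  then have "prob (C \<inter> C) = prob C * prob C"
    by (intro indep_setD[OF ind]) auto
  then have "prob C = 0 \<or> prob C = 1" by simp
  moreover have "measure (proc_law M W) A = prob C"
    unfolding proc_law_def C_def by (subst measure_distr) (auto intro!: arg_cong[where f = prob])
  ultimately show "measure (proc_law M W) A = 0 \<or> measure (proc_law M W) A = 1" by simp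
qed

end

section \<open>Growth of products along the stationary process\<close>

text \<open>The negative part of \<open>u\<close> may have infinite integral, so that the mean of
  the logarithm is minus infinity. A cut from below at \<open>- K\<close> restores integrability,
  and monotone convergence of the truncated negative parts keeps the mean negative for some
  \<open>K\<close>.\<close>

lemma (in prob_space) truncated_log_expectation:
  fixes u :: "'a \<Rightarrow> real"
  assumes [measurable]: "u \<in> borel_measurable M"
    and neg: "(\<integral>\<^sup>+ \<omega>. ennreal (u \<omega>) \<partial>M) < (\<integral>\<^sup>+ \<omega>. ennreal (- u \<omega>) \<partial>M)"
  obtains K :: nat where "integrable M (\<lambda>\<omega>. max (u \<omega>) (- real K))" "(\<integral>\<omega>. max (u \<omega>) (- real K) \<partial>M) < 0"
proof -
  have "(\<integral>\<^sup>+ \<omega>. ennreal (- u \<omega>) \<partial>M) = (\<integral>\<^sup>+ \<omega>. (SUP K::nat. ennreal (min (- u \<omega>) (real K))) \<partial>M)"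
  proof (rule nn_integral_cong)
    fix \<omega>
    obtain K :: nat where K: "- u \<omega> \<le> real K" using real_arch_simple by blast
    show "ennreal (- u \<omega>) = (SUP K::nat. ennreal (min (- u \<omega>) (real K)))"
    proof (rule antisym)
      show "ennreal (- u \<omega>) \<le> (SUP K::nat. ennreal (min (- u \<omega>) (real K)))"
        using K by (intro SUP_upper2[of K]) auto
    qed (auto intro!: SUP_least ennreal_leI)
  qed
  also have "\<dots> = (SUP K::nat. \<integral>\<^sup>+ \<omega>. ennreal (min (- u \<omega>) (real K)) \<partial>M)"
    by (rule nn_integral_monotone_convergence_SUP) (auto simp: incseq_def le_fun_def intro!: ennreal_leI)
  finally obtain K :: nat where K: "(\<integral>\<^sup>+ \<omega>. ennreal (u \<omega>) \<partial>M) < (\<integral>\<^sup>+ \<omega>. ennreal (min (- u \<omega>) (real K)) \<partial>M)"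
    using neg by (auto simp: less_SUP_iff)
  let ?g = "\<lambda>\<omega>. max (u \<omega>) (- real K)"
  have pos: "(\<integral>\<^sup>+ \<omega>. ennreal (?g \<omega>) \<partial>M) = (\<integral>\<^sup>+ \<omega>. ennreal (u \<omega>) \<partial>M)"
    by (intro nn_integral_cong) (auto simp: max_def ennreal_neg)
  have "- ?g \<omega> = min (- u \<omega>) (real K)" for \<omega> by (simp add: max_def min_def)
  then have negp: "(\<integral>\<^sup>+ \<omega>. ennreal (- ?g \<omega>) \<partial>M) = (\<integral>\<^sup>+ \<omega>. ennreal (min (- u \<omega>) (real K)) \<partial>M)"
    by simp
  have "(\<integral>\<^sup>+ \<omega>. ennreal (min (- u \<omega>) (real K)) \<partial>M) \<le> (\<integral>\<^sup>+ \<omega>. ennreal (real K) \<partial>M)"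
    by (intro nn_integral_mono ennreal_leI) auto
  also have "\<dots> < \<infinity>" by (simp add: emeasure_space_1)
  finally have fin: "(\<integral>\<^sup>+ \<omega>. ennreal (min (- u \<omega>) (real K)) \<partial>M) < \<infinity>" .
  have fin': "(\<integral>\<^sup>+ \<omega>. ennreal (u \<omega>) \<partial>M) < \<infinity>" using K fin by (rule less_trans)
  have int: "integrable M ?g"
    unfolding real_integrable_def pos negp using fin fin' by auto
  have "(\<integral>\<omega>. ?g \<omega> \<partial>M) < 0"
    unfolding real_lebesgue_integral_def[OF int] pos negp
    using K fin fin' by (simp add: enn2real_less_iff)
  with int show ?thesis by (rule that)
qed

text \<open>The number of \<open>n\<close> below \<open>x\<close> is the ceiling of
  \<open>x\<close>. Taking means, a sum of tail probabilities is controlled by a first moment, as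
  Borel-Cantelli requires.\<close>

lemma suminf_indicator_less:
  assumes "0 \<le> x"
  shows "(\<Sum>n. indicator {y. real n < y} x :: ennreal) \<le> ennreal (x + 1)"
proof -
  let ?m = "nat \<lceil>x\<rceil>"
  have "(\<Sum>n. indicator {y. real n < y} x :: ennreal) = (\<Sum>n<?m. indicator {y. real n < y} x)"
  proof (rule suminf_finite)
    fix n assume "n \<notin> {..<?m}"
    then have "\<not> real n < x" by (simp add: not_less ceiling_le_iff nat_le_iff)
    then show "indicator {y. real n < y} x = (0::ennreal)" by simp
  qed simp
  also have "\<dots> \<le> (\<Sum>n<?m. 1)" by (intro sum_mono) (auto simp: indicator_def)
  also have "\<dots> = ennreal (real ?m)" by (simp add: ennreal_of_nat_eq_real_of_nat)
  also have "\<dots> \<le> ennreal (x + 1)" using assms by (intro ennreal_leI) linarith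
  finally show ?thesis .
qed

lemma le_exp_logplus: "0 \<le> c \<Longrightarrow> c \<le> exp (logplus c)"
  by (simp add: logplus_def)

lemma logplus_nonneg: "0 \<le> logplus c"
  by (simp add: logplus_def)

lemma measurable_logplus [measurable]: "logplus \<in> borel_measurable borel"
  unfolding logplus_def by measurable

context noise_driven
begin

lemma product_exponential_decay:
  assumes \<kappa>[measurable]: "\<kappa> \<in> borel_measurable borel" and pos: "\<And>z. 0 < \<kappa> z"
    and neg: "(\<integral>\<^sup>+ \<omega>. ennreal (ln (\<kappa> (Z 0 \<omega>))) \<partial>M) < (\<integral>\<^sup>+ \<omega>. ennreal (- ln (\<kappa> (Z 0 \<omega>))) \<partial>M)"
  obtains \<delta> where "0 < \<delta>"
    "\<And>t. AE \<omega> in M. \<exists>C. \<forall>n. (\<Prod>i<n. \<kappa> (Z (t - 1 - int i) \<omega>)) \<le> C * exp (- \<delta> * real n)"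
proof -
  obtain K :: nat where K: "integrable M (\<lambda>\<omega>. max (ln (\<kappa> (Z 0 \<omega>))) (- real K))"
    "(\<integral>\<omega>. max (ln (\<kappa> (Z 0 \<omega>))) (- real K) \<partial>M) < 0"
    using truncated_log_expectation[OF _ neg] by auto
  \<comment> \<open>Half of the negative drift is spent: after adding \<delta> the truncated
    logarithm has mean \<open>- \<delta>\<close>, still negative, and upper bounded partial sums of
    \<open>g\<close> mean exponential decay of the product at rate \<delta>.\<close>
  define \<delta> where "\<delta> = - (\<integral>\<omega>. max (ln (\<kappa> (Z 0 \<omega>))) (- real K) \<partial>M) / 2"
  have \<delta>: "0 < \<delta>" using K by (simp add: \<delta>_def)
  define g where "g z = max (ln (\<kappa> z)) (- real K) + \<delta>" for z
  have [measurable]: "g \<in> borel_measurable borel" unfolding g_def by measurable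
  have "(\<integral>\<omega>. g (Z 0 \<omega>) \<partial>M) = (\<integral>\<omega>. max (ln (\<kappa> (Z 0 \<omega>))) (- real K) \<partial>M) + \<delta>"
    using K(1) by (simp add: g_def prob_space)
  then have gneg: "(\<integral>\<omega>. g (Z 0 \<omega>) \<partial>M) < 0" using K(2) by (simp add: \<delta>_def)
  have gint: "integrable M (\<lambda>\<omega>. g (Z 0 \<omega>))" using K(1) by (simp add: g_def)
  have bdd: "AE w in proc_law M Z. bdd_above (range (\<lambda>n. path_max g n w))"
    by (rule ergodic_path_max_bounded[OF prob_space_axioms Z_erg _ gint gneg]) simp
  have "AE \<omega> in M. \<exists>C. \<forall>n. (\<Prod>i<n. \<kappa> (Z (t - 1 - int i) \<omega>)) \<le> C * exp (- \<delta> * real n)" for t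
  proof -
    \<comment> \<open>By stationarity the path seen from time \<open>t\<close> has the same law, so
      the bound obtained for the law of \<open>Z\<close> holds around every
      \<open>t\<close>.\<close>
    have "proc_law M Z = proc_law M (\<lambda>s. Z (s + t))"
      using Z_stat by (simp add: stationary_process_def)
    from subst[OF this, where P = "\<lambda>N. AE w in N. bdd_above (range (\<lambda>n. path_max g n w))", OF bdd]
    have "AE w in distr M path_space (\<lambda>\<omega> s. Z (s + t) \<omega>). bdd_above (range (\<lambda>n. path_max g n w))"
      unfolding proc_law_def .
    then have "AE \<omega> in M. bdd_above (range (\<lambda>n. path_max g n (\<lambda>s. Z (s + t) \<omega>)))"
      by (rule AE_distrD[rotated]) simp
    then show ?thesis
    proof eventually_elim
      case (elim \<omega>)
      then obtain C where C: "\<And>n. path_max g n (\<lambda>s. Z (s + t) \<omega>) \<le> C"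
        by (auto simp: bdd_above_def)
      have "(\<Prod>i<n. \<kappa> (Z (t - 1 - int i) \<omega>)) \<le> exp C * exp (- \<delta> * real n)" for n
      proof -
        have "(\<Sum>i<n. ln (\<kappa> (Z (t - 1 - int i) \<omega>))) \<le> (\<Sum>i<n. g (Z (-1 - int i + t) \<omega>) - \<delta>)"
          by (intro sum_mono) (simp add: g_def algebra_simps)
        also have "\<dots> \<le> C - \<delta> * real n"
          using sum_le_path_max[of g "\<lambda>s. Z (s + t) \<omega>" n] C[of n] by (simp add: sum_subtractf)
        finally have "exp (\<Sum>i<n. ln (\<kappa> (Z (t - 1 - int i) \<omega>))) \<le> exp (C - \<delta> * real n)" by simp
        then show ?thesis using pos by (simp add: exp_sum exp_diff exp_minus divide_inverse)
      qed
      then show ?case by blast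
    qed
  qed
  with \<delta> show ?thesis by (rule that)
qed

text \<open>After division of the logarithm by \<eta>, stationarity makes the probability of
  exceeding \<open>n\<close> at time \<open>t - 1 - n\<close> a tail probability of the single
  variable \<open>G (Z 0)\<close>, and these tails sum to at most its mean plus 1.\<close>

lemma subexponential_growth:
  assumes c[measurable]: "c \<in> borel_measurable borel" and pos: "\<And>z. 0 \<le> c z"
    and fin: "(\<integral>\<^sup>+ \<omega>. ennreal (logplus (c (Z 0 \<omega>))) \<partial>M) < \<infinity>" and \<eta>: "0 < \<eta>"
  shows "AE \<omega> in M. \<exists>C. \<forall>n. c (Z (t - 1 - int n) \<omega>) \<le> C * exp (\<eta> * real n)"
proof -
  define G where "G z = logplus (c z) / \<eta>" for z
  have [measurable]: "G \<in> borel_measurable borel" unfolding G_def by measurable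
  have G0: "0 \<le> G z" for z using \<eta> by (simp add: G_def logplus_nonneg)
  define A where "A n = {\<omega>\<in>space M. real n < G (Z (t - 1 - int n) \<omega>)}" for n
  have [measurable]: "A n \<in> sets M" for n unfolding A_def by measurable
  have A: "emeasure M (A n) = (\<integral>\<^sup>+ \<omega>. indicator {y. real n < y} (G (Z 0 \<omega>)) \<partial>M)" for n
  proof -
    have "emeasure M (A n) = (\<integral>\<^sup>+ \<omega>. indicator {y. real n < y} (G (Z (0 + (t - 1 - int n)) \<omega>)) \<partial>M)"
    proof -
      have "emeasure M (A n) = (\<integral>\<^sup>+ \<omega>. indicator (A n) \<omega> \<partial>M)" by simp
      also have "\<dots> = (\<integral>\<^sup>+ \<omega>. indicator {y. real n < y} (G (Z (0 + (t - 1 - int n)) \<omega>)) \<partial>M)"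
        by (intro nn_integral_cong) (simp add: A_def indicator_def)
      finally show ?thesis .
    qed
    also have "\<dots> = (\<integral>\<^sup>+ \<omega>. indicator {y. real n < y} (G (Z 0 \<omega>)) \<partial>M)"
      by (rule stationary_process_nn_integral[OF Z_stat, of "\<lambda>z. indicator {y. real n < y} (G (z 0))"]) measurable
    finally show ?thesis .
  qed
  have "(\<Sum>n. emeasure M (A n)) = (\<integral>\<^sup>+ \<omega>. (\<Sum>n. indicator {y. real n < y} (G (Z 0 \<omega>))) \<partial>M)"
    unfolding A by (rule nn_integral_suminf[symmetric]) measurable
  also have "\<dots> \<le> (\<integral>\<^sup>+ \<omega>. ennreal (G (Z 0 \<omega>) + 1) \<partial>M)"
    by (intro nn_integral_mono suminf_indicator_less G0)
  also have "\<dots> = (\<integral>\<^sup>+ \<omega>. ennreal (inverse \<eta>) * ennreal (logplus (c (Z 0 \<omega>))) + 1 \<partial>M)"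
    using \<eta> by (intro nn_integral_cong) (simp add: G_def divide_inverse logplus_nonneg ennreal_mult mult.commute)
  also have "\<dots> = (\<integral>\<^sup>+ \<omega>. ennreal (inverse \<eta>) * ennreal (logplus (c (Z 0 \<omega>))) \<partial>M) + 1"
    by (subst nn_integral_add) (simp_all add: emeasure_space_1)
  also have "\<dots> = ennreal (inverse \<eta>) * (\<integral>\<^sup>+ \<omega>. ennreal (logplus (c (Z 0 \<omega>))) \<partial>M) + 1"
    by (simp add: nn_integral_cmult)
  also have "\<dots> < \<infinity>" using fin by (simp add: ennreal_mult_less_top)
  finally have "(\<Sum>n. ennreal (prob (A n))) < \<infinity>" by (simp add: emeasure_eq_measure)
  then have "summable (\<lambda>n. prob (A n))" by (intro summable_suminf_not_top) auto
  then have "AE \<omega> in M. eventually (\<lambda>n. \<omega> \<in> space M - A n) sequentially"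
    by (intro borel_cantelli_AE1) (auto simp: emeasure_eq_measure)
  then show ?thesis
  proof eventually_elim
    case (elim \<omega>)
    let ?f = "\<lambda>n. c (Z (t - 1 - int n) \<omega>)"
    from elim obtain N where N: "\<And>n. n \<ge> N \<Longrightarrow> \<omega> \<in> space M - A n" by (auto simp: eventually_sequentially)
    have tail: "?f n \<le> exp (\<eta> * real n)" if "n \<ge> N" for n
    proof -
      have "logplus (?f n) \<le> \<eta> * real n"
        using N[OF that] \<eta> by (auto simp: A_def G_def not_less field_simps)
      then show ?thesis using le_exp_logplus[OF pos, of "Z (t - 1 - int n) \<omega>"] by (meson exp_le_cancel_iff order_trans)
    qed
    have S: "0 \<le> (\<Sum>i<N. ?f i)" by (intro sum_nonneg pos)
    \<comment> \<open>The 1 covers the tail, the finite sum the \<open>N\<close> exceptional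
      indices.\<close>
    have "?f n \<le> (1 + (\<Sum>i<N. ?f i)) * exp (\<eta> * real n)" for n
    proof (cases "n < N")
      case True
      then have "?f n \<le> (\<Sum>i<N. ?f i)" by (intro member_le_sum) (auto simp: pos)
      also have "\<dots> \<le> (1 + (\<Sum>i<N. ?f i)) * 1" by simp
      also have "\<dots> \<le> (1 + (\<Sum>i<N. ?f i)) * exp (\<eta> * real n)"
        using S \<eta> by (intro mult_left_mono) auto
      finally show ?thesis .
    next
      case False
      then have "?f n \<le> 1 * exp (\<eta> * real n)" using tail by simp
      also have "\<dots> \<le> (1 + (\<Sum>i<N. ?f i)) * exp (\<eta> * real n)"
        using S by (intro mult_right_mono) auto
      finally show ?thesis .
    qed
    then show ?case by blast
  qed
qed

end

section \<open>Conditional contraction of the iterated maps\<close>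

text \<open>On the sets where \<open>R \<le> n\<close>, which belong to \<open>F\<close>, the
  integral of \<open>Q\<close> is finite, and these sets exhaust the space up to a null set. A
  conditional bound thus yields finiteness of \<open>Q\<close> itself.\<close>

lemma (in finite_measure_subalgebra) AE_finite_if_conditionally_dominated:
  assumes Q[measurable]: "Q \<in> borel_measurable M" and R[measurable]: "R \<in> borel_measurable F"
    and fin: "AE x in M. R x < \<infinity>"
    and le: "\<And>A. A \<in> sets F \<Longrightarrow> (\<integral>\<^sup>+ x. indicator A x * Q x \<partial>M) \<le> (\<integral>\<^sup>+ x. indicator A x * R x \<partial>M)"
  shows "AE x in M. Q x < (\<infinity>::ennreal)"
proof -
  have sp: "space F = space M" using subalg by (simp add: subalgebra_def)
  have [measurable]: "R \<in> borel_measurable M" by (rule measurable_from_subalg[OF subalg R])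
  have "AE x in M. R x \<le> of_nat n \<longrightarrow> Q x < \<infinity>" for n
  proof -
    define A where "A = {x \<in> space F. R x \<le> of_nat n}"
    have A: "A \<in> sets F" unfolding A_def by measurable
    have [measurable]: "A \<in> sets M" using A subalg by (auto simp: subalgebra_def)
    note le[OF A]
    also have "(\<integral>\<^sup>+ x. indicator A x * R x \<partial>M) \<le> (\<integral>\<^sup>+ x. of_nat n \<partial>M)"
      by (intro nn_integral_mono) (auto simp: A_def split: split_indicator)
    also have "\<dots> < \<infinity>" by (simp add: emeasure_eq_measure ennreal_of_nat_eq_real_of_nat ennreal_mult''[symmetric])
    finally have "AE x in M. indicator A x * Q x \<noteq> \<infinity>"
      by (intro nn_integral_PInf_AE) auto
    then show ?thesis
      by (rule AE_mp) (auto intro!: AE_I2 simp: A_def sp less_top split: split_indicator_asm)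
  qed
  then have "AE x in M. \<forall>n::nat. R x \<le> of_nat n \<longrightarrow> Q x < \<infinity>" by (subst AE_all_countable) blast
  with fin show ?thesis
  proof eventually_elim
    case (elim x)
    then obtain n where "R x < of_nat n" using ennreal_Ex_less_of_nat[of "R x"] by auto
    then have "R x \<le> of_nat n" by (rule less_imp_le)
    with elim show ?case by auto
  qed
qed

text \<open>The sum is at most three times its largest term. The crude constant is harmless, as it
  only enters finiteness and summability statements.\<close>

lemma powr_add3_le:
  fixes a b c :: real
  assumes "0 \<le> a" "0 \<le> b" "0 \<le> c" "0 < p"
  shows "(a + b + c) powr p \<le> 3 powr p * (a powr p + b powr p + c powr p)"
proof -
  define m where "m = max a (max b c)"
  have "(a + b + c) powr p \<le> (3 * m) powr p"
    using assms by (intro powr_mono2) (auto simp: m_def)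
  also have "\<dots> = 3 powr p * m powr p" by (rule powr_mult)
  also have "\<dots> \<le> 3 powr p * (a powr p + b powr p + c powr p)"
    by (intro mult_left_mono) (auto simp: m_def max_def)
  finally show ?thesis .
qed

text \<open>The recursion of \<open>iterF\<close> peels off the latest map; peeling off the
  earliest, at time \<open>t - n\<close>, exhibits \<open>n + 1\<close> and \<open>n\<close>
  iterates as one and the same map applied to two starting points.\<close>

lemma iterF_Suc_inner:
  "iterF F Z eps t (Suc n) x \<omega> = iterF F Z eps t n (F x (Z (t - 1 - int n) \<omega>) (eps (t - int n) \<omega>)) \<omega>"
proof (induction n arbitrary: t)
  case (Suc n)
  have "iterF F Z eps t (Suc (Suc n)) x \<omega> = F (iterF F Z eps (t - 1) (Suc n) x \<omega>) (Z (t - 1) \<omega>) (eps t \<omega>)"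
    by simp
  also have "\<dots> = F (iterF F Z eps (t - 1) n (F x (Z (t - 1 - 1 - int n) \<omega>) (eps (t - 1 - int n) \<omega>)) \<omega>) (Z (t - 1) \<omega>) (eps t \<omega>)"
    by (subst Suc) simp
  finally show ?case by (simp add: algebra_simps)
qed simp

locale random_maps = noise_driven M Z eps
  for M :: "'a measure" and Z :: "int \<Rightarrow> 'a \<Rightarrow> 'z::second_countable_topology"
    and eps :: "int \<Rightarrow> 'a \<Rightarrow> 'w::second_countable_topology" +
  fixes F :: "'e::polish_space \<Rightarrow> 'z \<Rightarrow> 'w \<Rightarrow> 'e" and \<kappa> :: "'z \<Rightarrow> real" and p :: real and x0 :: 'e
  assumes F_meas: "(\<lambda>(x, z, w). F x z w) \<in> borel \<Otimes>\<^sub>M borel \<Otimes>\<^sub>M borel \<rightarrow>\<^sub>M borel"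
    and p_pos: "0 < p"
    and \<kappa>_meas [measurable]: "\<kappa> \<in> borel_measurable borel"
    and \<kappa>_pos: "\<And>z. 0 < \<kappa> z"
    and \<kappa>_logneg: "(\<integral>\<^sup>+ \<omega>. ennreal (ln (\<kappa> (Z 0 \<omega>))) \<partial>M) < (\<integral>\<^sup>+ \<omega>. ennreal (- ln (\<kappa> (Z 0 \<omega>))) \<partial>M)"
    and contr: "\<And>x y z. (\<integral>\<^sup>+ u. ennreal (dist (F x z u) (F y z u) powr p) \<partial>distr M borel (eps 0))
      \<le> ennreal (\<kappa> z powr p * dist x y powr p)"
    and moment: "\<And>z. (\<integral>\<^sup>+ u. ennreal (dist (F x0 z u) x0 powr p) \<partial>distr M borel (eps 0)) < \<infinity>"
    and log_moment: "(\<integral>\<^sup>+ \<omega>. ennreal (logplus (enn2real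
        (\<integral>\<^sup>+ u. ennreal (dist (F x0 (Z 0 \<omega>) u) x0 powr p) \<partial>distr M borel (eps 0)))) \<partial>M) < \<infinity>"
begin

abbreviation \<mu> :: "'w measure" where "\<mu> \<equiv> distr M borel (eps 0)"

abbreviation f :: "int \<Rightarrow> nat \<Rightarrow> 'e \<Rightarrow> 'a \<Rightarrow> 'e" where "f \<equiv> iterF F Z eps"

abbreviation dp :: "'e \<Rightarrow> 'e \<Rightarrow> ennreal" where "dp x y \<equiv> ennreal (dist x y powr p)"

text \<open>The noise stops strictly before \<open>t\<close>, which leaves \<open>eps t\<close>
  independent; a variable that knows the noise up to \<open>t\<close> is therefore measurable for
  \<open>past (t + 1)\<close>.\<close>

definition past :: "int \<Rightarrow> 'a measure" where
  "past t = vimage_algebra (space M) (\<lambda>\<omega>. (\<lambda>s. Z s \<omega>, \<lambda>j\<in>{..<t}. eps j \<omega>))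
     (path_space \<Otimes>\<^sub>M Pi\<^sub>M {..<t} (\<lambda>_. borel))"

abbreviation \<Z> :: "'a measure" where "\<Z> \<equiv> proc_sigma M UNIV Z"

lemma measurable_F [measurable (raw)]:
  assumes "a \<in> N \<rightarrow>\<^sub>M borel" "b \<in> N \<rightarrow>\<^sub>M borel" "c \<in> N \<rightarrow>\<^sub>M borel"
  shows "(\<lambda>x. F (a x) (b x) (c x)) \<in> N \<rightarrow>\<^sub>M borel"
proof -
  have "(\<lambda>x. (a x, b x, c x)) \<in> N \<rightarrow>\<^sub>M borel \<Otimes>\<^sub>M borel \<Otimes>\<^sub>M borel" using assms by simp
  from measurable_compose[OF this F_meas] show ?thesis by simp
qed

lemma space_past [simp]: "space (past t) = space M"
  by (simp add: past_def)

lemma past_proj: "(\<lambda>\<omega>. (\<lambda>s. Z s \<omega>, \<lambda>j\<in>{..<t}. eps j \<omega>)) \<in> past t \<rightarrow>\<^sub>M path_space \<Otimes>\<^sub>M Pi\<^sub>M {..<t} (\<lambda>_. borel)"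
  unfolding past_def by (rule measurable_vimage_algebra1) (auto simp: space_pair_measure space_PiM)

lemma Z_past [measurable]: "Z s \<in> borel_measurable (past t)"
proof -
  have "(\<lambda>ze. fst ze s) \<in> borel_measurable ((path_space :: (int \<Rightarrow> 'z) measure) \<Otimes>\<^sub>M Pi\<^sub>M {..<t} (\<lambda>_. borel :: 'w measure))"
    by measurable
  from measurable_compose[OF past_proj this] show ?thesis by simp
qed

lemma eps_past: "j < t \<Longrightarrow> eps j \<in> borel_measurable (past t)"
proof -
  assume j: "j < t"
  then have "(\<lambda>ze. snd ze j) \<in> borel_measurable ((path_space :: (int \<Rightarrow> 'z) measure) \<Otimes>\<^sub>M Pi\<^sub>M {..<t} (\<lambda>_. borel :: 'w measure))"
    by (intro measurable_compose[OF measurable_snd measurable_component_singleton]) simp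
  from measurable_compose[OF past_proj this] show ?thesis using j by simp
qed

lemma sets_past: "sets (past t) \<subseteq> sets M"
  unfolding past_def by (intro sets_image_in_sets) measurable

lemma past_mono: "s \<le> t \<Longrightarrow> sets (past s) \<subseteq> sets (past t)"
  unfolding past_def[of s]
  by (intro sets_image_in_sets measurable_Pair measurable_path measurable_restrict) (auto intro: eps_past)

lemma measurable_past_mono: "s \<le> t \<Longrightarrow> g \<in> past s \<rightarrow>\<^sub>M N \<Longrightarrow> g \<in> past t \<rightarrow>\<^sub>M N"
  by (rule measurable_mono[THEN subsetD, OF order_refl refl past_mono]) simp_all

lemma measurable_past_M: "g \<in> past s \<rightarrow>\<^sub>M N \<Longrightarrow> g \<in> M \<rightarrow>\<^sub>M N"
  by (rule measurable_mono[THEN subsetD, OF order_refl refl sets_past]) simp_all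

lemma space_Z [simp]: "space \<Z> = space M"
  by (simp add: proc_sigma_def)

lemma sets_Z_past: "sets \<Z> \<subseteq> sets (past t)"
  unfolding proc_sigma_UNIV by (intro sets_image_in_sets measurable_path) auto

lemma measurable_Z_past: "g \<in> \<Z> \<rightarrow>\<^sub>M N \<Longrightarrow> g \<in> past t \<rightarrow>\<^sub>M N"
  by (rule measurable_mono[THEN subsetD, OF order_refl refl sets_Z_past]) simp_all

lemma Z_in_Z [measurable]: "Z s \<in> borel_measurable \<Z>"
proof -
  have "(\<lambda>\<omega> s. Z s \<omega>) \<in> \<Z> \<rightarrow>\<^sub>M path_space"
    unfolding proc_sigma_UNIV by (rule measurable_vimage_algebra1) simp
  then show ?thesis by (rule measurable_compose) measurable
qed

lemma subalgebra_Z: "subalgebra M \<Z>"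
  using sets_Z_past sets_past by (auto simp: subalgebra_def)

sublocale Z: finite_measure_subalgebra M \<Z>
  by (simp add: finite_measure_subalgebra_def finite_measure_subalgebra_axioms_def finite_measure_axioms subalgebra_Z)

lemma indep_past_eps:
  assumes "R \<in> past t \<rightarrow>\<^sub>M N"
  shows "indep_pair N R borel (eps t)"
proof (rule indep_pair_vimage_algebra[OF indep_Z_eps_disjoint[of "{..<t}" "{t}"]])
  show "R \<in> vimage_algebra (space M) (\<lambda>\<omega>. (\<lambda>s. Z s \<omega>, \<lambda>j\<in>{..<t}. eps j \<omega>))
      (path_space \<Otimes>\<^sub>M Pi\<^sub>M {..<t} (\<lambda>_. borel)) \<rightarrow>\<^sub>M N"
    using assms by (simp add: past_def)
  have "(\<lambda>\<omega>. (\<lambda>j\<in>{t}. eps j \<omega>) t) \<in> borel_measurable (vimage_algebra (space M) (\<lambda>\<omega>. \<lambda>j\<in>{t}. eps j \<omega>) (Pi\<^sub>M {t} (\<lambda>_. borel)))"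
    by (rule measurable_compose[OF measurable_vimage_algebra1 measurable_component_singleton])
      (auto simp: space_PiM PiE_def extensional_def)
  then show "eps t \<in> borel_measurable (vimage_algebra (space M) (\<lambda>\<omega>. \<lambda>j\<in>{t}. eps j \<omega>) (Pi\<^sub>M {t} (\<lambda>_. borel)))"
    by simp
qed simp

lemma nn_integral_past_eps:
  assumes "R \<in> past t \<rightarrow>\<^sub>M N" and "g \<in> borel_measurable (N \<Otimes>\<^sub>M borel)"
  shows "(\<integral>\<^sup>+ \<omega>. g (R \<omega>, eps t \<omega>) \<partial>M) = (\<integral>\<^sup>+ \<omega>. \<integral>\<^sup>+ u. g (R \<omega>, u) \<partial>\<mu> \<partial>M)"
  using nn_integral_indep_pair[OF indep_past_eps[OF assms(1)] assms(2)] by (simp add: eps_ident[of t])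

text \<open>With the past frozen only \<open>eps t\<close> is random, the weight is a constant
  factor, and \<open>contr\<close> applies for fixed arguments.\<close>

lemma contraction_step:
  assumes U: "U \<in> borel_measurable (past t)" and V: "V \<in> borel_measurable (past t)"
    and wt: "wt \<in> borel_measurable (past t)"
  shows "(\<integral>\<^sup>+ \<omega>. wt \<omega> * dp (F (U \<omega>) (Z (t - 1) \<omega>) (eps t \<omega>)) (F (V \<omega>) (Z (t - 1) \<omega>) (eps t \<omega>)) \<partial>M)
    \<le> (\<integral>\<^sup>+ \<omega>. wt \<omega> * (ennreal (\<kappa> (Z (t - 1) \<omega>) powr p) * dp (U \<omega>) (V \<omega>)) \<partial>M)"
proof -
  let ?R = "\<lambda>\<omega>. (wt \<omega>, U \<omega>, V \<omega>, Z (t - 1) \<omega>)"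
  define g where "g = (\<lambda>r. fst (fst r) * dp (F (fst (snd (fst r))) (snd (snd (snd (fst r)))) (snd r))
    (F (fst (snd (snd (fst r)))) (snd (snd (snd (fst r)))) (snd r)) :: ennreal)"
  have R: "?R \<in> past t \<rightarrow>\<^sub>M borel \<Otimes>\<^sub>M borel \<Otimes>\<^sub>M borel \<Otimes>\<^sub>M borel"
    using U V wt by simp
  have g: "g \<in> borel_measurable ((borel \<Otimes>\<^sub>M borel \<Otimes>\<^sub>M borel \<Otimes>\<^sub>M borel) \<Otimes>\<^sub>M borel)"
    unfolding g_def by measurable
  have "(\<integral>\<^sup>+ \<omega>. wt \<omega> * dp (F (U \<omega>) (Z (t - 1) \<omega>) (eps t \<omega>)) (F (V \<omega>) (Z (t - 1) \<omega>) (eps t \<omega>)) \<partial>M) =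
      (\<integral>\<^sup>+ \<omega>. \<integral>\<^sup>+ u. g (?R \<omega>, u) \<partial>\<mu> \<partial>M)"
    using nn_integral_past_eps[OF R g] by (simp add: g_def)
  also have "\<dots> \<le> (\<integral>\<^sup>+ \<omega>. wt \<omega> * (ennreal (\<kappa> (Z (t - 1) \<omega>) powr p) * dp (U \<omega>) (V \<omega>)) \<partial>M)"
  proof (rule nn_integral_mono)
    fix \<omega>
    have "(\<integral>\<^sup>+ u. g (?R \<omega>, u) \<partial>\<mu>) = wt \<omega> * (\<integral>\<^sup>+ u. dp (F (U \<omega>) (Z (t - 1) \<omega>) u) (F (V \<omega>) (Z (t - 1) \<omega>) u) \<partial>\<mu>)"
      unfolding g_def by (simp add: nn_integral_cmult)
    also have "\<dots> \<le> wt \<omega> * ennreal (\<kappa> (Z (t - 1) \<omega>) powr p * dist (U \<omega>) (V \<omega>) powr p)"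
      by (intro mult_left_mono contr) simp
    finally show "(\<integral>\<^sup>+ u. g (?R \<omega>, u) \<partial>\<mu>) \<le> wt \<omega> * (ennreal (\<kappa> (Z (t - 1) \<omega>) powr p) * dp (U \<omega>) (V \<omega>))"
      by (simp add: ennreal_mult)
  qed
  finally show ?thesis .
qed

section \<open>Contraction factors and contraction of the iterates\<close>

definition kp :: "int \<Rightarrow> nat \<Rightarrow> 'a \<Rightarrow> real" where
  "kp t n \<omega> = (\<Prod>i<n. \<kappa> (Z (t - 1 - int i) \<omega>)) powr p"

lemma kp_0 [simp]: "kp t 0 \<omega> = 1"
  by (simp add: kp_def)

lemma kp_nonneg [simp]: "0 \<le> kp t n \<omega>"
  by (simp add: kp_def)

lemma kp_Suc: "kp t (Suc n) \<omega> = kp t n \<omega> * \<kappa> (Z (t - 1 - int n) \<omega>) powr p"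
  by (simp add: kp_def powr_mult prod_nonneg less_imp_le \<kappa>_pos)

text \<open>Splitting off the latest factor matches the recursion of \<open>iterF\<close>;
  \<open>kp_Suc\<close> splits off the earliest instead, to be merged with the factor inside
  \<open>B\<close>.\<close>

lemma kp_Suc_shift: "kp t (Suc n) \<omega> = \<kappa> (Z (t - 1) \<omega>) powr p * kp (t - 1) n \<omega>"
proof -
  have "(\<Prod>i<Suc n. \<kappa> (Z (t - 1 - int i) \<omega>)) = \<kappa> (Z (t - 1) \<omega>) * (\<Prod>i<n. \<kappa> (Z (t - 1 - 1 - int i) \<omega>))"
    by (subst prod.lessThan_Suc_shift) (simp add: algebra_simps)
  then show ?thesis
    unfolding kp_def by (simp add: powr_mult prod_nonneg less_imp_le \<kappa>_pos)
qed

lemma kp_meas [measurable]: "kp t n \<in> borel_measurable \<Z>" "kp t n \<in> borel_measurable M"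
  unfolding kp_def by measurable

text \<open>The start may be random: \<open>past (t - int n + 1)\<close> knows the noise up to time
  \<open>t - n\<close>, and the \<open>n\<close> maps use exactly the later noise up to
  \<open>t\<close>. This admits iterates started at a solution \<open>Y (t - int n)\<close>.\<close>

lemma iterF_past:
  assumes "U \<in> borel_measurable (past (t - int n + 1))"
  shows "(\<lambda>\<omega>. f t n (U \<omega>) \<omega>) \<in> borel_measurable (past (t + 1))"
  using assms
proof (induction n arbitrary: t)
  case (Suc n)
  have [measurable]: "(\<lambda>\<omega>. f (t - 1) n (U \<omega>) \<omega>) \<in> borel_measurable (past (t + 1))"
    using Suc.IH[of "t - 1"] Suc.prems by (intro measurable_past_mono[of t "t + 1"]) (simp_all add: algebra_simps)
  have [measurable]: "eps t \<in> borel_measurable (past (t + 1))" by (rule eps_past) simp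
  show ?case by simp
qed simp

lemma iterF_meas [measurable]: "f t n x \<in> borel_measurable M"
  using measurable_past_M[OF iterF_past[of "\<lambda>_. x" t n]] by simp

text \<open>
  Conditional inequalities given \<open>Z\<close> are stated through arbitrary \<open>\<Z>\<close>-measurable weights, which
  lets the factor \<open>\<kappa>\<close> of each step be absorbed into the weight of the induction hypothesis.
\<close>
lemma iterF_contraction:
  assumes "U \<in> borel_measurable (past (t - int n + 1))" and "V \<in> borel_measurable (past (t - int n + 1))"
    and "wt \<in> borel_measurable \<Z>"
  shows "(\<integral>\<^sup>+ \<omega>. wt \<omega> * dp (f t n (U \<omega>) \<omega>) (f t n (V \<omega>) \<omega>) \<partial>M)
    \<le> (\<integral>\<^sup>+ \<omega>. wt \<omega> * (ennreal (kp t n \<omega>) * dp (U \<omega>) (V \<omega>)) \<partial>M)"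
  using assms
proof (induction n arbitrary: t wt)
  case (Suc n)
  have UV: "U \<in> borel_measurable (past (t - 1 - int n + 1))" "V \<in> borel_measurable (past (t - 1 - int n + 1))"
    using Suc.prems by (simp_all add: algebra_simps)
  have "(\<integral>\<^sup>+ \<omega>. wt \<omega> * dp (f t (Suc n) (U \<omega>) \<omega>) (f t (Suc n) (V \<omega>) \<omega>) \<partial>M) \<le>
      (\<integral>\<^sup>+ \<omega>. wt \<omega> * (ennreal (\<kappa> (Z (t - 1) \<omega>) powr p) * dp (f (t - 1) n (U \<omega>) \<omega>) (f (t - 1) n (V \<omega>) \<omega>)) \<partial>M)"
    using iterF_past[OF UV(1)] iterF_past[OF UV(2)] measurable_Z_past[OF Suc.prems(3)]
    by (simp only: iterF.simps) (rule contraction_step; simp)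
  also have "\<dots> = (\<integral>\<^sup>+ \<omega>. (wt \<omega> * ennreal (\<kappa> (Z (t - 1) \<omega>) powr p)) * dp (f (t - 1) n (U \<omega>) \<omega>) (f (t - 1) n (V \<omega>) \<omega>) \<partial>M)"
    by (simp add: mult.assoc)
  also have "\<dots> \<le> (\<integral>\<^sup>+ \<omega>. (wt \<omega> * ennreal (\<kappa> (Z (t - 1) \<omega>) powr p)) * (ennreal (kp (t - 1) n \<omega>) * dp (U \<omega>) (V \<omega>)) \<partial>M)"
  proof (rule Suc.IH[OF UV])
    note [measurable] = Suc.prems(3)
    show "(\<lambda>\<omega>. wt \<omega> * ennreal (\<kappa> (Z (t - 1) \<omega>) powr p)) \<in> borel_measurable \<Z>" by measurable
  qed
  also have "\<dots> = (\<integral>\<^sup>+ \<omega>. wt \<omega> * (ennreal (kp t (Suc n) \<omega>) * dp (U \<omega>) (V \<omega>)) \<partial>M)"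
    by (simp add: kp_Suc_shift ennreal_mult mult.assoc)
  finally show ?case .
qed simp

section \<open>Displacement in one step and increments of the backward iterates\<close>

definition c :: "'z \<Rightarrow> real" where
  "c z = enn2real (\<integral>\<^sup>+ u. dp (F x0 z u) x0 \<partial>\<mu>)"

text \<open>The three terms come from the detour from \<open>F x z u\<close> over
  \<open>F x0 z u\<close> and \<open>x0\<close> to \<open>x\<close>: contraction, moment at
  \<open>x0\<close>, distance of the starting points. The factor in front is the price of
  \<open>powr_add3_le\<close>.\<close>

definition B :: "'e \<Rightarrow> 'z \<Rightarrow> real" where
  "B x z = 3 powr p * (\<kappa> z powr p * dist x x0 powr p + c z + dist x x0 powr p)"

lemma prob_space_\<mu>: "prob_space \<mu>"
  by (rule prob_space_distr) simp

lemma c_meas [measurable]: "c \<in> borel_measurable borel"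
proof -
  interpret \<mu>: prob_space \<mu> by (rule prob_space_\<mu>)
  show ?thesis unfolding c_def by measurable
qed

lemma c_nonneg: "0 \<le> c z"
  by (simp add: c_def)

lemma B_nonneg: "0 \<le> B x z"
  by (simp add: B_def c_nonneg)

lemma B_meas [measurable]: "B x \<in> borel_measurable borel"
  unfolding B_def by measurable

lemma one_step_moment: "(\<integral>\<^sup>+ u. dp (F x z u) x \<partial>\<mu>) \<le> ennreal (B x z)"
proof -
  interpret \<mu>: prob_space \<mu> by (rule prob_space_\<mu>)
  have "(\<integral>\<^sup>+ u. dp (F x z u) x \<partial>\<mu>) \<le>
      (\<integral>\<^sup>+ u. ennreal (3 powr p) * (dp (F x z u) (F x0 z u) + dp (F x0 z u) x0 + dp x x0) \<partial>\<mu>)"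
  proof (rule nn_integral_mono)
    fix u
    have "dist (F x z u) x \<le> dist (F x z u) (F x0 z u) + dist (F x0 z u) x0 + dist x x0"
      by metric
    then have "dist (F x z u) x powr p \<le> (dist (F x z u) (F x0 z u) + dist (F x0 z u) x0 + dist x x0) powr p"
      using p_pos by (intro powr_mono2) auto
    also have "\<dots> \<le> 3 powr p * (dist (F x z u) (F x0 z u) powr p + dist (F x0 z u) x0 powr p + dist x x0 powr p)"
      using p_pos by (intro powr_add3_le) auto
    finally have "dp (F x z u) x \<le> ennreal (3 powr p * (dist (F x z u) (F x0 z u) powr p + dist (F x0 z u) x0 powr p + dist x x0 powr p))"
      by (rule ennreal_leI)
    then show "dp (F x z u) x \<le> ennreal (3 powr p) * (dp (F x z u) (F x0 z u) + dp (F x0 z u) x0 + dp x x0)"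
      by (simp add: ennreal_mult)
  qed
  also have "\<dots> = ennreal (3 powr p) * ((\<integral>\<^sup>+ u. dp (F x z u) (F x0 z u) \<partial>\<mu>) + (\<integral>\<^sup>+ u. dp (F x0 z u) x0 \<partial>\<mu>) + dp x x0)"
    using \<mu>.emeasure_space_1 by (simp add: nn_integral_cmult nn_integral_add)
  also have "(\<integral>\<^sup>+ u. dp (F x0 z u) x0 \<partial>\<mu>) = ennreal (c z)"
    using moment[of z] by (simp add: c_def)
  also have "ennreal (3 powr p) * ((\<integral>\<^sup>+ u. dp (F x z u) (F x0 z u) \<partial>\<mu>) + ennreal (c z) + dp x x0) \<le>
     ennreal (3 powr p) * (ennreal (\<kappa> z powr p * dist x x0 powr p) + ennreal (c z) + dp x x0)"
    by (intro mult_left_mono add_mono contr) auto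
  also have "\<dots> = ennreal (B x z)"
    by (simp add: B_def ennreal_mult c_nonneg)
  finally show ?thesis .
qed

text \<open>By \<open>iterF_Suc_inner\<close> both iterates are the same \<open>k\<close>-fold map,
  started one step away from \<open>x\<close> and at \<open>x\<close>. Contraction reduces the
  increment to that single displacement, whose noise is then integrated out.\<close>

lemma increment_bound:
  assumes wt: "wt \<in> borel_measurable \<Z>"
  shows "(\<integral>\<^sup>+ \<omega>. wt \<omega> * dp (f t (Suc k) x \<omega>) (f t k x \<omega>) \<partial>M)
    \<le> (\<integral>\<^sup>+ \<omega>. wt \<omega> * ennreal (kp t k \<omega> * B x (Z (t - 1 - int k) \<omega>)) \<partial>M)"
proof -
  let ?U = "\<lambda>\<omega>. F x (Z (t - 1 - int k) \<omega>) (eps (t - int k) \<omega>)"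
  have [measurable]: "eps (t - int k) \<in> borel_measurable (past (t - int k + 1))" by (rule eps_past) simp
  have "(\<integral>\<^sup>+ \<omega>. wt \<omega> * dp (f t (Suc k) x \<omega>) (f t k x \<omega>) \<partial>M) =
      (\<integral>\<^sup>+ \<omega>. wt \<omega> * dp (f t k (?U \<omega>) \<omega>) (f t k x \<omega>) \<partial>M)"
    unfolding iterF_Suc_inner ..
  also have "\<dots> \<le> (\<integral>\<^sup>+ \<omega>. wt \<omega> * (ennreal (kp t k \<omega>) * dp (?U \<omega>) x) \<partial>M)"
    by (rule iterF_contraction[of ?U t k "\<lambda>_. x", OF _ _ wt]) measurable
  also have "\<dots> = (\<integral>\<^sup>+ \<omega>. (wt \<omega> * ennreal (kp t k \<omega>)) * dp (?U \<omega>) x \<partial>M)"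
    by (simp add: mult.assoc)
  also have "\<dots> = (\<integral>\<^sup>+ \<omega>. \<integral>\<^sup>+ u. (wt \<omega> * ennreal (kp t k \<omega>)) * dp (F x (Z (t - 1 - int k) \<omega>) u) x \<partial>\<mu> \<partial>M)"
  proof -
    let ?R = "\<lambda>\<omega>. (wt \<omega> * ennreal (kp t k \<omega>), Z (t - 1 - int k) \<omega>)"
    define g where "g = (\<lambda>r. fst (fst r) * dp (F x (snd (fst r)) (snd r)) x :: ennreal)"
    \<comment> \<open>The displacement uses \<open>eps (t - int k)\<close>, so the weight has to be
      known strictly before that time; it is, being a function of \<open>Z\<close> alone.\<close>
    have R: "?R \<in> past (t - int k) \<rightarrow>\<^sub>M borel \<Otimes>\<^sub>M borel"
    proof (rule measurable_Z_past)
      note [measurable] = wt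
      show "?R \<in> \<Z> \<rightarrow>\<^sub>M borel \<Otimes>\<^sub>M borel" by measurable
    qed
    have g: "g \<in> borel_measurable ((borel \<Otimes>\<^sub>M borel) \<Otimes>\<^sub>M borel)"
      unfolding g_def by measurable
    show ?thesis using nn_integral_past_eps[OF R g] by (simp add: g_def)
  qed
  also have "\<dots> = (\<integral>\<^sup>+ \<omega>. wt \<omega> * ennreal (kp t k \<omega>) * (\<integral>\<^sup>+ u. dp (F x (Z (t - 1 - int k) \<omega>) u) x \<partial>\<mu>) \<partial>M)"
    by (simp add: nn_integral_cmult)
  also have "\<dots> \<le> (\<integral>\<^sup>+ \<omega>. wt \<omega> * ennreal (kp t k \<omega>) * ennreal (B x (Z (t - 1 - int k) \<omega>)) \<partial>M)"
    by (intro nn_integral_mono mult_left_mono one_step_moment) simp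
  finally show ?thesis by (simp add: ennreal_mult B_nonneg mult.assoc)
qed

end

section \<open>Convergence of the backward iterates\<close>

lemma geometric_dist_bound:
  fixes s :: "nat \<Rightarrow> 'e::metric_space"
  assumes step: "\<And>k. dist (s (Suc k)) (s k) \<le> K * q ^ k" and q: "0 < q" "q < 1"
  shows "dist (s m) (s (m + j)) \<le> K * q ^ m / (1 - q)"
proof -
  have K: "0 \<le> K" using order_trans[OF zero_le_dist step[of 0]] by simp
  \<comment> \<open>The factor \<open>1 - q ^ j\<close> keeps the partial geometric sum exact, so
    that the induction closes.\<close>
  have "dist (s m) (s (m + j)) \<le> K * q ^ m * (1 - q ^ j) / (1 - q)"
  proof (induction j)
    case (Suc j)
    have "dist (s m) (s (m + Suc j)) \<le> dist (s m) (s (m + j)) + dist (s (Suc (m + j))) (s (m + j))"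
      using dist_triangle[of "s m" "s (m + Suc j)" "s (m + j)"] by (simp add: dist_commute)
    also have "\<dots> \<le> K * q ^ m * (1 - q ^ j) / (1 - q) + K * q ^ (m + j)"
      using Suc step[of "m + j"] by simp
    also have "\<dots> = K * q ^ m * (1 - q ^ Suc j) / (1 - q)"
      using q by (simp add: field_simps power_add)
    finally show ?case .
  qed simp
  also have "\<dots> \<le> K * q ^ m * 1 / (1 - q)"
    using q K by (intro divide_right_mono mult_left_mono) auto
  finally show ?thesis by simp
qed

lemma geometric_Cauchy:
  fixes s :: "nat \<Rightarrow> 'e::metric_space"
  assumes step: "\<And>k. dist (s (Suc k)) (s k) \<le> K * q ^ k" and q: "0 < q" "q < 1"
  shows "Cauchy s"
proof (rule CauchyI')
  fix e :: real assume "0 < e"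
  have "(\<lambda>m. K * q ^ m / (1 - q)) \<longlonglongrightarrow> K * 0 / (1 - q)"
    using q by (intro tendsto_intros LIMSEQ_power_zero) auto
  then have "eventually (\<lambda>m. K * q ^ m / (1 - q) < e) sequentially"
    using \<open>0 < e\<close> by (intro order_tendstoD(2)) auto
  then obtain N where N: "\<And>m. m \<ge> N \<Longrightarrow> K * q ^ m / (1 - q) < e" by (auto simp: eventually_sequentially)
  have "dist (s m) (s n) < e" if "N \<le> m" "m < n" for m n
    using geometric_dist_bound[OF step q, of m "n - m"] N[of m] that by simp
  then show "\<exists>M. \<forall>m\<ge>M. \<forall>n>m. dist (s m) (s n) < e" by blast
qed

lemma geometric_limit_bound:
  fixes s :: "nat \<Rightarrow> 'e::metric_space"
  assumes step: "\<And>k. dist (s (Suc k)) (s k) \<le> K * q ^ k" and q: "0 < q" "q < 1" and l: "s \<longlonglongrightarrow> l"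
  shows "dist (s m) l \<le> K * q ^ m / (1 - q)"
proof (rule LIMSEQ_le_const2)
  show "(\<lambda>j. dist (s m) (s (m + j))) \<longlonglongrightarrow> dist (s m) l"
    using LIMSEQ_ignore_initial_segment[OF l, of m] by (intro tendsto_intros) (simp add: add.commute)
  show "\<exists>N. \<forall>n\<ge>N. dist (s m) (s (m + n)) \<le> K * q ^ m / (1 - q)"
    using geometric_dist_bound[OF step q] by blast
qed

text \<open>The time \<open>s\<close> is free because the recursion lowers \<open>t\<close> and
  \<open>s\<close> together. With \<open>s = 0\<close> every iterate becomes one fixed function of
  the path shifted by \<open>t\<close>.\<close>

lemma iterF_path:
  "iterF F Z eps t n x \<omega> =
     iterF F (\<lambda>j w. fst (w j)) (\<lambda>j w. snd (w j)) s n x (\<lambda>j. (Z (t - s + j) \<omega>, eps (t - s + j) \<omega>))"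
proof (induction n arbitrary: t s)
  case (Suc n)
  show ?case using Suc[of "t - 1" "s - 1"] by simp
qed simp

context random_maps
begin

text \<open>All rates are measured in powers of one \<rho>. Of the four powers gained from
  \<open>kp\<close>, two are spent on the weight in \<open>Q\<close> and one on the growth of
  \<open>c\<close>, which leaves \<open>\<rho> ^ k\<close> to be summed.\<close>

lemma decay:
  "\<exists>\<rho>>0. \<rho> < 1 \<and> (\<forall>t. AE \<omega> in M. \<exists>C. \<forall>n. kp t n \<omega> \<le> C * \<rho> ^ (4 * n)) \<and>
    (\<forall>t. AE \<omega> in M. \<exists>C. \<forall>n. c (Z (t - 1 - int n) \<omega>) \<le> C * (1 / \<rho>) ^ n)"
proof -
  obtain \<delta> where \<delta>: "0 < \<delta>"
    "\<And>t. AE \<omega> in M. \<exists>C. \<forall>n. (\<Prod>i<n. \<kappa> (Z (t - 1 - int i) \<omega>)) \<le> C * exp (- \<delta> * real n)"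
    using product_exponential_decay[OF \<kappa>_meas \<kappa>_pos \<kappa>_logneg] by blast
  define \<rho> where "\<rho> = exp (- (\<delta> * p / 4))"
  have \<rho>: "0 < \<rho>" "\<rho> < 1" using \<delta> p_pos by (auto simp: \<rho>_def)
  have "AE \<omega> in M. \<exists>C. \<forall>n. kp t n \<omega> \<le> C * \<rho> ^ (4 * n)" for t
    using \<delta>(2)[of t]
  proof eventually_elim
    case (elim \<omega>)
    then obtain C where C: "\<And>n. (\<Prod>i<n. \<kappa> (Z (t - 1 - int i) \<omega>)) \<le> C * exp (- \<delta> * real n)" by blast
    have "kp t n \<omega> \<le> C powr p * \<rho> ^ (4 * n)" for n
    proof -
      have "kp t n \<omega> \<le> (C * exp (- \<delta> * real n)) powr p"
        unfolding kp_def using C[of n] p_pos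
        by (intro powr_mono2) (auto intro: prod_nonneg less_imp_le[OF \<kappa>_pos])
      also have "\<dots> = C powr p * exp (- \<delta> * real n) powr p" by (rule powr_mult)
      also have "exp (- \<delta> * real n) powr p = \<rho> ^ (4 * n)"
        by (simp add: \<rho>_def powr_def exp_of_nat_mult[symmetric] algebra_simps)
      finally show ?thesis .
    qed
    then show ?case by blast
  qed
  moreover have "AE \<omega> in M. \<exists>C. \<forall>n. c (Z (t - 1 - int n) \<omega>) \<le> C * (1 / \<rho>) ^ n" for t
  proof -
    have "exp (\<delta> * p / 4 * real n) = (1 / \<rho>) ^ n" for n
      by (simp add: \<rho>_def exp_minus power_inverse exp_of_nat_mult[symmetric] field_simps)
    moreover have "AE \<omega> in M. \<exists>C. \<forall>n. c (Z (t - 1 - int n) \<omega>) \<le> C * exp (\<delta> * p / 4 * real n)"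
      using \<delta> p_pos log_moment by (intro subexponential_growth c_meas c_nonneg) (auto simp: c_def)
    ultimately show ?thesis by simp
  qed
  ultimately show ?thesis using \<rho> by blast
qed

lemma kp_summable:
  assumes \<rho>: "0 < \<rho>" "\<rho> < 1" and C: "\<And>n. kp t n \<omega> \<le> C * \<rho> ^ (4 * n)"
  shows "summable (\<lambda>n. kp t n \<omega>)"
proof (rule summable_comparison_test')
  have "\<rho> ^ 4 < 1" using \<rho> by (simp add: power_less_one_iff)
  then show "summable (\<lambda>n. C * (\<rho> ^ 4) ^ n)" using \<rho> by (intro summable_mult summable_geometric) auto
  show "norm (kp t n \<omega>) \<le> C * (\<rho> ^ 4) ^ n" for n using C[of n] by (simp add: power_mult)
qed

lemma weighted_summable:
  assumes \<rho>: "0 < \<rho>" "\<rho> < 1" and C: "\<And>n. kp t n \<omega> \<le> C * \<rho> ^ (4 * n)"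
    and C': "\<And>n. c (Z (t - 1 - int n) \<omega>) \<le> C' * (1 / \<rho>) ^ n"
  shows "summable (\<lambda>k. (1 / \<rho>) ^ (2 * k) * (kp t k \<omega> * B x (Z (t - 1 - int k) \<omega>)))"
proof (rule summable_comparison_test')
  let ?D = "dist x x0 powr p"
  let ?K = "3 powr p * (C * ?D + C * C' + C * ?D)"
  have C0: "0 \<le> C" using C[of 0] by simp
  have C'0: "0 \<le> C'" using C'[of 0] c_nonneg[of "Z (t - 1) \<omega>"] by simp
  show "summable (\<lambda>k. ?K * \<rho> ^ k)" using \<rho> by (intro summable_mult summable_geometric) auto
  fix k
  let ?r = "(1 / \<rho>) ^ (2 * k)"
  have r0: "0 \<le> ?r" using \<rho> by simp
  have r4: "?r * \<rho> ^ (4 * k) = \<rho> ^ (2 * k)" using \<rho> by (simp add: power_divide field_simps flip: power_add)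
  have two: "\<rho> ^ (2 * k) \<le> \<rho> ^ k" using \<rho> by (intro power_decreasing) auto
  have a: "?r * kp t k \<omega> \<le> C * \<rho> ^ k"
  proof -
    have "?r * kp t k \<omega> \<le> ?r * (C * \<rho> ^ (4 * k))" using C[of k] r0 by (intro mult_left_mono)
    also have "\<dots> = C * \<rho> ^ (2 * k)" using r4 by (simp add: mult_ac)
    also have "\<dots> \<le> C * \<rho> ^ k" using two C0 by (intro mult_left_mono)
    finally show ?thesis .
  qed
  \<comment> \<open>The \<kappa> in the first term of \<open>B\<close> turns \<open>kp t k\<close>
    into \<open>kp t (Suc k)\<close>, which obeys the same decay.\<close>
  have b: "?r * kp t (Suc k) \<omega> \<le> C * \<rho> ^ k"
  proof -
    have "\<rho> ^ (4 * Suc k) \<le> \<rho> ^ (4 * k)" using \<rho> by (intro power_decreasing) auto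
    then have "kp t (Suc k) \<omega> \<le> C * \<rho> ^ (4 * k)"
      using C[of "Suc k"] mult_left_mono[OF _ C0] by (blast intro: order_trans)
    then have "?r * kp t (Suc k) \<omega> \<le> ?r * (C * \<rho> ^ (4 * k))" using r0 by (intro mult_left_mono)
    also have "\<dots> = C * \<rho> ^ (2 * k)" using r4 by (simp add: mult_ac)
    also have "\<dots> \<le> C * \<rho> ^ k" using two C0 by (intro mult_left_mono)
    finally show ?thesis .
  qed
  have d: "?r * kp t k \<omega> * c (Z (t - 1 - int k) \<omega>) \<le> C * C' * \<rho> ^ k"
  proof -
    have "?r * kp t k \<omega> \<le> C * \<rho> ^ (2 * k)"
      using mult_left_mono[OF C[of k] r0] r4 by (simp add: mult_ac)
    then have "?r * kp t k \<omega> * c (Z (t - 1 - int k) \<omega>) \<le> (C * \<rho> ^ (2 * k)) * (C' * (1 / \<rho>) ^ k)"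
      using C0 \<rho> C'[of k] c_nonneg by (intro mult_mono[of "?r * kp t k \<omega>"]) auto
    also have "\<dots> = C * C' * \<rho> ^ k"
      using \<rho> by (simp add: power_divide field_simps flip: power_add mult_2)
    finally show ?thesis .
  qed
  have "?r * (kp t k \<omega> * B x (Z (t - 1 - int k) \<omega>)) =
      3 powr p * (?r * kp t (Suc k) \<omega> * ?D + ?r * kp t k \<omega> * c (Z (t - 1 - int k) \<omega>) + ?r * kp t k \<omega> * ?D)"
    by (simp add: B_def kp_Suc algebra_simps)
  also have "\<dots> \<le> 3 powr p * (C * \<rho> ^ k * ?D + C * C' * \<rho> ^ k + C * \<rho> ^ k * ?D)"
    using a b d by (intro mult_left_mono add_mono mult_right_mono) auto
  also have "\<dots> = ?K * \<rho> ^ k" by (simp add: algebra_simps)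
  finally show "norm (?r * (kp t k \<omega> * B x (Z (t - 1 - int k) \<omega>))) \<le> ?K * \<rho> ^ k"
    using r0 B_nonneg by simp
qed

text \<open>\<open>R\<close> is the weighted series with each increment replaced by its bound from
  \<open>increment_bound\<close>. It is finite by \<open>weighted_summable\<close>, which in turn
  makes \<open>Q\<close> finite almost surely.\<close>

lemma geometric_control:
  obtains q Q R where "0 < q" "q < 1" "Q \<in> borel_measurable M" "R \<in> borel_measurable \<Z>"
    "AE \<omega> in M. R \<omega> < (\<infinity>::ennreal)" "AE \<omega> in M. Q \<omega> < (\<infinity>::ennreal)"
    "\<And>A. A \<in> sets \<Z> \<Longrightarrow> (\<integral>\<^sup>+ \<omega>. indicator A \<omega> * Q \<omega> \<partial>M) \<le> (\<integral>\<^sup>+ \<omega>. indicator A \<omega> * R \<omega> \<partial>M)"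
    "\<And>\<omega> k. Q \<omega> < \<infinity> \<Longrightarrow> dist (f t (Suc k) x \<omega>) (f t k x \<omega>) \<le> enn2real (Q \<omega>) powr (1 / p) * q ^ k"
proof -
  obtain \<rho> where \<rho>: "0 < \<rho>" "\<rho> < 1"
    "\<And>t. AE \<omega> in M. \<exists>C. \<forall>n. kp t n \<omega> \<le> C * \<rho> ^ (4 * n)"
    "\<And>t. AE \<omega> in M. \<exists>C. \<forall>n. c (Z (t - 1 - int n) \<omega>) \<le> C * (1 / \<rho>) ^ n"
    using decay by blast
  define Q where "Q \<omega> = (\<Sum>k. ennreal ((1 / \<rho>) ^ (2 * k)) * dp (f t (Suc k) x \<omega>) (f t k x \<omega>))" for \<omega>
  define R where "R \<omega> = (\<Sum>k. ennreal ((1 / \<rho>) ^ (2 * k) * (kp t k \<omega> * B x (Z (t - 1 - int k) \<omega>))))" for \<omega>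
  have Q[measurable]: "Q \<in> borel_measurable M" unfolding Q_def by measurable
  have R[measurable]: "R \<in> borel_measurable \<Z>" unfolding R_def by measurable
  have R_fin: "AE \<omega> in M. R \<omega> < \<infinity>"
    using \<rho>(3)[of t] \<rho>(4)[of t]
  proof eventually_elim
    case (elim \<omega>)
    then obtain C C' where "\<And>n. kp t n \<omega> \<le> C * \<rho> ^ (4 * n)"
      "\<And>n. c (Z (t - 1 - int n) \<omega>) \<le> C' * (1 / \<rho>) ^ n" by blast
    from weighted_summable[OF \<rho>(1,2) this] have "R \<omega> \<noteq> \<top>"
      unfolding R_def using \<rho> B_nonneg by (intro ennreal_suminf_neq_top) auto
    then show ?case by (simp add: less_top)
  qed
  have le: "(\<integral>\<^sup>+ \<omega>. indicator A \<omega> * Q \<omega> \<partial>M) \<le> (\<integral>\<^sup>+ \<omega>. indicator A \<omega> * R \<omega> \<partial>M)" if A: "A \<in> sets \<Z>" for A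
  proof -
    note [measurable] = A
    have [measurable]: "A \<in> sets M" using A subalgebra_Z by (auto simp: subalgebra_def)
    have "(\<integral>\<^sup>+ \<omega>. indicator A \<omega> * Q \<omega> \<partial>M) =
        (\<integral>\<^sup>+ \<omega>. (\<Sum>k. (indicator A \<omega> * ennreal ((1 / \<rho>) ^ (2 * k))) * dp (f t (Suc k) x \<omega>) (f t k x \<omega>)) \<partial>M)"
      unfolding Q_def by (intro nn_integral_cong) (simp only: ennreal_suminf_cmult[symmetric] mult.assoc)
    also have "\<dots> = (\<Sum>k. \<integral>\<^sup>+ \<omega>. (indicator A \<omega> * ennreal ((1 / \<rho>) ^ (2 * k))) * dp (f t (Suc k) x \<omega>) (f t k x \<omega>) \<partial>M)"
      by (rule nn_integral_suminf) measurable
    also have "\<dots> \<le> (\<Sum>k. \<integral>\<^sup>+ \<omega>. (indicator A \<omega> * ennreal ((1 / \<rho>) ^ (2 * k))) * ennreal (kp t k \<omega> * B x (Z (t - 1 - int k) \<omega>)) \<partial>M)"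
      by (intro suminf_le increment_bound) auto
    also have "\<dots> = (\<integral>\<^sup>+ \<omega>. (\<Sum>k. (indicator A \<omega> * ennreal ((1 / \<rho>) ^ (2 * k))) * ennreal (kp t k \<omega> * B x (Z (t - 1 - int k) \<omega>))) \<partial>M)"
      by (rule nn_integral_suminf[symmetric]) measurable
    also have "\<dots> = (\<integral>\<^sup>+ \<omega>. indicator A \<omega> * R \<omega> \<partial>M)"
    proof (rule nn_integral_cong)
      fix \<omega>
      have "(indicator A \<omega> * ennreal ((1 / \<rho>) ^ (2 * k))) * ennreal (kp t k \<omega> * B x (Z (t - 1 - int k) \<omega>)) =
          indicator A \<omega> * ennreal ((1 / \<rho>) ^ (2 * k) * (kp t k \<omega> * B x (Z (t - 1 - int k) \<omega>)))" for k
        using \<rho> B_nonneg[of x] by (subst ennreal_mult) (auto simp: mult.assoc)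
      then show "(\<Sum>k. (indicator A \<omega> * ennreal ((1 / \<rho>) ^ (2 * k))) * ennreal (kp t k \<omega> * B x (Z (t - 1 - int k) \<omega>))) =
          indicator A \<omega> * R \<omega>"
        unfolding R_def by (simp only: ennreal_suminf_cmult)
    qed
    finally show ?thesis .
  qed
  have Q_fin: "AE \<omega> in M. Q \<omega> < \<infinity>"
    by (rule Z.AE_finite_if_conditionally_dominated[OF Q R R_fin le])
  \<comment> \<open>A single term of \<open>Q\<close> bounds the \<open>p\<close>-th power of the
    increment by \<open>Q \<omega> * \<rho> ^ (2 * k)\<close>; the \<open>p\<close>-th root turns
    the weight into this ratio.\<close>
  define q where "q = \<rho> powr (2 / p)"
  have q: "0 < q" "q < 1" using \<rho> p_pos powr_less_mono2[of "2 / p" \<rho> 1] by (auto simp: q_def)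
  have "dist (f t (Suc k) x \<omega>) (f t k x \<omega>) \<le> enn2real (Q \<omega>) powr (1 / p) * q ^ k" if fin: "Q \<omega> < \<infinity>" for \<omega> k
  proof -
    let ?d = "dist (f t (Suc k) x \<omega>) (f t k x \<omega>)"
    have "ennreal ((1 / \<rho>) ^ (2 * k)) * ennreal (?d powr p) \<le> Q \<omega>"
      unfolding Q_def using sum_le_suminf[of "\<lambda>k. ennreal ((1 / \<rho>) ^ (2 * k)) * dp (f t (Suc k) x \<omega>) (f t k x \<omega>)" "{k}"] by simp
    then have "ennreal ((1 / \<rho>) ^ (2 * k) * ?d powr p) \<le> ennreal (enn2real (Q \<omega>))"
      using fin \<rho> by (simp add: ennreal_mult)
    then have "(1 / \<rho>) ^ (2 * k) * ?d powr p \<le> enn2real (Q \<omega>)" by (simp add: ennreal_le_iff)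
    then have "?d powr p \<le> enn2real (Q \<omega>) * \<rho> ^ (2 * k)"
      using \<rho> by (simp add: power_divide field_simps)
    then have "(?d powr p) powr (1 / p) \<le> (enn2real (Q \<omega>) * \<rho> ^ (2 * k)) powr (1 / p)"
      using p_pos by (intro powr_mono2) auto
    also have "\<dots> = enn2real (Q \<omega>) powr (1 / p) * (\<rho> ^ (2 * k)) powr (1 / p)" by (rule powr_mult)
    also have "(\<rho> ^ (2 * k)) powr (1 / p) = q ^ k"
      using \<rho> by (simp add: q_def powr_powr powr_realpow[symmetric] mult_ac)
    finally show ?thesis using p_pos by (simp add: powr_powr)
  qed
  from that[OF q Q R R_fin Q_fin le this] show ?thesis .
qed

end

lemma (in prob_space) prob_ge_tendsto_zero:
  fixes u :: "nat \<Rightarrow> 'a \<Rightarrow> real"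
  assumes [measurable]: "\<And>n. u n \<in> borel_measurable M"
    and lim: "AE \<omega> in M. (\<lambda>n. u n \<omega>) \<longlonglongrightarrow> 0" and \<eta>: "0 < \<eta>"
  shows "(\<lambda>n. prob {\<omega>\<in>space M. \<eta> \<le> u n \<omega>}) \<longlonglongrightarrow> 0"
proof -
  have "(\<lambda>n. \<integral>\<omega>. indicator {\<omega>\<in>space M. \<eta> \<le> u n \<omega>} \<omega> \<partial>M) \<longlonglongrightarrow> (\<integral>\<omega>. (0::real) \<partial>M)"
  proof (rule integral_dominated_convergence[where w = "\<lambda>_. 1"])
    show "AE \<omega> in M. (\<lambda>n. indicator {\<omega>\<in>space M. \<eta> \<le> u n \<omega>} \<omega>) \<longlonglongrightarrow> (0::real)"
      using lim
    proof eventually_elim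
      case (elim \<omega>)
      then have "eventually (\<lambda>n. u n \<omega> < \<eta>) sequentially" using \<eta> by (rule order_tendstoD)
      then have "eventually (\<lambda>n. 0 = (indicator {\<omega>\<in>space M. \<eta> \<le> u n \<omega>} \<omega> :: real)) sequentially"
        by eventually_elim (auto simp: indicator_def)
      then show ?case by (rule Lim_transform_eventually[OF tendsto_const])
    qed
  qed (auto simp: indicator_def)
  then show ?thesis by simp
qed

context random_maps
begin

section \<open>The limit as a function of the driving path\<close>

definition path_iter :: "'e \<Rightarrow> nat \<Rightarrow> (int \<Rightarrow> 'z \<times> 'w) \<Rightarrow> 'e" where
  "path_iter x n w = iterF F (\<lambda>j w. fst (w j)) (\<lambda>j w. snd (w j)) 0 n x w"

text \<open>Off the Cauchy paths the sequence is replaced by the constant \<open>x0\<close>, so a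
  limit exists for every path. This makes \<open>path_lim\<close> measurable and \<open>X\<close> an
  exact function of the shifted path, as \<open>ergodic_process_factor\<close> requires.\<close>

definition path_lim :: "'e \<Rightarrow> (int \<Rightarrow> 'z \<times> 'w) \<Rightarrow> 'e" where
  "path_lim x w = lim (\<lambda>n. if Cauchy (\<lambda>n. path_iter x n w) then path_iter x n w else x0)"

definition X :: "int \<Rightarrow> 'e \<Rightarrow> 'a \<Rightarrow> 'e" where
  "X t x \<omega> = path_lim x (\<lambda>s. W (t + s) \<omega>)"

lemma measurable_path_components [measurable]:
  "(\<lambda>w. fst (w j)) \<in> borel_measurable (path_space :: (int \<Rightarrow> 'z \<times> 'w) measure)"
  "(\<lambda>w. snd (w j)) \<in> borel_measurable (path_space :: (int \<Rightarrow> 'z \<times> 'w) measure)"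
proof -
  have "(fst :: 'z \<times> 'w \<Rightarrow> 'z) \<in> borel \<rightarrow>\<^sub>M borel" "(snd :: 'z \<times> 'w \<Rightarrow> 'w) \<in> borel \<rightarrow>\<^sub>M borel"
    by (auto simp flip: borel_prod)
  then show "(\<lambda>w. fst (w j)) \<in> borel_measurable (path_space :: (int \<Rightarrow> 'z \<times> 'w) measure)"
    "(\<lambda>w. snd (w j)) \<in> borel_measurable (path_space :: (int \<Rightarrow> 'z \<times> 'w) measure)"
    by (auto intro!: measurable_compose[OF measurable_component_singleton])
qed

lemma path_iter_meas [measurable]: "path_iter x n \<in> borel_measurable path_space"
proof -
  have "iterF F (\<lambda>j w. fst (w j)) (\<lambda>j w. snd (w j)) s n x \<in> borel_measurable path_space" for s
  proof (induction n arbitrary: s)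
    case (Suc n)
    note [measurable] = Suc
    show ?case by (simp add: fun_eq_iff cong: measurable_cong) measurable
  qed (simp cong: measurable_cong)
  then show ?thesis unfolding path_iter_def .
qed

lemma path_lim_meas [measurable]: "path_lim x \<in> borel_measurable path_space"
proof (rule borel_measurable_LIMSEQ_metric)
  let ?f = "\<lambda>n w. if Cauchy (\<lambda>n. path_iter x n w) then path_iter x n w else x0"
  show "?f n \<in> borel_measurable path_space" for n by measurable
  fix w
  have "convergent (\<lambda>n. ?f n w)"
    by (cases "Cauchy (\<lambda>n. path_iter x n w)") (auto simp: Cauchy_convergent_iff convergent_const)
  then show "(\<lambda>n. ?f n w) \<longlonglongrightarrow> path_lim x w"
    unfolding path_lim_def by (simp add: convergent_LIMSEQ_iff)
qed

lemma iterF_eq_path_iter: "f t n x \<omega> = path_iter x n (\<lambda>s. W (t + s) \<omega>)"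
  unfolding path_iter_def W_def by (subst iterF_path[where s = 0]) simp

lemma X_meas [measurable]: "X t x \<in> borel_measurable M"
  unfolding X_def by measurable

lemma X_lim:
  assumes "Cauchy (\<lambda>n. f t n x \<omega>)"
  shows "(\<lambda>n. f t n x \<omega>) \<longlonglongrightarrow> X t x \<omega>"
  using assms by (simp add: iterF_eq_path_iter X_def path_lim_def Cauchy_convergent_iff convergent_LIMSEQ_iff)

text \<open>Turns a pathwise bound through \<open>Q\<close> into a conditional one through
  \<open>R\<close>. The affine form serves two uses: \<open>d = 0\<close> for the distance to the
  limit, a constant \<open>d\<close> for the moment of the limit.\<close>

lemma nn_cond_exp_Z_le:
  assumes [measurable]: "g \<in> borel_measurable M" "Q \<in> borel_measurable M" and R[measurable]: "R \<in> borel_measurable \<Z>"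
    and fin: "AE \<omega> in M. R \<omega> < \<infinity>"
    and le: "\<And>A. A \<in> sets \<Z> \<Longrightarrow> (\<integral>\<^sup>+ \<omega>. indicator A \<omega> * Q \<omega> \<partial>M) \<le> (\<integral>\<^sup>+ \<omega>. indicator A \<omega> * R \<omega> \<partial>M)"
    and dom: "AE \<omega> in M. g \<omega> \<le> ennreal b * Q \<omega> + ennreal d"
  shows "AE \<omega> in M. nn_cond_exp M \<Z> g \<omega> \<le> ennreal b * R \<omega> + ennreal d"
proof (rule Z.nn_cond_exp_le)
  show "AE \<omega> in M. ennreal b * R \<omega> + ennreal d < \<infinity>"
    using fin by eventually_elim (simp add: ennreal_mult_less_top)
  have [measurable]: "R \<in> borel_measurable M" by (rule measurable_from_subalg[OF subalgebra_Z R])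
  fix A assume A: "A \<in> sets \<Z>"
  then have [measurable]: "A \<in> sets M" using subalgebra_Z by (auto simp: subalgebra_def)
  have "(\<integral>\<^sup>+ \<omega>. indicator A \<omega> * g \<omega> \<partial>M) \<le> (\<integral>\<^sup>+ \<omega>. ennreal b * (indicator A \<omega> * Q \<omega>) + ennreal d * indicator A \<omega> \<partial>M)"
    using dom by (intro nn_integral_mono_AE) (auto elim!: eventually_mono split: split_indicator)
  also have "\<dots> = ennreal b * (\<integral>\<^sup>+ \<omega>. indicator A \<omega> * Q \<omega> \<partial>M) + ennreal d * emeasure M A"
    by (simp add: nn_integral_add nn_integral_cmult)
  also have "\<dots> \<le> ennreal b * (\<integral>\<^sup>+ \<omega>. indicator A \<omega> * R \<omega> \<partial>M) + ennreal d * emeasure M A"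
    by (intro add_right_mono mult_left_mono le A) simp
  also have "\<dots> = (\<integral>\<^sup>+ \<omega>. ennreal b * (indicator A \<omega> * R \<omega>) + ennreal d * indicator A \<omega> \<partial>M)"
    by (simp add: nn_integral_add nn_integral_cmult)
  also have "\<dots> = (\<integral>\<^sup>+ \<omega>. indicator A \<omega> * (ennreal b * R \<omega> + ennreal d) \<partial>M)"
    by (intro nn_integral_cong) (auto split: split_indicator)
  finally show "(\<integral>\<^sup>+ \<omega>. indicator A \<omega> * g \<omega> \<partial>M) \<le> (\<integral>\<^sup>+ \<omega>. indicator A \<omega> * (ennreal b * R \<omega> + ennreal d) \<partial>M)" .
qed simp_all

lemma convergence:
  shows "AE \<omega> in M. (\<lambda>n. f t n x \<omega>) \<longlonglongrightarrow> X t x \<omega>" (is ?lim)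
    and "AE \<omega> in M. (\<lambda>n. nn_cond_exp M \<Z> (\<lambda>\<omega>. dp (f t n x \<omega>) (X t x \<omega>)) \<omega>) \<longlonglongrightarrow> 0" (is ?cond)
    and "AE \<omega> in M. nn_cond_exp M \<Z> (\<lambda>\<omega>. dp (X t x \<omega>) x0) \<omega> < \<infinity>" (is ?fin)
proof -
  obtain q Q R where q: "0 < q" "q < 1" and Q[measurable]: "Q \<in> borel_measurable M"
    and R[measurable]: "R \<in> borel_measurable \<Z>"
    and R_fin: "AE \<omega> in M. R \<omega> < (\<infinity>::ennreal)" and Q_fin: "AE \<omega> in M. Q \<omega> < (\<infinity>::ennreal)"
    and le: "\<And>A. A \<in> sets \<Z> \<Longrightarrow> (\<integral>\<^sup>+ \<omega>. indicator A \<omega> * Q \<omega> \<partial>M) \<le> (\<integral>\<^sup>+ \<omega>. indicator A \<omega> * R \<omega> \<partial>M)"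
    and step: "\<And>\<omega> k. Q \<omega> < \<infinity> \<Longrightarrow> dist (f t (Suc k) x \<omega>) (f t k x \<omega>) \<le> enn2real (Q \<omega>) powr (1 / p) * q ^ k"
    using geometric_control[of t x] by blast
  have lim: "(\<lambda>n. f t n x \<omega>) \<longlonglongrightarrow> X t x \<omega>" if "Q \<omega> < \<infinity>" for \<omega>
    by (rule X_lim, rule geometric_Cauchy[OF step[OF that] q])
  show ?lim using Q_fin by eventually_elim (rule lim)
  \<comment> \<open>The \<open>p\<close>-th power of the geometric tail
    \<open>q ^ k / (1 - q)\<close>. The bound is a deterministic rate times the random constant
    \<open>Q\<close>, so the conditional expectation inherits the rate.\<close>
  define b where "b k = (1 / (1 - q)) powr p * (q powr p) ^ k" for k
  have bound: "dist (f t k x \<omega>) (X t x \<omega>) powr p \<le> b k * enn2real (Q \<omega>)" if "Q \<omega> < \<infinity>" for \<omega> k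
  proof -
    have "dist (f t k x \<omega>) (X t x \<omega>) \<le> enn2real (Q \<omega>) powr (1 / p) * q ^ k / (1 - q)"
      by (rule geometric_limit_bound[OF step[OF that] q lim[OF that]])
    also have "\<dots> = enn2real (Q \<omega>) powr (1 / p) * (q ^ k * (1 / (1 - q)))" by simp
    finally have "dist (f t k x \<omega>) (X t x \<omega>) powr p \<le> (enn2real (Q \<omega>) powr (1 / p) * (q ^ k * (1 / (1 - q)))) powr p"
      using p_pos by (intro powr_mono2) auto
    also have "\<dots> = enn2real (Q \<omega>) * ((q ^ k) powr p * (1 / (1 - q)) powr p)"
      using p_pos by (simp only: powr_mult powr_powr) simp
    also have "(q ^ k) powr p = (q powr p) ^ k"
      using q by (simp add: powr_powr powr_realpow[symmetric] mult_ac)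
    finally show ?thesis by (simp add: b_def mult_ac)
  qed
  have b0: "0 \<le> b k" for k by (simp add: b_def)
  have boundQ: "dp (f t k x \<omega>) (X t x \<omega>) \<le> ennreal (b k) * Q \<omega>" if "Q \<omega> < \<infinity>" for \<omega> k
  proof -
    have "dp (f t k x \<omega>) (X t x \<omega>) \<le> ennreal (b k * enn2real (Q \<omega>))" by (rule ennreal_leI[OF bound[OF that]])
    then show ?thesis using that by (simp add: ennreal_mult b0)
  qed
  have "AE \<omega> in M. nn_cond_exp M \<Z> (\<lambda>\<omega>. dp (f t k x \<omega>) (X t x \<omega>)) \<omega> \<le> ennreal (b k) * R \<omega> + ennreal 0" for k
    using Q_fin by (intro nn_cond_exp_Z_le[OF _ Q R R_fin le]) (auto elim!: eventually_mono intro: boundQ)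
  then have "AE \<omega> in M. \<forall>k. nn_cond_exp M \<Z> (\<lambda>\<omega>. dp (f t k x \<omega>) (X t x \<omega>)) \<omega> \<le> ennreal (b k) * R \<omega>"
    by (subst AE_all_countable) simp
  with R_fin show ?cond
  proof eventually_elim
    case (elim \<omega>)
    have "q powr p < 1" using q p_pos powr_less_mono2[of p q 1] by simp
    then have "b \<longlonglongrightarrow> (1 / (1 - q)) powr p * 0"
      unfolding b_def using q by (intro tendsto_intros LIMSEQ_power_zero) auto
    then have "(\<lambda>k. ennreal (b k * enn2real (R \<omega>))) \<longlonglongrightarrow> ennreal (0 * enn2real (R \<omega>))"
      by (intro tendsto_intros) simp
    moreover have "ennreal (b k * enn2real (R \<omega>)) = ennreal (b k) * R \<omega>" for k
      using elim(1) by (simp add: ennreal_mult b0)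
    ultimately have "(\<lambda>k. ennreal (b k) * R \<omega>) \<longlonglongrightarrow> 0" by simp
    then show ?case
      by (rule tendsto_sandwich[rotated 2, OF tendsto_const]) (use elim(2) in auto)
  qed
  have "AE \<omega> in M. nn_cond_exp M \<Z> (\<lambda>\<omega>. dp (X t x \<omega>) x0) \<omega> \<le>
      ennreal (3 powr p * b 0) * R \<omega> + ennreal (3 powr p * dist x x0 powr p)"
  proof (rule nn_cond_exp_Z_le[OF _ Q R R_fin le])
    show "AE \<omega> in M. dp (X t x \<omega>) x0 \<le> ennreal (3 powr p * b 0) * Q \<omega> + ennreal (3 powr p * dist x x0 powr p)"
      using Q_fin
    proof eventually_elim
      case (elim \<omega>)
      \<comment> \<open>The iterate with \<open>k = 0\<close> is \<open>x\<close> itself, so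
        \<open>bound\<close> at 0 measures the distance from \<open>x\<close> to the limit; the
        third summand is a dummy 0.\<close>
      have "dist (X t x \<omega>) x0 powr p \<le> (dist x (X t x \<omega>) + dist x x0 + 0) powr p"
        using p_pos by (intro powr_mono2) (auto, metric)
      also have "\<dots> \<le> 3 powr p * (dist x (X t x \<omega>) powr p + dist x x0 powr p + 0 powr p)"
        using p_pos by (intro powr_add3_le) auto
      also have "\<dots> \<le> 3 powr p * (b 0 * enn2real (Q \<omega>) + dist x x0 powr p)"
        using bound[OF elim, of 0] by simp
      finally have "dp (X t x \<omega>) x0 \<le> ennreal (3 powr p * (b 0 * enn2real (Q \<omega>) + dist x x0 powr p))"
        by (rule ennreal_leI)
      also have "\<dots> = ennreal (3 powr p * b 0) * Q \<omega> + ennreal (3 powr p * dist x x0 powr p)"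
        using elim by (simp add: distrib_left mult.assoc[symmetric] ennreal_mult b0)
      finally show ?case .
    qed
  qed simp_all
  with R_fin show ?fin
  proof eventually_elim
    case (elim \<omega>)
    have "ennreal (3 powr p * b 0) * R \<omega> + ennreal (3 powr p * dist x x0 powr p) < \<infinity>"
      using elim(1) by (simp add: ennreal_mult_less_top)
    with elim(2) show ?case by (rule le_less_trans)
  qed
qed

lemma kp_AE_summable: "AE \<omega> in M. summable (\<lambda>n. kp t n \<omega>)"
proof -
  obtain \<rho> where \<rho>: "0 < \<rho>" "\<rho> < 1" "AE \<omega> in M. \<exists>C. \<forall>n. kp t n \<omega> \<le> C * \<rho> ^ (4 * n)"
    using decay by blast
  show ?thesis using \<rho>(3) by eventually_elim (use kp_summable[OF \<rho>(1,2)] in blast)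
qed

text \<open>Contraction, summed over \<open>n\<close>, makes the series of distances between the two
  trajectories conditionally finite, because \<open>kp\<close> is summable. The series is then
  finite almost surely, its terms tend to 0, and the limits agree.\<close>

lemma X_start_irrelevant: "AE \<omega> in M. X t x \<omega> = X t y \<omega>"
proof -
  define Q where "Q \<omega> = (\<Sum>n. dp (f t n x \<omega>) (f t n y \<omega>))" for \<omega>
  define R where "R \<omega> = (\<Sum>n. ennreal (kp t n \<omega>) * dp x y)" for \<omega>
  have Q[measurable]: "Q \<in> borel_measurable M" unfolding Q_def by measurable
  have R[measurable]: "R \<in> borel_measurable \<Z>" unfolding R_def by measurable
  have R_fin: "AE \<omega> in M. R \<omega> < \<infinity>"
    using kp_AE_summable[of t]
  proof eventually_elim
    case (elim \<omega>)
    then have "(\<Sum>n. ennreal (kp t n \<omega>)) \<noteq> \<top>" by (intro ennreal_suminf_neq_top) auto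
    then show ?case
      unfolding R_def by (simp add: ennreal_suminf_multc ennreal_mult_less_top less_top)
  qed
  have le: "(\<integral>\<^sup>+ \<omega>. indicator A \<omega> * Q \<omega> \<partial>M) \<le> (\<integral>\<^sup>+ \<omega>. indicator A \<omega> * R \<omega> \<partial>M)" if A: "A \<in> sets \<Z>" for A
  proof -
    note [measurable] = A
    have [measurable]: "A \<in> sets M" using A subalgebra_Z by (auto simp: subalgebra_def)
    have "(\<integral>\<^sup>+ \<omega>. indicator A \<omega> * Q \<omega> \<partial>M) = (\<integral>\<^sup>+ \<omega>. (\<Sum>n. indicator A \<omega> * dp (f t n x \<omega>) (f t n y \<omega>)) \<partial>M)"
      unfolding Q_def by (simp only: ennreal_suminf_cmult)
    also have "\<dots> = (\<Sum>n. \<integral>\<^sup>+ \<omega>. indicator A \<omega> * dp (f t n x \<omega>) (f t n y \<omega>) \<partial>M)"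
      by (rule nn_integral_suminf) measurable
    also have "\<dots> \<le> (\<Sum>n. \<integral>\<^sup>+ \<omega>. indicator A \<omega> * (ennreal (kp t n \<omega>) * dp x y) \<partial>M)"
    proof (intro suminf_le)
      show "(\<integral>\<^sup>+ \<omega>. indicator A \<omega> * dp (f t n x \<omega>) (f t n y \<omega>) \<partial>M) \<le>
          (\<integral>\<^sup>+ \<omega>. indicator A \<omega> * (ennreal (kp t n \<omega>) * dp x y) \<partial>M)" for n
        by (rule iterF_contraction[of "\<lambda>_. x" t n "\<lambda>_. y"]) measurable
    qed auto
    also have "\<dots> = (\<integral>\<^sup>+ \<omega>. (\<Sum>n. indicator A \<omega> * (ennreal (kp t n \<omega>) * dp x y)) \<partial>M)"
      by (rule nn_integral_suminf[symmetric]) measurable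
    also have "\<dots> = (\<integral>\<^sup>+ \<omega>. indicator A \<omega> * R \<omega> \<partial>M)"
      unfolding R_def by (simp only: ennreal_suminf_cmult)
    finally show ?thesis .
  qed
  have "AE \<omega> in M. Q \<omega> < \<infinity>"
    by (rule Z.AE_finite_if_conditionally_dominated[OF Q R R_fin le])
  with convergence(1)[of t x] convergence(1)[of t y] show ?thesis
  proof eventually_elim
    case (elim \<omega>)
    have "summable (\<lambda>n. dist (f t n x \<omega>) (f t n y \<omega>) powr p)"
      using elim(3) unfolding Q_def by (intro summable_suminf_not_top) auto
    then have "(\<lambda>n. dist (f t n x \<omega>) (f t n y \<omega>) powr p) \<longlonglongrightarrow> 0" by (rule summable_LIMSEQ_zero)
    moreover have "(\<lambda>n. dist (f t n x \<omega>) (f t n y \<omega>) powr p) \<longlonglongrightarrow> dist (X t x \<omega>) (X t y \<omega>) powr p"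
      using elim(1,2) p_pos by (intro tendsto_powr' tendsto_dist) auto
    ultimately have "dist (X t x \<omega>) (X t y \<omega>) powr p = 0" by (rule LIMSEQ_unique[symmetric])
    then show ?case by simp
  qed
qed

lemma XZ_ergodic: "ergodic_process M (\<lambda>t \<omega>. (X t x \<omega>, Z t \<omega>))"
proof -
  have "(\<lambda>w. (path_lim x w, fst (w 0))) \<in> borel_measurable path_space" by measurable
  from ergodic_process_factor[OF W_ergodic this] show ?thesis by (simp add: X_def W_def)
qed

end

section \<open>Uniqueness of the stationary solution\<close>

lemma (in prob_space) finite_measure_subalgebra_proc_sigma:
  fixes Z :: "int \<Rightarrow> 'a \<Rightarrow> 'b::topological_space"
  assumes "\<And>t. Z t \<in> borel_measurable M"
  shows "finite_measure_subalgebra M (proc_sigma M I Z)"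
proof -
  have "sets (proc_sigma M I Z) \<subseteq> sets M"
    unfolding proc_sigma_def by (intro sets_image_in_sets measurable_restrict) (auto simp: assms)
  then have "subalgebra M (proc_sigma M I Z)" by (simp add: subalgebra_def proc_sigma_def)
  then show ?thesis
    by (simp add: finite_measure_subalgebra_def finite_measure_subalgebra_axioms_def finite_measure_axioms)
qed

context random_maps
begin

lemma non_anticipative_past:
  assumes "Y \<in> proc_sigma M {..t} (\<lambda>j \<omega>. (Z j \<omega>, eps j \<omega>)) \<rightarrow>\<^sub>M N"
  shows "Y \<in> past (t + 1) \<rightarrow>\<^sub>M N"
proof -
  have "(\<lambda>\<omega>. (Z j \<omega>, eps j \<omega>)) \<in> borel_measurable (past (t + 1))" if "j \<le> t" for j
  proof -
    have [measurable]: "eps j \<in> borel_measurable (past (t + 1))" using that by (intro eps_past) simp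
    show ?thesis by measurable
  qed
  then have "sets (proc_sigma M {..t} (\<lambda>j \<omega>. (Z j \<omega>, eps j \<omega>))) \<subseteq> sets (past (t + 1))"
    unfolding proc_sigma_def by (intro sets_image_in_sets measurable_restrict) auto
  then show ?thesis
    using assms measurable_mono[OF order_refl refl, of "proc_sigma M {..t} (\<lambda>j \<omega>. (Z j \<omega>, eps j \<omega>))" "past (t + 1)" N]
    by (auto simp: proc_sigma_def)
qed

lemma iterate_solution:
  assumes rec: "\<And>t. AE \<omega> in M. Y t \<omega> = F (Y (t - 1) \<omega>) (Z (t - 1) \<omega>) (eps t \<omega>)"
  shows "AE \<omega> in M. Y t \<omega> = f t n (Y (t - int n) \<omega>) \<omega>"
proof (induction n arbitrary: t)
  case (Suc n)
  show ?case using rec[of t] Suc[of "t - 1"]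
    by eventually_elim (simp add: algebra_simps)
qed simp

text \<open>
  \<open>H\<close> encodes the event that the conditional moment of \<open>Y 0\<close> is at most \<open>K\<close>; as a set of
  \<open>Z\<close>-paths it can be shifted to any time \<open>h\<close>.
\<close>
lemma truncated_moments:
  assumes [measurable]: "\<And>t. Y t \<in> borel_measurable M"
    and stat: "stationary_process M (\<lambda>t \<omega>. (Y t \<omega>, Z t \<omega>))"
    and fin: "AE \<omega> in M. nn_cond_exp M (proc_sigma M {..0} Z) (\<lambda>\<omega>. dp (Y 0 \<omega>) x0) \<omega> < \<infinity>"
    and e: "0 < e"
  shows "\<exists>(K::nat) H. H \<in> sets (Pi\<^sub>M {..0} (\<lambda>_. borel)) \<and>
    (\<forall>h. prob {\<omega>\<in>space M. (\<lambda>j\<in>{..0}. Z (j + h) \<omega>) \<notin> H} < e \<and>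
      (\<integral>\<^sup>+ \<omega>. indicator H (\<lambda>j\<in>{..0}. Z (j + h) \<omega>) * dp (Y h \<omega>) x0 \<partial>M) \<le> of_nat K)"
proof -
  let ?G = "proc_sigma M {..0} Z"
  interpret G: finite_measure_subalgebra M ?G
    by (rule finite_measure_subalgebra_proc_sigma) simp
  define V where "V = nn_cond_exp M ?G (\<lambda>\<omega>. dp (Y 0 \<omega>) x0)"
  have V[measurable]: "V \<in> borel_measurable ?G" "V \<in> borel_measurable M"
    unfolding V_def by simp_all
  have spG: "space ?G = space M" by (simp add: proc_sigma_def)
  \<comment> \<open>Coding the exceptional event as a 0-1 variable that tends to 0 lets
    \<open>prob_ge_tendsto_zero\<close> select \<open>K\<close>.\<close>
  define u :: "nat \<Rightarrow> 'a \<Rightarrow> real" where "u K \<omega> = (if V \<omega> \<le> of_nat K then 0 else 1)" for K \<omega>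
  have [measurable]: "u K \<in> borel_measurable M" for K unfolding u_def by measurable
  have "AE \<omega> in M. (\<lambda>K. u K \<omega>) \<longlonglongrightarrow> 0"
    using fin
  proof eventually_elim
    case (elim \<omega>)
    then obtain K0 where "V \<omega> < of_nat K0" using ennreal_Ex_less_of_nat[of "V \<omega>"] by (auto simp: V_def)
    then have "V \<omega> \<le> of_nat K" if "K \<ge> K0" for K
      using that by (meson less_imp_le of_nat_mono order_trans)
    then have "eventually (\<lambda>K. 0 = u K \<omega>) sequentially"
      by (auto simp: eventually_sequentially u_def intro!: exI[of _ K0])
    then show ?case by (rule Lim_transform_eventually[OF tendsto_const])
  qed
  then have "(\<lambda>K. prob {\<omega>\<in>space M. 1 \<le> u K \<omega>}) \<longlonglongrightarrow> 0" by (intro prob_ge_tendsto_zero) auto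
  then have "eventually (\<lambda>K. prob {\<omega>\<in>space M. 1 \<le> u K \<omega>} < e) sequentially"
    using e by (rule order_tendstoD)
  then obtain K where K: "prob {\<omega>\<in>space M. 1 \<le> u K \<omega>} < e" by (auto simp: eventually_sequentially)
  have "{\<omega>\<in>space ?G. V \<omega> \<le> of_nat K} \<in> sets ?G" by measurable
  moreover have "sets ?G = {(\<lambda>\<omega>. \<lambda>j\<in>{..0}. Z j \<omega>) -` H \<inter> space M |H. H \<in> sets (Pi\<^sub>M {..0} (\<lambda>_. borel))}"
    unfolding proc_sigma_def by (rule sets_vimage_algebra2) (auto simp: space_PiM)
  ultimately obtain H where H[measurable]: "H \<in> sets (Pi\<^sub>M {..0} (\<lambda>_. borel))"
    and H_eq: "{\<omega>\<in>space M. V \<omega> \<le> of_nat K} = (\<lambda>\<omega>. \<lambda>j\<in>{..0}. Z j \<omega>) -` H \<inter> space M"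
    by (auto simp: spG)
  have H_iff: "(\<lambda>j\<in>{..0}. Z j \<omega>) \<in> H \<longleftrightarrow> V \<omega> \<le> of_nat K" if "\<omega> \<in> space M" for \<omega>
    using H_eq that by blast
  have proj[measurable]: "(\<lambda>w. \<lambda>j\<in>{..0}. snd (w j)) \<in>
      (path_space :: (int \<Rightarrow> 'e \<times> 'z) measure) \<rightarrow>\<^sub>M Pi\<^sub>M {..0} (\<lambda>_. borel)"
    and proj'[measurable]: "(\<lambda>w. fst (w 0)) \<in> borel_measurable (path_space :: (int \<Rightarrow> 'e \<times> 'z) measure)"
  proof -
    have "(fst :: 'e \<times> 'z \<Rightarrow> 'e) \<in> borel \<rightarrow>\<^sub>M borel" "(snd :: 'e \<times> 'z \<Rightarrow> 'z) \<in> borel \<rightarrow>\<^sub>M borel"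
      by (auto simp flip: borel_prod)
    then show "(\<lambda>w. \<lambda>j\<in>{..0}. snd (w j)) \<in> (path_space :: (int \<Rightarrow> 'e \<times> 'z) measure) \<rightarrow>\<^sub>M Pi\<^sub>M {..0} (\<lambda>_. borel)"
      "(\<lambda>w. fst (w 0)) \<in> borel_measurable (path_space :: (int \<Rightarrow> 'e \<times> 'z) measure)"
      by (auto intro!: measurable_restrict measurable_compose[OF measurable_component_singleton])
  qed
  have small: "prob {\<omega>\<in>space M. (\<lambda>j\<in>{..0}. Z (j + h) \<omega>) \<notin> H} < e" for h
  proof -
    have pr: "emeasure M {\<omega>\<in>space M. (\<lambda>j\<in>{..0}. Z (j + h) \<omega>) \<notin> H} =
        (\<integral>\<^sup>+ \<omega>. indicator (- H) (\<lambda>j\<in>{..0}. snd (Y (j + h) \<omega>, Z (j + h) \<omega>)) \<partial>M)" for h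
    proof -
      have "emeasure M {\<omega>\<in>space M. (\<lambda>j\<in>{..0}. Z (j + h) \<omega>) \<notin> H} =
          (\<integral>\<^sup>+ \<omega>. indicator {\<omega>\<in>space M. (\<lambda>j\<in>{..0}. Z (j + h) \<omega>) \<notin> H} \<omega> \<partial>M)" by simp
      also have "\<dots> = (\<integral>\<^sup>+ \<omega>. indicator (- H) (\<lambda>j\<in>{..0}. snd (Y (j + h) \<omega>, Z (j + h) \<omega>)) \<partial>M)"
        by (intro nn_integral_cong) (simp add: indicator_def)
      finally show ?thesis .
    qed
    \<comment> \<open>The complement of \<open>H\<close> in the full function type need not belong
      to the product sigma-algebra, so measurability goes through 1 minus the indicator of
      \<open>H\<close>.\<close>
    have m: "(\<lambda>w. indicator (- H) (\<lambda>j\<in>{..0}. snd (w j)) :: ennreal) \<in>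
        borel_measurable (path_space :: (int \<Rightarrow> 'e \<times> 'z) measure)"
    proof -
      have "(\<lambda>w. 1 - indicator H (\<lambda>j\<in>{..0}. snd (w j)) :: ennreal) \<in>
          borel_measurable (path_space :: (int \<Rightarrow> 'e \<times> 'z) measure)" by measurable
      moreover have "(indicator (- H) y :: ennreal) = 1 - indicator H y" for y by (simp add: indicator_def)
      ultimately show ?thesis by simp
    qed
    have "emeasure M {\<omega>\<in>space M. (\<lambda>j\<in>{..0}. Z (j + h) \<omega>) \<notin> H} = emeasure M {\<omega>\<in>space M. (\<lambda>j\<in>{..0}. Z (j + 0) \<omega>) \<notin> H}"
      using stationary_process_nn_integral[OF stat m, of h] unfolding pr by simp
    also have "{\<omega>\<in>space M. (\<lambda>j\<in>{..0}. Z (j + 0) \<omega>) \<notin> H} = {\<omega>\<in>space M. 1 \<le> u K \<omega>}"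
      using H_iff by (auto simp: u_def)
    finally have "prob {\<omega>\<in>space M. (\<lambda>j\<in>{..0}. Z (j + h) \<omega>) \<notin> H} = prob {\<omega>\<in>space M. 1 \<le> u K \<omega>}"
      by (simp only: measure_def)
    then show ?thesis using K by (simp only:)
  qed
  have moment: "(\<integral>\<^sup>+ \<omega>. indicator H (\<lambda>j\<in>{..0}. Z (j + h) \<omega>) * dp (Y h \<omega>) x0 \<partial>M) \<le> of_nat K" for h
  proof -
    have m: "(\<lambda>w. indicator H (\<lambda>j\<in>{..0}. snd (w j)) * dp (fst (w 0)) x0) \<in>
        borel_measurable (path_space :: (int \<Rightarrow> 'e \<times> 'z) measure)" by measurable
    have "(\<integral>\<^sup>+ \<omega>. indicator H (\<lambda>j\<in>{..0}. Z (j + h) \<omega>) * dp (Y h \<omega>) x0 \<partial>M) =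
        (\<integral>\<^sup>+ \<omega>. indicator H (\<lambda>j\<in>{..0}. Z j \<omega>) * dp (Y 0 \<omega>) x0 \<partial>M)"
      using stationary_process_nn_integral[OF stat m, of h] by simp
    also have "\<dots> = (\<integral>\<^sup>+ \<omega>. indicator {\<omega>\<in>space M. V \<omega> \<le> of_nat K} \<omega> * dp (Y 0 \<omega>) x0 \<partial>M)"
      using H_iff by (intro nn_integral_cong) (simp add: indicator_def)
    \<comment> \<open>The truncation set lies in \<open>?G\<close>, so on it the moment may be
      exchanged for its conditional expectation \<open>V\<close>, which is at most \<open>K\<close>
      there.\<close>
    also have "\<dots> = (\<integral>\<^sup>+ \<omega>. indicator {\<omega>\<in>space M. V \<omega> \<le> of_nat K} \<omega> * V \<omega> \<partial>M)"
      unfolding V_def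
    proof (rule G.nn_cond_exp_intg[symmetric])
      have "{\<omega>\<in>space ?G. V \<omega> \<le> of_nat K} \<in> sets ?G" by measurable
      then show "indicator {\<omega>\<in>space M. nn_cond_exp M ?G (\<lambda>\<omega>. dp (Y 0 \<omega>) x0) \<omega> \<le> of_nat K} \<in> borel_measurable ?G"
        by (intro borel_measurable_indicator) (simp add: spG V_def)
    qed simp
    also have "\<dots> \<le> (\<integral>\<^sup>+ \<omega>. of_nat K \<partial>M)"
      by (intro nn_integral_mono) (auto simp: indicator_def)
    finally show ?thesis by (simp add: emeasure_space_1)
  qed
  show ?thesis by (intro exI[of _ K] exI[of _ H] conjI allI H small moment)
qed

text \<open>Four exceptional events of probability at most \<open>e\<close> each: the path of
  \<open>Z\<close> up to \<open>t - n\<close> leaves \<open>H\<close>; the contraction factor is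
  still at least \<eta>; the iterates from \<open>x0\<close> are still at least \<zeta> away from
  the limit; or \<open>Y\<close> is at least \<zeta> away from these iterates although the first two
  do not occur. The last one is a Markov bound.\<close>

lemma stationary_solution_close:
  assumes na: "\<And>t. Y t \<in> proc_sigma M {..t} (\<lambda>j \<omega>. (Z j \<omega>, eps j \<omega>)) \<rightarrow>\<^sub>M borel"
    and stat: "stationary_process M (\<lambda>t \<omega>. (Y t \<omega>, Z t \<omega>))"
    and rec: "\<And>t. AE \<omega> in M. Y t \<omega> = F (Y (t - 1) \<omega>) (Z (t - 1) \<omega>) (eps t \<omega>)"
    and fin: "AE \<omega> in M. nn_cond_exp M (proc_sigma M {..0} Z) (\<lambda>\<omega>. dp (Y 0 \<omega>) x0) \<omega> < \<infinity>"
    and e: "0 < e" and \<zeta>: "0 < \<zeta>"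
  shows "prob {\<omega>\<in>space M. 2 * \<zeta> \<le> dist (Y t \<omega>) (X t x0 \<omega>)} \<le> 4 * e"
proof -
  have Y_past: "Y t \<in> borel_measurable (past (t + 1))" for t
    by (rule non_anticipative_past[OF na])
  have [measurable]: "Y t \<in> borel_measurable M" for t
    by (rule measurable_past_M[OF Y_past])
  obtain K :: nat and H where H[measurable]: "H \<in> sets (Pi\<^sub>M {..0} (\<lambda>_. borel))"
    and small: "\<And>h. prob {\<omega>\<in>space M. (\<lambda>j\<in>{..0}. Z (j + h) \<omega>) \<notin> H} < e"
    and moment: "\<And>h. (\<integral>\<^sup>+ \<omega>. indicator H (\<lambda>j\<in>{..0}. Z (j + h) \<omega>) * dp (Y h \<omega>) x0 \<partial>M) \<le> of_nat K"
    using truncated_moments[OF _ stat fin e] by auto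
  \<comment> \<open>Chosen so that the Markov bound \<open>\<eta> * K / \<zeta> powr p\<close> is at
    most \<open>e\<close>; the \<open>+ 1\<close> covers \<open>K = 0\<close>.\<close>
  define \<eta> where "\<eta> = e * \<zeta> powr p / (real K + 1)"
  have \<eta>: "0 < \<eta>" using e \<zeta> by (simp add: \<eta>_def)
  have "AE \<omega> in M. (\<lambda>n. kp t n \<omega>) \<longlonglongrightarrow> 0"
    using kp_AE_summable[of t] by eventually_elim (rule summable_LIMSEQ_zero)
  then have "(\<lambda>n. prob {\<omega>\<in>space M. \<eta> \<le> kp t n \<omega>}) \<longlonglongrightarrow> 0"
    using \<eta> by (intro prob_ge_tendsto_zero) auto
  then have ev1: "eventually (\<lambda>n. prob {\<omega>\<in>space M. \<eta> \<le> kp t n \<omega>} < e) sequentially"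
    using e by (rule order_tendstoD)
  have "AE \<omega> in M. (\<lambda>n. dist (f t n x0 \<omega>) (X t x0 \<omega>)) \<longlonglongrightarrow> 0"
    using convergence(1)[of t x0] by eventually_elim (rule tendsto_dist_iff[THEN iffD1])
  then have "(\<lambda>n. prob {\<omega>\<in>space M. \<zeta> \<le> dist (f t n x0 \<omega>) (X t x0 \<omega>)}) \<longlonglongrightarrow> 0"
    using \<zeta> by (intro prob_ge_tendsto_zero) auto
  then have ev2: "eventually (\<lambda>n. prob {\<omega>\<in>space M. \<zeta> \<le> dist (f t n x0 \<omega>) (X t x0 \<omega>)} < e) sequentially"
    using e by (rule order_tendstoD)
  \<comment> \<open>\<open>K\<close> and \<open>H\<close> were fixed before \<open>n\<close>, and
    their bounds hold at every time, in particular at \<open>t - n\<close>.\<close>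
  obtain n where n1: "prob {\<omega>\<in>space M. \<eta> \<le> kp t n \<omega>} < e"
    and n2: "prob {\<omega>\<in>space M. \<zeta> \<le> dist (f t n x0 \<omega>) (X t x0 \<omega>)} < e"
    using eventually_happens[OF eventually_conj[OF ev1 ev2]] by auto
  let ?h = "t - int n"
  let ?Z = "\<lambda>\<omega>. \<lambda>j\<in>{..0}. Z (j + ?h) \<omega>"
  have Zh[measurable]: "?Z \<in> \<Z> \<rightarrow>\<^sub>M Pi\<^sub>M {..0} (\<lambda>_. borel)" "?Z \<in> M \<rightarrow>\<^sub>M Pi\<^sub>M {..0} (\<lambda>_. borel)"
    by measurable
  \<comment> \<open>Both truncations depend on \<open>Z\<close> alone, so this is an admissible
    weight for \<open>iterF_contraction\<close>.\<close>
  define wt :: "'a \<Rightarrow> ennreal" where "wt \<omega> = indicator H (?Z \<omega>) * indicator {..<\<eta>} (kp t n \<omega>)" for \<omega>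
  have wt[measurable]: "wt \<in> borel_measurable \<Z>" "wt \<in> borel_measurable M" unfolding wt_def by measurable
  let ?S = "{\<omega>\<in>space M. ?Z \<omega> \<in> H \<and> kp t n \<omega> < \<eta> \<and> \<zeta> \<le> dist (Y t \<omega>) (f t n x0 \<omega>)}"
  have S: "prob ?S \<le> e"
  proof -
    have "emeasure M ?S * ennreal (\<zeta> powr p) = (\<integral>\<^sup>+ \<omega>. indicator ?S \<omega> * ennreal (\<zeta> powr p) \<partial>M)"
      by (subst nn_integral_multc) auto
    also have "\<dots> \<le> (\<integral>\<^sup>+ \<omega>. wt \<omega> * dp (Y t \<omega>) (f t n x0 \<omega>) \<partial>M)"
      using \<zeta> p_pos
      by (intro nn_integral_mono) (auto simp: wt_def indicator_def intro!: ennreal_leI powr_mono2)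
    also have "\<dots> = (\<integral>\<^sup>+ \<omega>. wt \<omega> * dp (f t n (Y ?h \<omega>) \<omega>) (f t n x0 \<omega>) \<partial>M)"
      using iterate_solution[of Y t n, OF rec] by (intro nn_integral_cong_AE) (auto elim!: eventually_mono)
    also have "\<dots> \<le> (\<integral>\<^sup>+ \<omega>. wt \<omega> * (ennreal (kp t n \<omega>) * dp (Y ?h \<omega>) x0) \<partial>M)"
      by (rule iterF_contraction[of "Y ?h" t n "\<lambda>_. x0"]) (auto intro: Y_past)
    also have "\<dots> \<le> (\<integral>\<^sup>+ \<omega>. ennreal \<eta> * (indicator H (?Z \<omega>) * dp (Y ?h \<omega>) x0) \<partial>M)"
    proof (rule nn_integral_mono)
      fix \<omega>
      have "ennreal (kp t n \<omega>) * dp (Y ?h \<omega>) x0 \<le> ennreal \<eta> * dp (Y ?h \<omega>) x0" if "kp t n \<omega> < \<eta>"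
        using that by (intro mult_right_mono ennreal_leI) auto
      then show "wt \<omega> * (ennreal (kp t n \<omega>) * dp (Y ?h \<omega>) x0) \<le> ennreal \<eta> * (indicator H (?Z \<omega>) * dp (Y ?h \<omega>) x0)"
        by (auto simp: wt_def indicator_def)
    qed
    also have "\<dots> = ennreal \<eta> * (\<integral>\<^sup>+ \<omega>. indicator H (?Z \<omega>) * dp (Y ?h \<omega>) x0 \<partial>M)"
      by (rule nn_integral_cmult) measurable
    also have "\<dots> \<le> ennreal \<eta> * of_nat K" by (intro mult_left_mono moment) simp
    also have "\<dots> = ennreal (\<eta> * real K)" using \<eta> by (simp add: ennreal_mult ennreal_of_nat_eq_real_of_nat)
    also have "\<dots> \<le> ennreal (e * \<zeta> powr p)"
    proof (rule ennreal_leI)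
      have "\<eta> * real K \<le> \<eta> * (real K + 1)" using \<eta> by simp
      also have "\<dots> = e * \<zeta> powr p" by (simp add: \<eta>_def field_simps)
      finally show "\<eta> * real K \<le> e * \<zeta> powr p" .
    qed
    finally have "ennreal (prob ?S * \<zeta> powr p) \<le> ennreal (e * \<zeta> powr p)"
      by (simp add: emeasure_eq_measure ennreal_mult)
    then have "prob ?S * \<zeta> powr p \<le> e * \<zeta> powr p" using e by (subst (asm) ennreal_le_iff) auto
    then show ?thesis using \<zeta> by simp
  qed
  let ?A = "{\<omega>\<in>space M. ?Z \<omega> \<notin> H}" and ?B = "{\<omega>\<in>space M. \<eta> \<le> kp t n \<omega>}"
    and ?C = "{\<omega>\<in>space M. \<zeta> \<le> dist (f t n x0 \<omega>) (X t x0 \<omega>)}"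
  have [measurable]: "?A \<in> sets M" "?B \<in> sets M" "?C \<in> sets M" "?S \<in> sets M" by measurable
  have "prob {\<omega>\<in>space M. 2 * \<zeta> \<le> dist (Y t \<omega>) (X t x0 \<omega>)} \<le> prob ((?A \<union> ?B) \<union> (?C \<union> ?S))"
  proof (rule finite_measure_mono)
    show "{\<omega>\<in>space M. 2 * \<zeta> \<le> dist (Y t \<omega>) (X t x0 \<omega>)} \<subseteq> (?A \<union> ?B) \<union> (?C \<union> ?S)"
    proof
      fix \<omega> assume \<omega>: "\<omega> \<in> {\<omega>\<in>space M. 2 * \<zeta> \<le> dist (Y t \<omega>) (X t x0 \<omega>)}"
      have "dist (Y t \<omega>) (X t x0 \<omega>) \<le> dist (Y t \<omega>) (f t n x0 \<omega>) + dist (f t n x0 \<omega>) (X t x0 \<omega>)"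
        by (rule dist_triangle)
      then have "\<zeta> \<le> dist (f t n x0 \<omega>) (X t x0 \<omega>) \<or> \<zeta> \<le> dist (Y t \<omega>) (f t n x0 \<omega>)"
        using \<omega> by auto
      then show "\<omega> \<in> (?A \<union> ?B) \<union> (?C \<union> ?S)" using \<omega> by auto
    qed
  qed measurable
  also have "\<dots> \<le> (prob ?A + prob ?B) + (prob ?C + prob ?S)"
    by (intro order_trans[OF measure_Un_le] add_mono measure_Un_le) auto
  also have "\<dots> \<le> 4 * e" using small[of ?h] n1 n2 S by simp
  finally show ?thesis .
qed

lemma stationary_solution_unique:
  assumes na: "\<And>t. Y t \<in> proc_sigma M {..t} (\<lambda>j \<omega>. (Z j \<omega>, eps j \<omega>)) \<rightarrow>\<^sub>M borel"
    and stat: "stationary_process M (\<lambda>t \<omega>. (Y t \<omega>, Z t \<omega>))"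
    and rec: "\<And>t. AE \<omega> in M. Y t \<omega> = F (Y (t - 1) \<omega>) (Z (t - 1) \<omega>) (eps t \<omega>)"
    and fin: "AE \<omega> in M. nn_cond_exp M (proc_sigma M {..0} Z) (\<lambda>\<omega>. dp (Y 0 \<omega>) x0) \<omega> < \<infinity>"
  shows "AE \<omega> in M. Y t \<omega> = X t x0 \<omega>"
proof -
  have [measurable]: "Y t \<in> borel_measurable M" for t
    by (rule measurable_past_M[OF non_anticipative_past[OF na]])
  have "AE \<omega> in M. dist (Y t \<omega>) (X t x0 \<omega>) < 2 * inverse (real (Suc m))" for m
  proof -
    let ?\<zeta> = "inverse (real (Suc m))"
    let ?N = "{\<omega>\<in>space M. 2 * ?\<zeta> \<le> dist (Y t \<omega>) (X t x0 \<omega>)}"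
    have "prob ?N \<le> 0"
    proof (rule field_le_epsilon)
      fix e :: real assume "0 < e"
      then show "prob ?N \<le> 0 + e"
        using stationary_solution_close[OF na stat rec fin, of "e / 4" ?\<zeta> t] by simp
    qed
    then have "emeasure M ?N = 0" by (simp add: emeasure_eq_measure measure_le_0_iff)
    then have "?N \<in> null_sets M" by (intro null_setsI) measurable
    then have "AE \<omega> in M. \<omega> \<notin> ?N" by (rule AE_not_in)
    then show ?thesis using AE_space by eventually_elim auto
  qed
  then have "AE \<omega> in M. \<forall>m. dist (Y t \<omega>) (X t x0 \<omega>) < 2 * inverse (real (Suc m))"
    by (subst AE_all_countable) blast
  then show ?thesis
  proof eventually_elim
    case (elim \<omega>)
    have "(\<lambda>m. 2 * inverse (real (Suc m))) \<longlonglongrightarrow> 2 * 0"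
      by (intro tendsto_intros LIMSEQ_inverse_real_of_nat)
    then have "dist (Y t \<omega>) (X t x0 \<omega>) \<le> 2 * 0"
      by (rule LIMSEQ_le_const) (use elim less_imp_le in blast)
    then show ?case by simp
  qed
qed

end

section \<open>Extension from \<open>E1\<close> to the whole space and conclusion\<close>

lemma iterF_cong:
  assumes "\<And>x t. F x (Z t \<omega>) (eps (t + 1) \<omega>) = F' x (Z t \<omega>) (eps (t + 1) \<omega>)"
  shows "iterF F Z eps t n x \<omega> = iterF F' Z eps t n x \<omega>"
proof (induction n arbitrary: t)
  case (Suc n)
  show ?case using Suc assms[of _ "t - 1"] by simp
qed simp

lemma measurable_extend_middle:
  fixes F :: "'e::topological_space \<Rightarrow> 'z::topological_space \<Rightarrow> 'w::topological_space \<Rightarrow> 'e"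
  assumes E1[measurable]: "E1 \<in> sets borel"
    and F: "(\<lambda>(x, z, w). F x z w) \<in> (borel \<Otimes>\<^sub>M restrict_space borel E1 \<Otimes>\<^sub>M borel) \<rightarrow>\<^sub>M borel"
  shows "(\<lambda>(x, z, w). if z \<in> E1 then F x z w else x0) \<in> borel \<Otimes>\<^sub>M borel \<Otimes>\<^sub>M borel \<rightarrow>\<^sub>M borel"
proof -
  let ?M = "borel \<Otimes>\<^sub>M borel \<Otimes>\<^sub>M borel :: ('e \<times> 'z \<times> 'w) measure"
  let ?P = "\<lambda>r :: 'e \<times> 'z \<times> 'w. fst (snd r) \<in> E1"
  have P: "{r \<in> space ?M. ?P r} \<in> sets ?M" by measurable
  have "(\<lambda>r. (fst r, fst (snd r), snd (snd r))) \<in> restrict_space ?M {r. ?P r} \<rightarrow>\<^sub>M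
      borel \<Otimes>\<^sub>M restrict_space borel E1 \<Otimes>\<^sub>M borel"
    by (intro measurable_Pair measurable_restrict_space2 measurable_restrict_space1)
      (auto simp: space_restrict_space)
  from measurable_compose[OF this F]
  have "(\<lambda>r. F (fst r) (fst (snd r)) (snd (snd r))) \<in> restrict_space ?M {r. ?P r} \<rightarrow>\<^sub>M borel"
    by (simp add: case_prod_beta')
  then have "(\<lambda>r. if ?P r then F (fst r) (fst (snd r)) (snd (snd r)) else x0) \<in> ?M \<rightarrow>\<^sub>M borel"
    by (subst measurable_If_restrict_space_iff[OF P]) auto
  then show ?thesis by (simp add: case_prod_beta')
qed

theorem theorem3:
  fixes M :: "'a measure"
    and F :: "'e::polish_space \<Rightarrow> 'z::euclidean_space \<Rightarrow> 'w::polish_space \<Rightarrow> 'e"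
    and E1 :: "'z set"
    and Z :: "int \<Rightarrow> 'a \<Rightarrow> 'z"
    and eps :: "int \<Rightarrow> 'a \<Rightarrow> 'w"
    and \<kappa> :: "'z \<Rightarrow> real"
    and p :: real and x0 :: 'e
  assumes P: "prob_space M"
    and E1: "E1 \<in> sets borel"
    and F_meas: "(\<lambda>(x, z, w). F x z w) \<in>
                   (borel \<Otimes>\<^sub>M restrict_space borel E1 \<Otimes>\<^sub>M borel) \<rightarrow>\<^sub>M borel"
    and p: "p \<ge> 1"
    \<comment> \<open>(A0)\<close>
    and Z_vals: "\<forall>t. \<forall>\<omega>\<in>space M. Z t \<omega> \<in> E1"
    and Z_erg: "ergodic_process M Z"
    and eps_indep: "prob_space.indep_vars M (\<lambda>_. borel) eps UNIV"
    and eps_ident: "\<forall>t. distr M borel (eps t) = distr M borel (eps 0)"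
    and Z_eps_indep: "prob_space.indep_set M
          (sets (proc_sigma M UNIV Z)) (sets (proc_sigma M UNIV eps))"
    \<comment> \<open>(A1')\<close>
    and A1: "\<forall>z\<in>E1. (\<integral>\<^sup>+ \<omega>. ennreal (dist (F x0 z (eps 1 \<omega>)) x0 powr p) \<partial>M) < \<infinity>"
    \<comment> \<open>(A2')\<close>
    and \<kappa>_meas: "\<kappa> \<in> borel_measurable (restrict_space borel E1)"
    and \<kappa>_pos: "\<forall>z\<in>E1. \<kappa> z > 0"
    and \<kappa>_logplus: "(\<integral>\<^sup>+ \<omega>. ennreal (logplus (\<kappa> (Z 0 \<omega>))) \<partial>M) < \<infinity>"
    and \<kappa>_logneg: "(\<integral>\<^sup>+ \<omega>. ennreal (ln (\<kappa> (Z 0 \<omega>))) \<partial>M)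
                    < (\<integral>\<^sup>+ \<omega>. ennreal (- ln (\<kappa> (Z 0 \<omega>))) \<partial>M)"
    and contr: "\<forall>x y. \<forall>z\<in>E1.
          (\<integral>\<^sup>+ \<omega>. ennreal (dist (F x z (eps 0 \<omega>)) (F y z (eps 0 \<omega>)) powr p) \<partial>M)
            \<le> ennreal (\<kappa> z powr p * dist x y powr p)"
    and A2_moment: "(\<integral>\<^sup>+ \<omega>. ennreal (logplus (enn2real
            (\<integral>\<^sup>+ u. ennreal (dist x0 (F x0 (Z 0 \<omega>) u) powr p) \<partial>(distr M borel (eps 1)))))
          \<partial>M) < \<infinity>"
  shows "\<exists>X :: int \<Rightarrow> 'e \<Rightarrow> 'a \<Rightarrow> 'e.
     \<comment> \<open>1.\<close>
     (\<forall>t x. X t x \<in> borel_measurable M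
        \<and> (AE \<omega> in M. nn_cond_exp M (proc_sigma M UNIV Z)
                          (\<lambda>\<omega>. ennreal (dist (X t x \<omega>) x0 powr p)) \<omega> < \<infinity>)
        \<and> (AE \<omega> in M. (\<lambda>s. nn_cond_exp M (proc_sigma M UNIV Z)
                          (\<lambda>\<omega>. ennreal (dist (iterF F Z eps t (Suc s) x \<omega>) (X t x \<omega>) powr p)) \<omega>)
                       \<longlonglongrightarrow> 0)
        \<and> (AE \<omega> in M. (\<lambda>s. iterF F Z eps t (Suc s) x \<omega>) \<longlonglongrightarrow> X t x \<omega>))
     \<comment> \<open>2.\<close>
   \<and> (\<forall>t x y. x \<noteq> y \<longrightarrow> measure M {\<omega> \<in> space M. X t x \<omega> \<noteq> X t y \<omega>} = 0)
     \<comment> \<open>3. (with X_t := X_t(x0))\<close>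
   \<and> ergodic_process M (\<lambda>t \<omega>. (X t x0 \<omega>, Z t \<omega>))
     \<comment> \<open>4.\<close>
   \<and> (\<forall>Y :: int \<Rightarrow> 'a \<Rightarrow> 'e.
        (\<forall>t. Y t \<in> measurable (proc_sigma M {..t} (\<lambda>j \<omega>. (Z j \<omega>, eps j \<omega>))) borel)
        \<and> stationary_process M (\<lambda>t \<omega>. (Y t \<omega>, Z t \<omega>))
        \<and> (\<forall>t. AE \<omega> in M. Y t \<omega> = F (Y (t - 1) \<omega>) (Z (t - 1) \<omega>) (eps t \<omega>))
        \<and> (AE \<omega> in M. nn_cond_exp M (proc_sigma M {..0} Z)
                          (\<lambda>\<omega>. ennreal (dist (Y 0 \<omega>) x0 powr p)) \<omega> < \<infinity>)
        \<longrightarrow> (\<forall>t. AE \<omega> in M. Y t \<omega> = X t x0 \<omega>))"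
proof -
  interpret prob_space M by fact
  txt \<open>\<open>F\<close> and \<open>\<kappa>\<close> are only measurable on \<open>E1\<close>; outside they are replaced by constants.\<close>
  define F' where "F' x z u = (if z \<in> E1 then F x z u else x0)" for x z u
  define \<kappa>' where "\<kappa>' z = (if z \<in> E1 then \<kappa> z else 1)" for z
  have F'[simp]: "F' x (Z t \<omega>) u = F x (Z t \<omega>) u" if "\<omega> \<in> space M" for x t \<omega> u
    using Z_vals that by (simp add: F'_def)
  have \<kappa>'[simp]: "\<kappa>' (Z t \<omega>) = \<kappa> (Z t \<omega>)" if "\<omega> \<in> space M" for t \<omega>
    using Z_vals that by (simp add: \<kappa>'_def)
  have F'_meas: "(\<lambda>(x, z, w). F' x z w) \<in> borel \<Otimes>\<^sub>M borel \<Otimes>\<^sub>M borel \<rightarrow>\<^sub>M borel"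
    using measurable_extend_middle[OF E1 F_meas, of x0] by (simp add: F'_def)
  have F'_u[measurable]: "F' x z \<in> borel_measurable borel" for x z
  proof -
    have "(\<lambda>u. (x, z, u)) \<in> borel \<rightarrow>\<^sub>M borel \<Otimes>\<^sub>M borel \<Otimes>\<^sub>M borel" by simp
    from measurable_compose[OF this F'_meas] show ?thesis by simp
  qed
  have \<kappa>'_meas: "\<kappa>' \<in> borel_measurable borel"
    unfolding \<kappa>'_def using E1 \<kappa>_meas by (subst measurable_If_restrict_space_iff) (auto simp: Collect_mem_eq)
  have eps_meas[measurable]: "eps t \<in> borel_measurable M" for t
    using eps_indep by (auto simp: indep_vars_def)
  have distr_eps: "(\<integral>\<^sup>+ u. g u \<partial>distr M borel (eps 0)) = (\<integral>\<^sup>+ \<omega>. g (eps t \<omega>) \<partial>M)"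
    if "g \<in> borel_measurable borel" for g :: "'w \<Rightarrow> ennreal" and t
    using that eps_ident[rule_format, of t] nn_integral_distr[OF eps_meas[of t], of g] by simp
  interpret random_maps M Z eps F' \<kappa>' p x0
  proof (unfold_locales, fact Z_erg, fact eps_indep)
    show "distr M borel (eps t) = distr M borel (eps 0)" for t using eps_ident by blast
    show "indep_set (sets (proc_sigma M UNIV Z)) (sets (proc_sigma M UNIV eps))" by fact
    show "(\<lambda>(x, z, w). F' x z w) \<in> borel \<Otimes>\<^sub>M borel \<Otimes>\<^sub>M borel \<rightarrow>\<^sub>M borel" by fact
    show "0 < p" using p by simp
    show "\<kappa>' \<in> borel_measurable borel" by fact
    \<comment> \<open>Outside \<open>E1\<close> the value 1 gives positivity, and \<open>F'\<close>
      is constantly \<open>x0\<close> there, so the contraction and moment conditions below hold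
      with left-hand side 0.\<close>
    show "0 < \<kappa>' z" for z using \<kappa>_pos by (simp add: \<kappa>'_def)
    show "(\<integral>\<^sup>+ \<omega>. ennreal (ln (\<kappa>' (Z 0 \<omega>))) \<partial>M) < (\<integral>\<^sup>+ \<omega>. ennreal (- ln (\<kappa>' (Z 0 \<omega>))) \<partial>M)"
      using \<kappa>_logneg by (simp cong: nn_integral_cong)
    show "(\<integral>\<^sup>+ u. ennreal (dist (F' x z u) (F' y z u) powr p) \<partial>distr M borel (eps 0))
        \<le> ennreal (\<kappa>' z powr p * dist x y powr p)" for x y z
    proof (cases "z \<in> E1")
      case True
      have "(\<integral>\<^sup>+ u. ennreal (dist (F' x z u) (F' y z u) powr p) \<partial>distr M borel (eps 0)) =
          (\<integral>\<^sup>+ \<omega>. ennreal (dist (F' x z (eps 0 \<omega>)) (F' y z (eps 0 \<omega>)) powr p) \<partial>M)"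
        by (rule distr_eps) measurable
      then show ?thesis using contr True by (simp add: F'_def \<kappa>'_def)
    next
      case False
      then show ?thesis by (simp add: F'_def)
    qed
    show "(\<integral>\<^sup>+ u. ennreal (dist (F' x0 z u) x0 powr p) \<partial>distr M borel (eps 0)) < \<infinity>" for z
    proof (cases "z \<in> E1")
      case True
      have "(\<integral>\<^sup>+ u. ennreal (dist (F' x0 z u) x0 powr p) \<partial>distr M borel (eps 0)) =
          (\<integral>\<^sup>+ \<omega>. ennreal (dist (F' x0 z (eps 1 \<omega>)) x0 powr p) \<partial>M)"
        by (rule distr_eps) measurable
      then show ?thesis using A1 True by (simp add: F'_def)
    next
      case False
      then show ?thesis by (simp add: F'_def)
    qed
    have "(\<integral>\<^sup>+ \<omega>. ennreal (logplus (enn2real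
          (\<integral>\<^sup>+ u. ennreal (dist (F' x0 (Z 0 \<omega>) u) x0 powr p) \<partial>distr M borel (eps 0)))) \<partial>M) =
        (\<integral>\<^sup>+ \<omega>. ennreal (logplus (enn2real
          (\<integral>\<^sup>+ u. ennreal (dist x0 (F x0 (Z 0 \<omega>) u) powr p) \<partial>distr M borel (eps 1)))) \<partial>M)"
      using eps_ident[rule_format, of 1] by (intro nn_integral_cong) (simp add: dist_commute)
    then show "(\<integral>\<^sup>+ \<omega>. ennreal (logplus (enn2real
          (\<integral>\<^sup>+ u. ennreal (dist (F' x0 (Z 0 \<omega>) u) x0 powr p) \<partial>distr M borel (eps 0)))) \<partial>M) < \<infinity>"
      using A2_moment by simp
  qed
  have iter: "iterF F Z eps t n x \<omega> = f t n x \<omega>" if "\<omega> \<in> space M" for t n x \<omega>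
    using that by (intro iterF_cong) simp
  have iter_meas[measurable]: "iterF F Z eps t n x \<in> borel_measurable M" for t n x
    using iterF_meas[of t n x] by (simp add: iter cong: measurable_cong)
  show ?thesis
  proof (intro exI[of _ X] conjI allI impI)
    fix t x
    show "X t x \<in> borel_measurable M" by simp
    show "AE \<omega> in M. nn_cond_exp M (proc_sigma M UNIV Z) (\<lambda>\<omega>. ennreal (dist (X t x \<omega>) x0 powr p)) \<omega> < \<infinity>"
      by (rule convergence)
    \<comment> \<open>\<open>F\<close> and \<open>F'\<close> give the same iterates on
      \<open>space M\<close>, so the conditional expectations agree almost surely for each
      \<open>s\<close>, and by countability for all \<open>s\<close> at once.\<close>
    have "AE \<omega> in M. nn_cond_exp M (proc_sigma M UNIV Z)
        (\<lambda>\<omega>. ennreal (dist (iterF F Z eps t (Suc s) x \<omega>) (X t x \<omega>) powr p)) \<omega> =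
        nn_cond_exp M (proc_sigma M UNIV Z) (\<lambda>\<omega>. dp (f t (Suc s) x \<omega>) (X t x \<omega>)) \<omega>" for s
      by (rule Z.nn_cond_exp_cong) (auto intro!: AE_I2 simp: iter simp del: iterF.simps)
    then have "AE \<omega> in M. \<forall>s. nn_cond_exp M (proc_sigma M UNIV Z)
        (\<lambda>\<omega>. ennreal (dist (iterF F Z eps t (Suc s) x \<omega>) (X t x \<omega>) powr p)) \<omega> =
        nn_cond_exp M (proc_sigma M UNIV Z) (\<lambda>\<omega>. dp (f t (Suc s) x \<omega>) (X t x \<omega>)) \<omega>"
      by (subst AE_all_countable) blast
    then show "AE \<omega> in M. (\<lambda>s. nn_cond_exp M (proc_sigma M UNIV Z)
        (\<lambda>\<omega>. ennreal (dist (iterF F Z eps t (Suc s) x \<omega>) (X t x \<omega>) powr p)) \<omega>) \<longlonglongrightarrow> 0"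
      using convergence(2)[of t x]
    proof eventually_elim
      case (elim \<omega>)
      \<comment> \<open>The composition from time \<open>t - s\<close> to \<open>t\<close> has
        \<open>s + 1\<close> factors, hence the shift of the index.\<close>
      show ?case using LIMSEQ_Suc[OF elim(2)] elim(1) by (simp del: iterF.simps)
    qed
    show "AE \<omega> in M. (\<lambda>s. iterF F Z eps t (Suc s) x \<omega>) \<longlonglongrightarrow> X t x \<omega>"
      using convergence(1)[of t x] AE_space
    proof eventually_elim
      case (elim \<omega>)
      show ?case using LIMSEQ_Suc[OF elim(1)] iter[OF elim(2)] by (simp del: iterF.simps)
    qed
  next
    fix t and x y :: 'e
    have "AE \<omega> in M. \<not> X t x \<omega> \<noteq> X t y \<omega>" using X_start_irrelevant[of t x y] by simp
    \<comment> \<open>Measurability of the event that the limits differ is obtained through the real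
      function \<open>dist\<close>.\<close>
    moreover have "{\<omega>\<in>space M. dist (X t x \<omega>) (X t y \<omega>) \<noteq> 0} \<in> sets M" by measurable
    ultimately show "measure M {\<omega> \<in> space M. X t x \<omega> \<noteq> X t y \<omega>} = 0"
      by (intro measure_eq_0_null_sets) (simp add: AE_iff_null)
  next
    show "ergodic_process M (\<lambda>t \<omega>. (X t x0 \<omega>, Z t \<omega>))" by (rule XZ_ergodic)
  next
    fix Y t
    assume Y: "(\<forall>t. Y t \<in> measurable (proc_sigma M {..t} (\<lambda>j \<omega>. (Z j \<omega>, eps j \<omega>))) borel)
        \<and> stationary_process M (\<lambda>t \<omega>. (Y t \<omega>, Z t \<omega>))
        \<and> (\<forall>t. AE \<omega> in M. Y t \<omega> = F (Y (t - 1) \<omega>) (Z (t - 1) \<omega>) (eps t \<omega>))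
        \<and> (AE \<omega> in M. nn_cond_exp M (proc_sigma M {..0} Z)
                          (\<lambda>\<omega>. ennreal (dist (Y 0 \<omega>) x0 powr p)) \<omega> < \<infinity>)"
    show "AE \<omega> in M. Y t \<omega> = X t x0 \<omega>"
    proof (rule stationary_solution_unique)
      fix t
      have "AE \<omega> in M. Y t \<omega> = F (Y (t - 1) \<omega>) (Z (t - 1) \<omega>) (eps t \<omega>)" using Y by blast
      then show "AE \<omega> in M. Y t \<omega> = F' (Y (t - 1) \<omega>) (Z (t - 1) \<omega>) (eps t \<omega>)"
        using AE_space by eventually_elim simp
    qed (use Y in auto)
  qed
qed

end
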